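(* Let $N\ge 3$, let $q\in\mathbb C^{\times}$ be generic, let $d\in\mathbb C^\times$ and put $p=d^{-N}$. Let $\mathcal A$ be the associative algebra generated by the coefficients of the formal series $E_i(z),F_i(z),K_i^{\pm}(z)$ ($0\le i\le N-1$) of operators on $V_Q$. Then the linear map $\pi$ given by $$\pi(e_i(z))=E_i(z),\quad \pi(f_i(z))=F_i(z),\quad \pi(k_i^{\pm}(z))=K_i^{\pm}(z),\quad \pi(k_i^{\pm1})=K_i^{\pm}\qquad(0\le i\le N-1),\qquad \pi(c)=q^{1/2},$$ yields an algebra homomorphism from the quantum toroidal algebra $U_q(\mathfrak{sl}_{N,tor})$ to $\mathcal A$.
   Context: Generic $q$: nonzero and not a root of unity; square roots $q^{1/2},p^{1/2}$ are fixed. $\delta(z)=\sum_{k\in\mathbb Z}z^k$. **Quantum toroidal algebra.** For $0\le i,j\le N-1$ read indices modulo $N$ and set $a_{ij}=2\delta_{i,j}-\delta_{i,j+1}-\delta_{i+1,j}$ (affine Cartan matrix of type $A^{(1)}_{N-1}$) and $m_{ij}=\delta_{i,j+1}-\delta_{j,i+1}$ (Kronecker deltas modulo $N$). Let $\theta_m(z)=\frac{q^mz-1}{z-q^m}$, expanded as a Taylor series in $z$. $U_q(\mathfrak{sl}_{N,tor})$ is the unital associative $\mathbb C$-algebra generated by $e_{i,k},f_{i,k},h_{i,l},k_i^{\pm1}$ ($0\le i\le N-1$, $k\in\mathbb Z$, $l\in\mathbb Z\setminus\{0\}$) and central $c^{\pm1}$. With $e_i(z)=\sum_k e_{i,k}z^{-k}$,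 $f_i(z)=\sum_k f_{i,k}z^{-k}$, $k_i^{\pm}(z)=k_i^{\pm1}\exp(\pm(q-q^{-1})\sum_{k\ge1}h_{i,\pm k}z^{\mp k})$, the relations are: - $k_ik_i^{-1}=k_i^{-1}k_i=cc^{-1}=1$, $[k_i^{\pm}(z),k_j^{\pm}(w)]=0$; - $\theta_{-a_{ij}}(c^2d^{-m_{ij}}\frac wz)k_i^+(z)k_j^-(w)=\theta_{-a_{ij}}(c^{-2}d^{-m_{ij}}\frac wz)k_j^-(w)k_i^+(z)$; - $k_i^{\pm}(z)e_j(w)=\theta_{\mp a_{ij}}(c^{-1}d^{\mp m_{ij}}(\frac wz)^{\pm1})e_j(w)k_i^{\pm}(z)$; - $k_i^{\pm}(z)f_j(w)=\theta_{\pm a_{ij}}(c\,d^{\mp m_{ij}}(\frac wz)^{\pm1})f_j(w)k_i^{\pm}(z)$; - $[e_i(z),f_j(w)]=\frac{\delta_{ij}}{q-q^{-1}}\big(\delta(c^{-2}\frac zw)k_i^+(cw)-\delta(c^2\frac zw)k_i^-(cz)\big)$; - $(d^{m_{ij}}z-q^{a_{ij}}w)e_i(z)e_j(w)=(q^{a_{ij}}d^{m_{ij}}z-w)e_j(w)e_i(z)$; - $(q^{a_{ij}}d^{m_{ij}}z-w)f_i(z)f_j(w)=(d^{m_{ij}}z-q^{a_{ij}}w)f_j(w)f_i(z)$; - if $a_{ij}=-1$: $\{e_i(z_1)e_i(z_2)e_j(w)-(q+q^{-1})e_i(z_1)e_j(w)e_i(z_2)+e_j(w)e_i(z_1)e_i(z_2)\}+\{z_1\leftrightarrow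 z_2\}=0$, and the same with $f$ in place of $e$; - if $a_{ij}=0$: $[e_i(z),e_j(w)]=[f_i(z),f_j(w)]=0$. **Fock space.** Let $\bigoplus_{i=1}^N\mathbb Z\epsilon_i$ carry the form $(\epsilon_i,\epsilon_j)=\delta_{ij}$, and let $Q=\bigoplus_{i=1}^{N-1}\mathbb Z(\epsilon_i-\epsilon_{i+1})$. Put $\epsilon_{i+N}=\epsilon_i$ for $i\in\mathbb Z$. Let $\varepsilon:Q\times Q\to\{\pm1\}$ be bimultiplicative with $\varepsilon(\alpha,\alpha)=(-1)^{(\alpha,\alpha)/2}$. On the group algebra $\mathbb C[Q]=\bigoplus_{\alpha\in Q}\mathbb Ce^\alpha$ let $e_\beta e^\alpha=\varepsilon(\beta,\alpha)e^{\alpha+\beta}$ ($\beta\in Q$), and for $\beta$ in $\bigoplus\mathbb Z\epsilon_i$ let $z^\beta e^\alpha=z^{(\beta,\alpha)}e^\alpha$ and $\mu^\beta e^\alpha=\mu^{(\beta,\alpha)}e^\alpha$ ($\mu\in\mathbb C^\times$); $z^{\beta+s}:=z^sz^\beta$ and $\mu^{\beta+s}:=\mu^s\mu^\beta$ for scalars $s$. The Heisenberg algebra has generators $\epsilon_i(n)$ ($1\le i\le N$, $n\ne0$) with $[\epsilon_i(m),\epsilon_j(n)]=m\delta_{ij}\delta_{m+n,0}C$, $C$ central. It acts on $S(\mathcal H^-)=\mathbb C[\epsilon_i(-n):1\le i\le N,n\ge1]$ with $C=1$, $\epsilon_i(-n)$ by multiplication and $\epsilon_i(n)$ by $n\,\partial/\partial\epsilon_i(-n)$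 ($n\ge1$). $V_Q=S(\mathcal H^-)\otimes\mathbb C[Q]$. **Vertex operators.** For $i\in\mathbb Z$ put $\epsilon_{i+N}(n)=\epsilon_i(n)$. For $\alpha=\pm\epsilon_i$ let $E_\pm(\alpha,z)=\exp\big(\mp\sum_{n\ge1}\frac{\alpha(\pm n)}nz^{\mp n}\big)$, where $(-\epsilon_i)(n)=-\epsilon_i(n)$. For $r,i,j\in\mathbb Z$, $$X_{ij}(r,z)=E_-(\epsilon_i,z)E_-(-\epsilon_j,zq^{i-j}p^r)E_+(\epsilon_i,z)E_+(-\epsilon_j,zq^{j-i}p^r)\,e_{\epsilon_i-\epsilon_j}\,z^{\epsilon_i-\epsilon_j+\frac{(\epsilon_i-\epsilon_j,\epsilon_i-\epsilon_j)}2}\,p^{-r\epsilon_j-\frac{(\epsilon_j,\epsilon_i-\epsilon_j)}2r},$$ and for $i\ne j$ $$u_{ij}(r,z)=q^{(j-i)(\epsilon_i-\epsilon_j)}\exp\Big(\sum_{n\ge1}\tfrac{q^{(j-i)n}-q^{(i-j)n}}n\big(q^{\frac{j-i}2n}\epsilon_i(n)-p^{-nr}q^{\frac{i-j}2n}\epsilon_j(n)\big)z^{-n}\Big),$$ $$v_{ij}(r,z)=q^{(i-j)(\epsilon_i-\epsilon_j)}\exp\Big(\sum_{n\ge1}\tfrac{q^{(i-j)n}-q^{(j-i)n}}n\big(q^{\frac{j-i}2n}\epsilon_i(-n)-p^{nr}q^{\frac{i-j}2n}\epsilon_j(-n)\big)z^{n}\Big).$$ For $1\le i\le N-1$: $E_i(z)=X_{i,i+1}(0,p^{1/2}d^iz)$,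 $F_i(z)=X_{i+1,i}(0,p^{1/2}d^iz)$, $K_i^+(z)=u_{i,i+1}(0,p^{1/2}d^iz)$, $K_i^-(z)=v_{i,i+1}(0,p^{1/2}d^iz)$. Moreover $E_0(z)=X_{01}(1,p^{-1/2}z)$, $F_0(z)=X_{10}(-1,p^{1/2}z)$, $K_0^+(z)=u_{01}(1,p^{-1/2}z)$, $K_0^-(z)=v_{01}(1,p^{-1/2}z)$. For $0\le i\le N-1$, $K_i^{\pm}=q^{\pm(\epsilon_i-\epsilon_{i+1})}$.
   Formalization: The formal theorem has π(f_i(z)) = −F_i(z) instead of F_i(z): since ε(α,α) = −1 for a root α, the stated map gives [E_{i,0},F_{i,0}]e^α = −(q+q^{-1})e^α for α = ε_i−ε_{i+1}, while the defining relation requires +(q+q^{-1})e^α. *)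

theory Defs
  imports
    "HOL-Library.Poly_Mapping"
    "HOL-Library.FuncSet"
    "HOL-Computational_Algebra.Formal_Power_Series"
    "HOL-Algebra.QuotRing"
    "HOL-Algebra.Module"
begin

section \<open>Complex algebras\<close>

text \<open>
  An associative unital complex algebra is given by a record of type \<open>(complex, 'a) module\<close>, i.e. a
  ring record together with a scalar multiplication. (The locale \<^locale>\<open>algebra\<close> of HOL-Algebra
  is restricted to commutative algebras, so only the record is used.)
\<close>

definition alg_hom :: "(complex, 'a) module \<Rightarrow> (complex, 'b) module \<Rightarrow> ('a \<Rightarrow> 'b) set" where
  "alg_hom A B = {h \<in> ring_hom A B.
     \<forall>c. \<forall>x \<in> carrier A. h (c \<odot>\<^bsub>A\<^esub> x) = c \<odot>\<^bsub>B\<^esub> h x}"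

definition quot_alg :: "(complex, 'a) module \<Rightarrow> 'a set \<Rightarrow> (complex, 'a set) module" where
  "quot_alg A I =
     \<lparr>carrier = carrier (A Quot I), mult = mult (A Quot I), one = one (A Quot I),
      zero = zero (A Quot I), add = add (A Quot I),
      smult = (\<lambda>c X. \<Union>x\<in>X. I +>\<^bsub>A\<^esub> (c \<odot>\<^bsub>A\<^esub> x))\<rparr>"

inductive_set generated_carrier :: "(complex, 'a) module \<Rightarrow> 'a set \<Rightarrow> 'a set"
  for A :: "(complex, 'a) module" and S :: "'a set"
  where
    gen: "x \<in> S \<Longrightarrow> x \<in> generated_carrier A S"
  | one: "\<one>\<^bsub>A\<^esub> \<in> generated_carrier A S"
  | add: "x \<in> generated_carrier A S \<Longrightarrow> y \<in> generated_carrier A S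
            \<Longrightarrow> x \<oplus>\<^bsub>A\<^esub> y \<in> generated_carrier A S"
  | mult: "x \<in> generated_carrier A S \<Longrightarrow> y \<in> generated_carrier A S
            \<Longrightarrow> x \<otimes>\<^bsub>A\<^esub> y \<in> generated_carrier A S"
  | smult: "x \<in> generated_carrier A S \<Longrightarrow> c \<odot>\<^bsub>A\<^esub> x \<in> generated_carrier A S"

definition generated_subalg :: "(complex, 'a) module \<Rightarrow> 'a set \<Rightarrow> (complex, 'a) module" where
  "generated_subalg A S = A\<lparr>carrier := generated_carrier A S\<rparr>"

definition cscale :: "complex \<Rightarrow> ('b \<Rightarrow>\<^sub>0 complex) \<Rightarrow> ('b \<Rightarrow>\<^sub>0 complex)"  (infixr \<open>*\<^sub>C\<close> 75) where
  "c *\<^sub>C x = Poly_Mapping.map ((*) c) x"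


subsection \<open>Free algebras and presentations\<close>

datatype 'a free_monoid = Word (letters: "'a list")

instantiation free_monoid :: (type) monoid_add
begin
definition "0 = Word []"
definition "v + w = Word (letters v @ letters w)"
instance
  by standard (simp_all add: zero_free_monoid_def plus_free_monoid_def)
end

text \<open>The product of \<open>'a free_alg\<close> is convolution over \<open>+\<close>, i.e. over concatenation of words.\<close>

type_synonym 'a free_alg = "'a free_monoid \<Rightarrow>\<^sub>0 complex"

definition gen :: "'a \<Rightarrow> 'a free_alg" where
  "gen x = Poly_Mapping.single (Word [x]) 1"

definition free_algebra :: "'a set \<Rightarrow> (complex, 'a free_alg) module" where
  "free_algebra X =
     \<lparr>carrier = {x. \<forall>w \<in> Poly_Mapping.keys x. set (letters w) \<subseteq> X},
      mult = (*), one = 1, zero = 0, add = (+), smult = cscale\<rparr>"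

definition presentation_ideal :: "'a set \<Rightarrow> 'a free_alg set \<Rightarrow> 'a free_alg set" where
  "presentation_ideal X R = Idl\<^bsub>free_algebra X\<^esub> R"

definition presented_algebra :: "'a set \<Rightarrow> 'a free_alg set \<Rightarrow> (complex, 'a free_alg set) module" where
  "presented_algebra X R = quot_alg (free_algebra X) (presentation_ideal X R)"


section \<open>The quantum toroidal algebra of type A\<close>

text \<open>
  \<open>GE i k, GF i k, GH i l, GK i, GKinv i, GC, GCinv\<close> are the generators
  $e_{i,k}, f_{i,k}, h_{i,l}, k_i, k_i^{-1}, c, c^{-1}$.
\<close>

datatype toroidal_gen =
  GE nat int | GF nat int | GH nat int | GK nat | GKinv nat | GC | GCinv

definition kron :: "nat \<Rightarrow> nat \<Rightarrow> nat \<Rightarrow> int" where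
  "kron N i j = (if i mod N = j mod N then 1 else 0)"

definition cartan :: "nat \<Rightarrow> nat \<Rightarrow> nat \<Rightarrow> int" where
  "cartan N i j = 2 * kron N i j - kron N i (j + 1) - kron N (i + 1) j"

definition mcoef :: "nat \<Rightarrow> nat \<Rightarrow> nat \<Rightarrow> int" where
  "mcoef N i j = kron N i (j + 1) - kron N j (i + 1)"

definition theta :: "complex \<Rightarrow> int \<Rightarrow> complex fps" where
  "theta q m = (fps_const (q powi m) * fps_X - 1) / (fps_X - fps_const (q powi m))"

text \<open>Exponential of a power series without constant term over the (noncommutative) free algebra.\<close>

definition free_exp :: "'a free_alg fps \<Rightarrow> 'a free_alg fps" where
  "free_exp F = Abs_fps (\<lambda>n. \<Sum>m\<le>n. (1 / fact m) *\<^sub>C fps_nth (F ^ m) n)"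

definition cpow :: "int \<Rightarrow> toroidal_gen free_alg" where
  "cpow n = (if n \<ge> 0 then gen GC ^ nat n else gen GCinv ^ nat (- n))"

definition toroidal_gens :: "nat \<Rightarrow> toroidal_gen set" where
  "toroidal_gens N =
     {GE i k | i k. i < N} \<union> {GF i k | i k. i < N} \<union> {GH i l | i l. i < N \<and> l \<noteq> 0}
     \<union> {GK i | i. i < N} \<union> {GKinv i | i. i < N} \<union> {GC, GCinv}"

context
  fixes N :: nat and q d :: complex
begin

text \<open>
  \<open>k_plus i n\<close> is the coefficient of $z^{-n}$ in $k_i^+(z)$, and \<open>k_minus i n\<close> is the coefficient
  of $z^{n}$ in $k_i^-(z)$.
\<close>

definition k_plus :: "nat \<Rightarrow> int \<Rightarrow> toroidal_gen free_alg" where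
  "k_plus i n = (if n < 0 then 0 else gen (GK i) * fps_nth (free_exp
     (Abs_fps (\<lambda>k. if k = 0 then 0 else (q - inverse q) *\<^sub>C gen (GH i (int k))))) (nat n))"

definition k_minus :: "nat \<Rightarrow> int \<Rightarrow> toroidal_gen free_alg" where
  "k_minus i n = (if n < 0 then 0 else gen (GKinv i) * fps_nth (free_exp
     (Abs_fps (\<lambda>k. if k = 0 then 0 else (- (q - inverse q)) *\<^sub>C gen (GH i (- int k))))) (nat n))"

private abbreviation (input) "a \<equiv> cartan N"
private abbreviation (input) "m \<equiv> mcoef N"
private abbreviation (input) "\<theta> \<equiv> \<lambda>k l. fps_nth (theta q k) l"
private abbreviation (input) "e \<equiv> \<lambda>i k. gen (GE i k)"
private abbreviation (input) "f \<equiv> \<lambda>i k. gen (GF i k)"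

text \<open>
  The relators are the coefficients of (left hand side) - (right hand side) of the defining
  relations, for $0 \le i,j < N$:
  \<^item> \<open>kp_km\<close>: coefficient of $z^{-r} w^{s}$;
  \<^item> \<open>kp_e\<close>, \<open>kp_f\<close>: coefficient of $z^{-r} w^{-l}$;
  \<^item> \<open>km_e\<close>, \<open>km_f\<close>: coefficient of $z^{r} w^{-l}$;
  \<^item> \<open>e_f\<close>, \<open>e_e\<close>, \<open>f_f\<close>: coefficient of $z^{-k} w^{-l}$;
  \<^item> \<open>serre_e\<close>, \<open>serre_f\<close>: coefficient of $z_1^{-k_1} z_2^{-k_2} w^{-l}$.

  In \<open>e_f\<close>: $\delta(c^{-2}z/w)k_i^+(cw)$ contributes to $z^{-k}w^{-l}$ only via $c^{2k}z^{-k}w^{k}$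
  times $c^{-k-l}w^{-k-l}$, and $\delta(c^{2}z/w)k_i^-(cz)$ only via $c^{2l}z^{l}w^{-l}$
  times $c^{-k-l}z^{-k-l}$.
\<close>

inductive_set toroidal_relators :: "toroidal_gen free_alg set" where
  k_kinv: "i < N \<Longrightarrow> gen (GK i) * gen (GKinv i) - 1 \<in> toroidal_relators"
| kinv_k: "i < N \<Longrightarrow> gen (GKinv i) * gen (GK i) - 1 \<in> toroidal_relators"
| c_cinv: "gen GC * gen GCinv - 1 \<in> toroidal_relators"
| cinv_c: "gen GCinv * gen GC - 1 \<in> toroidal_relators"
| c_central: "x \<in> toroidal_gens N \<Longrightarrow> gen GC * gen x - gen x * gen GC \<in> toroidal_relators"
| cinv_central:
    "x \<in> toroidal_gens N \<Longrightarrow> gen GCinv * gen x - gen x * gen GCinv \<in> toroidal_relators"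
| kp_kp: "i < N \<Longrightarrow> j < N \<Longrightarrow>
    k_plus i r * k_plus j s - k_plus j s * k_plus i r \<in> toroidal_relators"
| km_km: "i < N \<Longrightarrow> j < N \<Longrightarrow>
    k_minus i r * k_minus j s - k_minus j s * k_minus i r \<in> toroidal_relators"
| kp_km: "i < N \<Longrightarrow> j < N \<Longrightarrow>
    (\<Sum>n\<le>min r s. (\<theta> (- a i j) n * (d powi (- m i j)) ^ n) *\<^sub>C
        (cpow (2 * int n) * k_plus i (int r - int n) * k_minus j (int s - int n)))
    - (\<Sum>n\<le>min r s. (\<theta> (- a i j) n * (d powi (- m i j)) ^ n) *\<^sub>C
        (cpow (- 2 * int n) * k_minus j (int s - int n) * k_plus i (int r - int n)))
    \<in> toroidal_relators"
| kp_e: "i < N \<Longrightarrow> j < N \<Longrightarrow>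
    k_plus i (int r) * e j l
    - (\<Sum>n\<le>r. (\<theta> (- a i j) n * (d powi (- m i j)) ^ n) *\<^sub>C
        (cpow (- int n) * e j (l + int n) * k_plus i (int r - int n)))
    \<in> toroidal_relators"
| km_e: "i < N \<Longrightarrow> j < N \<Longrightarrow>
    k_minus i (int r) * e j l
    - (\<Sum>n\<le>r. (\<theta> (a i j) n * (d powi m i j) ^ n) *\<^sub>C
        (cpow (- int n) * e j (l - int n) * k_minus i (int r - int n)))
    \<in> toroidal_relators"
| kp_f: "i < N \<Longrightarrow> j < N \<Longrightarrow>
    k_plus i (int r) * f j l
    - (\<Sum>n\<le>r. (\<theta> (a i j) n * (d powi (- m i j)) ^ n) *\<^sub>C
        (cpow (int n) * f j (l + int n) * k_plus i (int r - int n)))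
    \<in> toroidal_relators"
| km_f: "i < N \<Longrightarrow> j < N \<Longrightarrow>
    k_minus i (int r) * f j l
    - (\<Sum>n\<le>r. (\<theta> (- a i j) n * (d powi m i j) ^ n) *\<^sub>C
        (cpow (int n) * f j (l - int n) * k_minus i (int r - int n)))
    \<in> toroidal_relators"
| e_f: "i < N \<Longrightarrow> j < N \<Longrightarrow>
    e i k * f j l - f j l * e i k
    - (of_int (kron N i j) / (q - inverse q)) *\<^sub>C
        (cpow (k - l) * k_plus i (k + l) - cpow (l - k) * k_minus i (- k - l))
    \<in> toroidal_relators"
| e_e: "i < N \<Longrightarrow> j < N \<Longrightarrow>
    (d powi m i j) *\<^sub>C (e i (k + 1) * e j l) - (q powi a i j) *\<^sub>C (e i k * e j (l + 1))
    - ((q powi a i j * d powi m i j) *\<^sub>C (e j l * e i (k + 1)) - e j (l + 1) * e i k)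
    \<in> toroidal_relators"
| f_f: "i < N \<Longrightarrow> j < N \<Longrightarrow>
    (q powi a i j * d powi m i j) *\<^sub>C (f i (k + 1) * f j l) - f i k * f j (l + 1)
    - ((d powi m i j) *\<^sub>C (f j l * f i (k + 1)) - (q powi a i j) *\<^sub>C (f j (l + 1) * f i k))
    \<in> toroidal_relators"
| serre_e: "i < N \<Longrightarrow> j < N \<Longrightarrow> a i j = -1 \<Longrightarrow>
    (e i k\<^sub>1 * e i k\<^sub>2 * e j l - (q + inverse q) *\<^sub>C (e i k\<^sub>1 * e j l * e i k\<^sub>2)
      + e j l * e i k\<^sub>1 * e i k\<^sub>2)
    + (e i k\<^sub>2 * e i k\<^sub>1 * e j l - (q + inverse q) *\<^sub>C (e i k\<^sub>2 * e j l * e i k\<^sub>1)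
      + e j l * e i k\<^sub>2 * e i k\<^sub>1)
    \<in> toroidal_relators"
| serre_f: "i < N \<Longrightarrow> j < N \<Longrightarrow> a i j = -1 \<Longrightarrow>
    (f i k\<^sub>1 * f i k\<^sub>2 * f j l - (q + inverse q) *\<^sub>C (f i k\<^sub>1 * f j l * f i k\<^sub>2)
      + f j l * f i k\<^sub>1 * f i k\<^sub>2)
    + (f i k\<^sub>2 * f i k\<^sub>1 * f j l - (q + inverse q) *\<^sub>C (f i k\<^sub>2 * f j l * f i k\<^sub>1)
      + f j l * f i k\<^sub>2 * f i k\<^sub>1)
    \<in> toroidal_relators"
| e_commute: "i < N \<Longrightarrow> j < N \<Longrightarrow> a i j = 0 \<Longrightarrow>
    e i k * e j l - e j l * e i k \<in> toroidal_relators"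
| f_commute: "i < N \<Longrightarrow> j < N \<Longrightarrow> a i j = 0 \<Longrightarrow>
    f i k * f j l - f j l * f i k \<in> toroidal_relators"

definition toroidal_algebra :: "(complex, toroidal_gen free_alg set) module" where
  "toroidal_algebra = presented_algebra (toroidal_gens N) toroidal_relators"

definition tcls :: "toroidal_gen free_alg \<Rightarrow> toroidal_gen free_alg set" where
  "tcls x = presentation_ideal (toroidal_gens N) toroidal_relators
              +>\<^bsub>free_algebra (toroidal_gens N)\<^esub> x"

end


section \<open>The Fock space\<close>

text \<open>
  The indices of the $\epsilon_i$ are read modulo $N$ and represented by the residues
  \<open>0, \<dots>, N - 1\<close>, the residue \<open>0\<close> standing for the index $N$.
\<close>

type_synonym lattice = "nat \<Rightarrow>\<^sub>0 int"

definition eps_vec :: "nat \<Rightarrow> int \<Rightarrow> lattice" where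
  "eps_vec N i = frag_of (nat (i mod int N))"

definition lform :: "lattice \<Rightarrow> lattice \<Rightarrow> int" where
  "lform \<alpha> \<beta> = (\<Sum>i \<in> Poly_Mapping.keys \<alpha>. Poly_Mapping.lookup \<alpha> i * Poly_Mapping.lookup \<beta> i)"

definition root_lattice :: "nat \<Rightarrow> lattice set" where
  "root_lattice N =
     range (\<lambda>c :: int \<Rightarrow> int. \<Sum>i = 1..int N - 1. frag_cmul (c i) (eps_vec N i - eps_vec N (i + 1)))"

definition lattice_cocycle :: "nat \<Rightarrow> (lattice \<Rightarrow> lattice \<Rightarrow> complex) \<Rightarrow> bool" where
  "lattice_cocycle N \<epsilon> \<longleftrightarrow>
     (\<forall>\<alpha> \<in> root_lattice N. \<forall>\<beta> \<in> root_lattice N. \<epsilon> \<alpha> \<beta> \<in> {1, -1}) \<and>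
     (\<forall>\<alpha> \<in> root_lattice N. \<forall>\<beta> \<in> root_lattice N. \<forall>\<gamma> \<in> root_lattice N.
        \<epsilon> (\<alpha> + \<beta>) \<gamma> = \<epsilon> \<alpha> \<gamma> * \<epsilon> \<beta> \<gamma> \<and> \<epsilon> \<gamma> (\<alpha> + \<beta>) = \<epsilon> \<gamma> \<alpha> * \<epsilon> \<gamma> \<beta>) \<and>
     (\<forall>\<alpha> \<in> root_lattice N. \<epsilon> \<alpha> \<alpha> = (-1) powi (lform \<alpha> \<alpha> div 2))"

text \<open>
  The basis vector \<open>(\<mu>, \<alpha>)\<close> is the monomial $\prod \epsilon_i(-n)^{\mu(i,n)} \otimes e^\alpha$. The type
  \<open>fock\<close> is larger than $V_Q$, which is its subspace \<open>VQ N\<close>: the variables are restricted to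
  $\epsilon_i(-n)$ with $n \ge 1$ and \<open>i\<close> a residue modulo $N$, and $\alpha$ to $Q$.
\<close>

type_synonym fock_basis = "(nat \<times> nat \<Rightarrow>\<^sub>0 nat) \<times> lattice"
type_synonym fock = "fock_basis \<Rightarrow>\<^sub>0 complex"

definition VQ :: "nat \<Rightarrow> fock set" where
  "VQ N = {v. \<forall>(\<mu>, \<alpha>) \<in> Poly_Mapping.keys v.
                Poly_Mapping.keys \<mu> \<subseteq> {..<N} \<times> {1..} \<and> \<alpha> \<in> root_lattice N}"

definition linext :: "(fock_basis \<Rightarrow> fock) \<Rightarrow> fock \<Rightarrow> fock" where
  "linext g v = (\<Sum>b \<in> Poly_Mapping.keys v. Poly_Mapping.lookup v b *\<^sub>C g b)"

text \<open>\<open>heis N i n\<close> is the action of $\epsilon_i(n)$; the value at \<open>n = 0\<close> is irrelevant.\<close>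

definition heis :: "nat \<Rightarrow> int \<Rightarrow> int \<Rightarrow> fock \<Rightarrow> fock" where
  "heis N i n = linext (\<lambda>(\<mu>, \<alpha>).
     let x = (nat (i mod int N), nat \<bar>n\<bar>) in
     if n < 0 then Poly_Mapping.single (\<mu> + Poly_Mapping.single x 1, \<alpha>) 1
     else Poly_Mapping.single (\<mu> - Poly_Mapping.single x 1, \<alpha>) (of_int n * of_nat (Poly_Mapping.lookup \<mu> x)))"

definition e_op :: "(lattice \<Rightarrow> lattice \<Rightarrow> complex) \<Rightarrow> lattice \<Rightarrow> fock \<Rightarrow> fock" where
  "e_op \<epsilon> \<beta> = linext (\<lambda>(\<mu>, \<alpha>). Poly_Mapping.single (\<mu>, \<alpha> + \<beta>) (\<epsilon> \<beta> \<alpha>))"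

text \<open>The operator $\mu^\beta$ for a nonzero scalar $\mu$.\<close>

definition scalar_op :: "complex \<Rightarrow> lattice \<Rightarrow> fock \<Rightarrow> fock" where
  "scalar_op c \<beta> = linext (\<lambda>(\<mu>, \<alpha>). Poly_Mapping.single (\<mu>, \<alpha>) (c powi lform \<beta> \<alpha>))"


subsection \<open>Formal series of operators\<close>

text \<open>
  A formal series $\sum_k A_k z^k$, $k \in \mathbb{Z}$, is the function $k \mapsto A_k$. All products
  and exponentials below are locally finite: applied to a vector, every coefficient is a sum
  with finitely many nonzero terms.
\<close>

type_synonym op_series = "int \<Rightarrow> fock \<Rightarrow> fock"

definition ser_const :: "(fock \<Rightarrow> fock) \<Rightarrow> op_series" where
  "ser_const T = (\<lambda>k v. if k = 0 then T v else 0)"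

definition ser_mult :: "op_series \<Rightarrow> op_series \<Rightarrow> op_series"  (infixr \<open>\<otimes>\<^sub>S\<close> 70) where
  "A \<otimes>\<^sub>S B = (\<lambda>k v. Sum_any (\<lambda>n. A (k - n) (B n v)))"

primrec ser_pow :: "op_series \<Rightarrow> nat \<Rightarrow> op_series" where
  "ser_pow A 0 = ser_const id"
| "ser_pow A (Suc n) = A \<otimes>\<^sub>S ser_pow A n"

definition ser_exp :: "op_series \<Rightarrow> op_series" where
  "ser_exp A = (\<lambda>k v. Sum_any (\<lambda>n. (1 / fact n) *\<^sub>C ser_pow A n k v))"

text \<open>The substitution of \<open>c z\<close> for \<open>z\<close>.\<close>

definition ser_subst :: "complex \<Rightarrow> op_series \<Rightarrow> op_series" where
  "ser_subst c A = (\<lambda>k v. (c powi k) *\<^sub>C A k v)"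

text \<open>The series $z^{\beta + s}$.\<close>

definition z_pow :: "lattice \<Rightarrow> int \<Rightarrow> op_series" where
  "z_pow \<beta> s = (\<lambda>k. linext (\<lambda>(\<mu>, \<alpha>).
     if lform \<beta> \<alpha> + s = k then Poly_Mapping.single (\<mu>, \<alpha>) 1 else 0))"


section \<open>Vertex operators\<close>

text \<open>\<open>E_plus N s i\<close> and \<open>E_minus N s i\<close> are $E_\pm(\alpha, z)$ for $\alpha = s\epsilon_i$, $s = \pm 1$.\<close>

definition E_plus :: "nat \<Rightarrow> complex \<Rightarrow> int \<Rightarrow> op_series" where
  "E_plus N s i = ser_exp (\<lambda>k v. if k < 0 then (- (s / of_int (- k))) *\<^sub>C heis N i (- k) v else 0)"

definition E_minus :: "nat \<Rightarrow> complex \<Rightarrow> int \<Rightarrow> op_series" where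
  "E_minus N s i = ser_exp (\<lambda>k v. if k > 0 then (s / of_int k) *\<^sub>C heis N i (- k) v else 0)"

text \<open>
  \<open>sq\<close> and \<open>sp\<close> are the chosen square roots of \<open>q\<close> and \<open>p\<close>; half-integral powers of \<open>q\<close> and \<open>p\<close>
  are integral powers of these.
\<close>

context
  fixes N :: nat and \<epsilon> :: "lattice \<Rightarrow> lattice \<Rightarrow> complex" and q sq p sp d :: complex
begin

definition X_op :: "int \<Rightarrow> int \<Rightarrow> int \<Rightarrow> op_series" where
  "X_op i j r =
    (let \<beta> = eps_vec N i - eps_vec N j in
     E_minus N 1 i \<otimes>\<^sub>S
     ser_subst (q powi (i - j) * p powi r) (E_minus N (-1) j) \<otimes>\<^sub>S
     E_plus N 1 i \<otimes>\<^sub>S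
     ser_subst (q powi (j - i) * p powi r) (E_plus N (-1) j) \<otimes>\<^sub>S
     ser_const (e_op \<epsilon> \<beta>) \<otimes>\<^sub>S
     z_pow \<beta> (lform \<beta> \<beta> div 2) \<otimes>\<^sub>S
     ser_const (\<lambda>v. (sp powi (- (lform (eps_vec N j) \<beta> * r))) *\<^sub>C
                    scalar_op p (frag_cmul (- r) (eps_vec N j)) v))"

definition u_op :: "int \<Rightarrow> int \<Rightarrow> int \<Rightarrow> op_series" where
  "u_op i j r =
     ser_const (scalar_op (q powi (j - i)) (eps_vec N i - eps_vec N j)) \<otimes>\<^sub>S
     ser_exp (\<lambda>k v. if k < 0 then
       (let n = - k in
        ((q powi ((j - i) * n) - q powi ((i - j) * n)) / of_int n) *\<^sub>C
        ((sq powi ((j - i) * n)) *\<^sub>C heis N i n v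
         - (p powi (- n * r) * sq powi ((i - j) * n)) *\<^sub>C heis N j n v)) else 0)"

definition v_op :: "int \<Rightarrow> int \<Rightarrow> int \<Rightarrow> op_series" where
  "v_op i j r =
     ser_const (scalar_op (q powi (i - j)) (eps_vec N i - eps_vec N j)) \<otimes>\<^sub>S
     ser_exp (\<lambda>n v. if n > 0 then
        ((q powi ((i - j) * n) - q powi ((j - i) * n)) / of_int n) *\<^sub>C
        ((sq powi ((j - i) * n)) *\<^sub>C heis N i (- n) v
         - (p powi (n * r) * sq powi ((i - j) * n)) *\<^sub>C heis N j (- n) v) else 0)"

definition E_ser :: "nat \<Rightarrow> op_series" where
  "E_ser i = (if i = 0 then ser_subst (inverse sp) (X_op 0 1 1)
              else ser_subst (sp * d ^ i) (X_op (int i) (int i + 1) 0))"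

definition F_ser :: "nat \<Rightarrow> op_series" where
  "F_ser i = (if i = 0 then ser_subst sp (X_op 1 0 (-1))
              else ser_subst (sp * d ^ i) (X_op (int i + 1) (int i) 0))"

text \<open>
  Sign: for $\alpha = \epsilon_i - \epsilon_{i+1}$ one has
  $e_\alpha e_{-\alpha} = \varepsilon(\alpha,-\alpha) = \varepsilon(\alpha,\alpha) = -1$. Hence
  $[E_i(z), F_i(w)]$ is the negative of what the relation for $[e_i(z), f_i(w)]$ prescribes
  (e.g. $[E_{i,0}, F_{i,0}]\,e^\alpha = -(q + q^{-1})e^\alpha$), all other relations being
  insensitive to the sign, and the representation of the toroidal algebra sends $f_i(z)$ to
  $-F_i(z)$.
\<close>

definition Kp_ser :: "nat \<Rightarrow> op_series" where
  "Kp_ser i = (if i = 0 then ser_subst (inverse sp) (u_op 0 1 1)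
               else ser_subst (sp * d ^ i) (u_op (int i) (int i + 1) 0))"

definition Km_ser :: "nat \<Rightarrow> op_series" where
  "Km_ser i = (if i = 0 then ser_subst (inverse sp) (v_op 0 1 1)
               else ser_subst (sp * d ^ i) (v_op (int i) (int i + 1) 0))"

text \<open>The operator $K_i^{+}$ (for \<open>s = 1\<close>), $K_i^{-}$ (for \<open>s = -1\<close>).\<close>

definition K_op :: "int \<Rightarrow> nat \<Rightarrow> fock \<Rightarrow> fock" where
  "K_op s i = scalar_op (q powi s) (eps_vec N (int i) - eps_vec N (int i + 1))"

end


section \<open>Operators on the Fock space\<close>

definition EndVQ :: "nat \<Rightarrow> (complex, fock \<Rightarrow> fock) module" where
  "EndVQ N =
     \<lparr>carrier = {T \<in> VQ N \<rightarrow>\<^sub>E VQ N.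
        (\<forall>x \<in> VQ N. \<forall>y \<in> VQ N. T (x + y) = T x + T y) \<and>
        (\<forall>c. \<forall>x \<in> VQ N. T (c *\<^sub>C x) = c *\<^sub>C T x)},
      mult = compose (VQ N), one = (\<lambda>v \<in> VQ N. v), zero = (\<lambda>v \<in> VQ N. 0),
      add = (\<lambda>S T. \<lambda>v \<in> VQ N. S v + T v), smult = (\<lambda>c T. \<lambda>v \<in> VQ N. c *\<^sub>C T v)\<rparr>"

text \<open>The coefficient of $z^k$ of a series, as an operator on $V_Q$.\<close>

definition coef :: "nat \<Rightarrow> op_series \<Rightarrow> int \<Rightarrow> fock \<Rightarrow> fock" where
  "coef N A k = restrict (A k) (VQ N)"

definition vertex_algebra ::
  "nat \<Rightarrow> (lattice \<Rightarrow> lattice \<Rightarrow> complex) \<Rightarrow> complex \<Rightarrow> complex \<Rightarrow> complex \<Rightarrow> complex \<Rightarrow> complex \<Rightarrow>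
   (complex, fock \<Rightarrow> fock) module" where
  "vertex_algebra N \<epsilon> q sq p sp d = generated_subalg (EndVQ N)
     (\<Union>i<N. range (coef N (E_ser N \<epsilon> q p sp d i)) \<union> range (coef N (F_ser N \<epsilon> q p sp d i)) \<union>
            range (coef N (Kp_ser N q sq p sp d i)) \<union> range (coef N (Km_ser N q sq p sp d i)))"

end

theory Submission
  imports Defs
begin

text \<open>
  The commutators of the operator series with the Heisenberg modes are multiples of the series
  themselves, shifted by the mode. An operator family with this property, a product of two or three
  of the series included, is therefore determined by its vacuum expectation values
  $\langle e^\gamma, T e^\alpha\rangle$, and these are lattice monomials times contraction
  series $\exp(\sum_n c_n X^n / n)$ whose exponents $c_n$ are sums of $n$-th powers. So every relation is an
  identity between products of the series $(1 - a X)^{\pm 1}$; the Serre relations only use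
  $(z - x) a(z) = 1$ for the expansions of $1/(z - x)$. The generator $f_i$ goes to $-F_i$, because
  $\varepsilon(\alpha, \alpha) = -1$ for a root $\alpha$ makes
  $e_\alpha e_{-\alpha} = -1$.
\<close>

text \<open>Expectation values are computed without reordering exponentials of operators. The Euler
  operator, the sum of epsilon_a(-n) epsilon_a(n), multiplies a monomial by its weight. Inserted to
  the left of the last operator, its annihilators lower the degree there and its creators move left
  until the vacuum functional kills them. The outcome is the recursion r F_r = \<Sum> c_n F_(r-n),
  which characterizes exp(\<Sum> c_n X^n / n). The lattice part of a leading coefficient is a
  constant times a character of the root lattice; the cocycle and the positions of adjacent nodes
  then produce all signs and powers of d. The currents E and -F follow one pattern, with a parameter
  Q equal to the inverse of q and to q, so their quadratic and Serre relations are proved once. N >=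
  3 keeps a node from being adjacent to another from both sides. In [e, f] the right-hand side
  depends on k + l up to a power of c, and it is treated as a family in two variables with the
  covariance of E F. The target algebra is generated by the series alone, so the images of the
  h_(i,l) have to be recovered from the exponentials that contain them.\<close>

abbreviation lookup where "lookup \<equiv> Poly_Mapping.lookup"
abbreviation single where "single \<equiv> Poly_Mapping.single"
abbreviation keys where "keys \<equiv> Poly_Mapping.keys"

lemma lookup_cscale [simp]: "lookup (c *\<^sub>C x) k = c * lookup x k"
  by (simp add: cscale_def map.rep_eq when_def)

lemma cscale_0 [simp]: "0 *\<^sub>C x = 0" and cscale_zero [simp]: "c *\<^sub>C 0 = 0"
  and cscale_1 [simp]: "1 *\<^sub>C x = x" and cscale_cscale [simp]: "a *\<^sub>C b *\<^sub>C x = (a * b) *\<^sub>C x"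
  and cscale_add: "c *\<^sub>C (x + y) = c *\<^sub>C x + c *\<^sub>C y"
  and cscale_diff: "c *\<^sub>C (x - y) = c *\<^sub>C x - c *\<^sub>C y"
  and cscale_add_left: "(a + b) *\<^sub>C x = a *\<^sub>C x + b *\<^sub>C x"
  and cscale_uminus_left: "(- a) *\<^sub>C x = - (a *\<^sub>C x)"
  and cscale_single [simp]: "c *\<^sub>C single k r = single k (c * r)"
  by (rule poly_mapping_eqI; simp add: lookup_add lookup_minus lookup_single when_def algebra_simps)+

lemma cscale_eq_0_iff [simp]: "c *\<^sub>C x = 0 \<longleftrightarrow> c = 0 \<or> x = 0"
  by (auto simp: poly_mapping_eq_iff fun_eq_iff)

lemma cscale_sum: "c *\<^sub>C sum f A = (\<Sum>a\<in>A. c *\<^sub>C f a)"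
  by (induction A rule: infinite_finite_induct) (auto simp: cscale_add)

lemma cscale_sum_left: "sum f A *\<^sub>C x = (\<Sum>a\<in>A. f a *\<^sub>C x)"
  by (induction A rule: infinite_finite_induct) (auto simp: cscale_add_left)

lemma keys_cscale: "keys (c *\<^sub>C x) \<subseteq> keys x"
  by (auto simp: in_keys_iff)

section \<open>Linear maps on finitely supported functions\<close>

definition lin :: "(('b \<Rightarrow>\<^sub>0 complex) \<Rightarrow> ('c \<Rightarrow>\<^sub>0 complex)) \<Rightarrow> bool" where
  "lin T \<longleftrightarrow> (\<forall>x y. T (x + y) = T x + T y) \<and> (\<forall>c x. T (c *\<^sub>C x) = c *\<^sub>C T x)"

lemma linI:
  "(\<And>x y. T (x + y) = T x + T y) \<Longrightarrow> (\<And>c x. T (c *\<^sub>C x) = c *\<^sub>C T x) \<Longrightarrow> lin T"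
  by (simp add: lin_def)

lemma lin_add: "lin T \<Longrightarrow> T (x + y) = T x + T y"
  and lin_cscale: "lin T \<Longrightarrow> T (c *\<^sub>C x) = c *\<^sub>C T x"
  by (simp_all add: lin_def)

lemma lin_0: "lin T \<Longrightarrow> T 0 = 0"
  using lin_cscale[of T 0 0] by simp

lemma lin_uminus: "lin T \<Longrightarrow> T (- x) = - T x"
  using lin_cscale[of T "-1" x] by (simp add: cscale_uminus_left)

lemma lin_diff: "lin T \<Longrightarrow> T (x - y) = T x - T y"
  using lin_add[of T x "- y"] by (simp add: lin_uminus)

lemma lin_sum: "lin T \<Longrightarrow> T (sum f A) = (\<Sum>a\<in>A. T (f a))"
  by (induction A rule: infinite_finite_induct) (auto simp: lin_0 lin_add)

lemma lin_Sum_any: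
  assumes "lin T" "finite {a. f a \<noteq> 0}"
  shows "T (Sum_any f) = Sum_any (\<lambda>a. T (f a))"
proof -
  have "{a. T (f a) \<noteq> 0} \<subseteq> {a. f a \<noteq> 0}"
    using lin_0[OF assms(1)] by auto
  with assms show ?thesis
    by (simp add: Sum_any.expand_superset[of "{a. f a \<noteq> 0}"] lin_sum)
qed

lemma lin_id: "lin (\<lambda>v. v)"
  by (simp add: lin_def)

lemma lin_zero: "lin (\<lambda>v. 0)"
  by (simp add: lin_def)

lemma lin_scale: "lin T \<Longrightarrow> lin (\<lambda>v. c *\<^sub>C T v)"
  by (simp add: lin_def cscale_add mult.commute)

lemma lin_plus: "lin S \<Longrightarrow> lin T \<Longrightarrow> lin (\<lambda>v. S v + T v)"
  by (simp add: lin_def cscale_add algebra_simps)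

lemma lin_minus: "lin S \<Longrightarrow> lin T \<Longrightarrow> lin (\<lambda>v. S v - T v)"
  by (simp add: lin_def cscale_diff algebra_simps)

lemma lin_comp: "lin S \<Longrightarrow> lin T \<Longrightarrow> lin (\<lambda>v. S (T v))"
  by (simp add: lin_def)

lemma lin_setsum: "(\<And>a. a \<in> A \<Longrightarrow> lin (T a)) \<Longrightarrow> lin (\<lambda>v. \<Sum>a\<in>A. T a v)"
  by (induction A rule: infinite_finite_induct) (auto intro: lin_zero lin_plus)

abbreviation bas :: "'b \<Rightarrow> ('b \<Rightarrow>\<^sub>0 complex)" where
  "bas b \<equiv> single b 1"

lemma basis_expansion: "v = (\<Sum>b\<in>keys v. lookup v b *\<^sub>C bas b)"
proof (rule poly_mapping_eqI)
  fix k
  show "lookup v k = lookup (\<Sum>b\<in>keys v. lookup v b *\<^sub>C bas b) k"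
    by (cases "k \<in> keys v") (auto simp: lookup_sum lookup_single when_def in_keys_iff)
qed

lemma lin_expansion:
  assumes "lin T"
  shows "T v = (\<Sum>b\<in>keys v. lookup v b *\<^sub>C T (bas b))"
proof -
  have "T v = T (\<Sum>b\<in>keys v. lookup v b *\<^sub>C bas b)"
    by (subst basis_expansion[of v]) simp
  also have "\<dots> = (\<Sum>b\<in>keys v. lookup v b *\<^sub>C T (bas b))"
    by (simp only: lin_sum[OF assms] lin_cscale[OF assms])
  finally show ?thesis .
qed

lemma lin_eqI:
  assumes "lin S" "lin T" "\<And>b. b \<in> keys v \<Longrightarrow> S (bas b) = T (bas b)"
  shows "S v = T v"
  by (simp add: lin_expansion[OF assms(1), of v] lin_expansion[OF assms(2), of v] assms(3))

text \<open>A nonzero matrix coefficient passes through some basis vector of v; this is how support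
  conditions stated on basis vectors reach arbitrary vectors and composites.\<close>

lemma lin_lookup_nonzero:
  assumes "lin T" "lookup (T v) b \<noteq> 0"
  obtains b' where "b' \<in> keys v" "lookup (T (bas b')) b \<noteq> 0"
proof -
  have "\<exists>b'\<in>keys v. lookup (T (bas b')) b \<noteq> 0"
  proof (rule ccontr)
    assume "\<not> (\<exists>b'\<in>keys v. lookup (T (bas b')) b \<noteq> 0)"
    then have "lookup (T v) b = 0"
      by (simp add: lin_expansion[OF assms(1), of v] lookup_sum)
    with assms(2) show False by simp
  qed
  with that show ?thesis by blast
qed

lemma lin_linext: "lin (linext g)"
proof (rule linI)
  fix x y :: fock
  have *: "linext g v = (\<Sum>b\<in>keys x \<union> keys y. lookup v b *\<^sub>C g b)" if "keys v \<subseteq> keys x \<union> keys y" for v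
    unfolding linext_def by (rule sum.mono_neutral_left) (use that in \<open>auto simp: in_keys_iff\<close>)
  show "linext g (x + y) = linext g x + linext g y"
    using keys_add[of x y] by (simp add: * lookup_add cscale_add_left sum.distrib)
next
  fix c and x :: fock
  have "linext g (c *\<^sub>C x) = (\<Sum>b\<in>keys x. lookup (c *\<^sub>C x) b *\<^sub>C g b)"
    unfolding linext_def by (rule sum.mono_neutral_left) (auto simp: in_keys_iff)
  then show "linext g (c *\<^sub>C x) = c *\<^sub>C linext g x"
    by (simp add: linext_def cscale_sum)
qed

lemma linext_single [simp]: "linext g (single b c) = c *\<^sub>C g b"
  by (simp add: linext_def)

section \<open>Weights of monomials and the Heisenberg relations\<close>

definition weight :: "(nat \<times> nat \<Rightarrow>\<^sub>0 nat) \<Rightarrow> nat" where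
  "weight \<mu> = (\<Sum>x\<in>keys \<mu>. snd x * lookup \<mu> x)"

lemma weight_superset: "finite A \<Longrightarrow> keys \<mu> \<subseteq> A \<Longrightarrow> weight \<mu> = (\<Sum>x\<in>A. snd x * lookup \<mu> x)"
  unfolding weight_def by (rule sum.mono_neutral_left) (auto simp: in_keys_iff)

lemma weight_add: "weight (\<mu> + \<nu>) = weight \<mu> + weight \<nu>"
  using keys_add[of \<mu> \<nu>]
  by (simp add: weight_superset[of "keys \<mu> \<union> keys \<nu>"] lookup_add distrib_left sum.distrib)

lemma weight_0 [simp]: "weight 0 = 0"
  by (simp add: weight_def)

lemma weight_single [simp]: "weight (single x k) = snd x * k"
  by (simp add: weight_def)

text \<open>Exponents are subtracted with truncation at 0, so a removed variable can be restored
  only where it was present.\<close>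

lemma monomial_minus_single_add:
  fixes \<mu> :: "'b \<Rightarrow>\<^sub>0 nat"
  assumes "lookup \<mu> x \<noteq> 0"
  shows "\<mu> - single x 1 + single x 1 = \<mu>"
  by (rule poly_mapping_eqI) (use assms in \<open>auto simp: lookup_add lookup_minus lookup_single when_def\<close>)

lemma heis_bas_neg:
  "n < 0 \<Longrightarrow> heis N i n (bas (\<mu>, \<alpha>)) = bas (\<mu> + single (nat (i mod int N), nat (- n)) 1, \<alpha>)"
  by (simp add: heis_def)

lemma heis_bas_pos:
  "n > 0 \<Longrightarrow> heis N i n (bas (\<mu>, \<alpha>)) = single (\<mu> - single (nat (i mod int N), nat n) 1, \<alpha>)
     (of_int n * of_nat (lookup \<mu> (nat (i mod int N), nat n)))"
  by (simp add: heis_def Let_def)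

lemma lin_heis: "lin (heis N i n)"
  by (simp add: heis_def lin_linext)

text \<open>Compared on monomials. Modes of different variables act independently. For the same
  variable and n = -m the two orders multiply by |m| e and |m| (e + 1), where e is the exponent of
  that variable, and the difference is the central term.\<close>

lemma heis_commute:
  assumes "N > 0" "m \<noteq> 0" "n \<noteq> 0"
  shows "heis N i m (heis N j n v) = heis N j n (heis N i m v)
     + (if i mod int N = j mod int N \<and> m + n = 0 then of_int m else 0) *\<^sub>C v"
proof (rule lin_eqI[where S = "\<lambda>v. heis N i m (heis N j n v)"])
  fix b :: fock_basis
  obtain \<mu> \<alpha> where b: "b = (\<mu>, \<alpha>)" by (cases b)
  define x where "x = (nat (i mod int N), nat \<bar>m\<bar>)"
  define y where "y = (nat (j mod int N), nat \<bar>n\<bar>)"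
  have xy: "x = y \<longleftrightarrow> i mod int N = j mod int N \<and> \<bar>m\<bar> = \<bar>n\<bar>"
    using assms(1) by (auto simp: x_def y_def nat_eq_iff)
  have A: "heis N i m (bas (\<nu>, \<alpha>)) = (if m < 0 then bas (\<nu> + single x 1, \<alpha>)
      else (of_int m * of_nat (lookup \<nu> x)) *\<^sub>C bas (\<nu> - single x 1, \<alpha>))" for \<nu>
    using assms by (simp add: heis_bas_neg heis_bas_pos x_def)
  have B: "heis N j n (bas (\<nu>, \<alpha>)) = (if n < 0 then bas (\<nu> + single y 1, \<alpha>)
      else (of_int n * of_nat (lookup \<nu> y)) *\<^sub>C bas (\<nu> - single y 1, \<alpha>))" for \<nu>
    using assms by (simp add: heis_bas_neg heis_bas_pos y_def)
  note AB = A B lin_cscale[OF lin_heis]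
  note [simp del] = cscale_single
  have com: "\<mu> + single x 1 - single y 1 = \<mu> - single y 1 + single x (1::nat)"
    if "lookup \<mu> y \<noteq> 0 \<or> x \<noteq> y" for x y :: "nat \<times> nat"
    by (rule poly_mapping_eqI)
      (use that in \<open>auto simp: lookup_minus lookup_add lookup_single when_def\<close>)
  show "heis N i m (heis N j n (bas b)) = heis N j n (heis N i m (bas b))
     + (if i mod int N = j mod int N \<and> m + n = 0 then of_int m else 0) *\<^sub>C bas b"
  proof (cases "x = y")
    case False
    then have "\<not> (i mod int N = j mod int N \<and> m + n = 0)"
      using xy by auto
    moreover have "\<mu> - single y 1 - single x 1 = \<mu> - single x 1 - single y (1::nat)"
      by (rule poly_mapping_eqI) (simp add: lookup_minus)
    ultimately show ?thesis
      using False com[of y x] com[of x y]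
      by (auto simp: b AB lookup_minus lookup_add lookup_single ac_simps)
  next
    case True
    then have mn: "n = m \<or> n = - m" "i mod int N = j mod int N" using xy by auto
    then show ?thesis
    proof (cases "n = m")
      case True
      then have "heis N i m = heis N j n"
        using mn by (simp add: heis_def)
      with True assms show ?thesis by simp
    next
      case False
      then have "n = - m" using mn by simp
      note AB' = A B[unfolded \<open>n = - m\<close>] lin_cscale[OF lin_heis]
      have *: "lookup \<mu> y \<noteq> 0 \<Longrightarrow> \<mu> + single y 1 - single y 1 = \<mu> \<and> \<mu> - single y 1 + single y (1::nat) = \<mu>"
        using monomial_minus_single_add[of \<mu> y] by simp
      have 1: "(- of_int m * of_nat (lookup \<mu> y)) *\<^sub>C w
          = (- of_int m * of_nat (lookup \<mu> y + 1)) *\<^sub>C w + of_int m *\<^sub>C w" for w :: fock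
        unfolding cscale_add_left[symmetric] by (rule arg_cong[where f = "\<lambda>t. t *\<^sub>C w"]) (simp add: distrib_left)
      have 2: "(of_int m * of_nat (lookup \<mu> y + 1)) *\<^sub>C w
          = (of_int m * of_nat (lookup \<mu> y)) *\<^sub>C w + of_int m *\<^sub>C w" for w :: fock
        unfolding cscale_add_left[symmetric] by (rule arg_cong[where f = "\<lambda>t. t *\<^sub>C w"]) (simp add: distrib_left)
      have c: "(if i mod int N = j mod int N \<and> m + n = 0 then of_int m else 0) = (of_int m :: complex)"
        using mn \<open>n = - m\<close> by simp
      show ?thesis
      proof (cases "m < 0")
        case True
        have "heis N i m (heis N j n (bas b)) = (- of_int m * of_nat (lookup \<mu> y)) *\<^sub>C bas b"
          using True * \<open>x = y\<close> \<open>n = - m\<close>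
          by (cases "lookup \<mu> y = 0") (simp_all add: b AB' lin_0[OF lin_heis])
        moreover have "heis N j n (heis N i m (bas b)) = (- of_int m * of_nat (lookup \<mu> y + 1)) *\<^sub>C bas b"
          using True \<open>x = y\<close> \<open>n = - m\<close> by (simp add: b AB' lookup_add)
        ultimately show ?thesis
          by (simp only: c 1[symmetric])
      next
        case False
        then have "m > 0" using assms by simp
        then have "heis N i m (heis N j n (bas b)) = (of_int m * of_nat (lookup \<mu> y + 1)) *\<^sub>C bas b"
          using \<open>x = y\<close> \<open>n = - m\<close> by (simp add: b AB' lookup_add)
        moreover have "heis N j n (heis N i m (bas b)) = (of_int m * of_nat (lookup \<mu> y)) *\<^sub>C bas b"
          using * \<open>m > 0\<close> \<open>x = y\<close> \<open>n = - m\<close>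
          by (cases "lookup \<mu> y = 0") (simp_all add: b AB' lin_0[OF lin_heis])
        ultimately show ?thesis
          by (simp only: c 2)
      qed
    qed
  qed
qed (intro lin_plus lin_scale lin_id lin_comp[OF lin_heis lin_heis])+

section \<open>Vertex series\<close>

definition good :: "nat \<Rightarrow> (nat \<times> nat \<Rightarrow>\<^sub>0 nat) \<Rightarrow> bool" where
  "good N \<mu> \<longleftrightarrow> keys \<mu> \<subseteq> {..<N} \<times> {1..}"

text \<open>The number \<open>f \<alpha>\<close> is the order of the series on e^\<alpha>: since
  weights are nonnegative, no smaller power of z occurs there. It varies with \<alpha> because of
  the factor z^\<beta>. Goodness of monomials is carried along to keep V_Q invariant.\<close>

definition graded :: "nat \<Rightarrow> op_series \<Rightarrow> (lattice \<Rightarrow> int) \<Rightarrow> lattice \<Rightarrow> bool" where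
  "graded N A f \<beta> \<longleftrightarrow> (\<forall>k \<mu> \<alpha> \<nu> \<gamma>. lookup (A k (bas (\<mu>, \<alpha>))) (\<nu>, \<gamma>) \<noteq> 0 \<longrightarrow>
     \<gamma> = \<alpha> + \<beta> \<and> int (weight \<nu>) = int (weight \<mu>) + k - f \<alpha> \<and> (good N \<mu> \<longrightarrow> good N \<nu>))"

lemma gradedD:
  assumes "graded N A f \<beta>" "lookup (A k (bas (\<mu>, \<alpha>))) (\<nu>, \<gamma>) \<noteq> 0"
  shows "\<gamma> = \<alpha> + \<beta>" "int (weight \<nu>) = int (weight \<mu>) + k - f \<alpha>" "good N \<mu> \<Longrightarrow> good N \<nu>"
  using assms unfolding graded_def by blast+

text \<open>As generating functions: [epsilon_a(n), A(z)] = \<open>\<phi> a n\<close> z^n A(z). The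
  factor z^n becomes the index shift.\<close>

definition heis_covariant :: "nat \<Rightarrow> op_series \<Rightarrow> (nat \<Rightarrow> int \<Rightarrow> complex) \<Rightarrow> bool" where
  "heis_covariant N A \<phi> \<longleftrightarrow> (\<forall>a n k v. a < N \<longrightarrow> n \<noteq> 0 \<longrightarrow>
     heis N (int a) n (A k v) = A k (heis N (int a) n v) + \<phi> a n *\<^sub>C A (k - n) v)"

definition vertex_series ::
  "nat \<Rightarrow> op_series \<Rightarrow> (nat \<Rightarrow> int \<Rightarrow> complex) \<Rightarrow> (lattice \<Rightarrow> int) \<Rightarrow> lattice \<Rightarrow> bool" where
  "vertex_series N A \<phi> f \<beta> \<longleftrightarrow> (\<forall>k. lin (A k)) \<and> graded N A f \<beta> \<and> heis_covariant N A \<phi>"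

lemma vertex_seriesI:
  assumes "\<And>k. lin (A k)"
    and "\<And>k \<mu> \<alpha> \<nu> \<gamma>. lookup (A k (bas (\<mu>, \<alpha>))) (\<nu>, \<gamma>) \<noteq> 0 \<Longrightarrow>
     \<gamma> = \<alpha> + \<beta> \<and> int (weight \<nu>) = int (weight \<mu>) + k - f \<alpha> \<and> (good N \<mu> \<longrightarrow> good N \<nu>)"
    and "\<And>a n k v. a < N \<Longrightarrow> n \<noteq> 0 \<Longrightarrow>
     heis N (int a) n (A k v) = A k (heis N (int a) n v) + \<phi> a n *\<^sub>C A (k - n) v"
  shows "vertex_series N A \<phi> f \<beta>"
  using assms unfolding vertex_series_def graded_def heis_covariant_def by blast

lemma vertex_seriesD:
  assumes "vertex_series N A \<phi> f \<beta>"
  shows "lin (A k)" "graded N A f \<beta>" "heis_covariant N A \<phi>"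
    and "a < N \<Longrightarrow> n \<noteq> 0 \<Longrightarrow>
      heis N (int a) n (A k v) = A k (heis N (int a) n v) + \<phi> a n *\<^sub>C A (k - n) v"
  using assms unfolding vertex_series_def heis_covariant_def by blast+

text \<open>\<open>Sum_any\<close> returns 0 on an infinite support, so without this finiteness
  \<open>ser_mult\<close> would be neither linear nor compatible with commutators.\<close>

definition composable :: "op_series \<Rightarrow> op_series \<Rightarrow> bool" where
  "composable A B \<longleftrightarrow> (\<forall>k v. finite {n. A (k - n) (B n v) \<noteq> 0})"

lemma composableD: "composable A B \<Longrightarrow> finite {n. A (k - n) (B n v) \<noteq> 0}"
  by (simp add: composable_def)

lemma ser_mult_add:
  assumes "\<And>k. lin (A k)" "\<And>k. lin (B k)" "composable A B"
  shows "(A \<otimes>\<^sub>S B) k (x + y) = (A \<otimes>\<^sub>S B) k x + (A \<otimes>\<^sub>S B) k y"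
  unfolding ser_mult_def lin_add[OF assms(1)] lin_add[OF assms(2)]
  by (rule Sum_any.distrib) (auto intro: composableD assms)

lemma cscale_Sum_any:
  fixes f :: "'a \<Rightarrow> ('b \<Rightarrow>\<^sub>0 complex)"
  assumes "finite {a. f a \<noteq> 0}"
  shows "c *\<^sub>C Sum_any f = Sum_any (\<lambda>a. c *\<^sub>C f a)"
  by (rule lin_Sum_any[OF lin_scale[OF lin_id] assms])

lemma lin_ser_mult:
  assumes "\<And>k. lin (A k)" "\<And>k. lin (B k)" "composable A B"
  shows "lin ((A \<otimes>\<^sub>S B) k)"
proof (rule linI)
  fix c x
  show "(A \<otimes>\<^sub>S B) k (c *\<^sub>C x) = c *\<^sub>C (A \<otimes>\<^sub>S B) k x"
    unfolding ser_mult_def lin_cscale[OF assms(1)] lin_cscale[OF assms(2)]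
    by (rule cscale_Sum_any[symmetric]) (rule composableD[OF assms(3)])
qed (rule ser_mult_add[OF assms])

lemma lookup_Sum_any:
  assumes "finite {a. f a \<noteq> 0}"
  shows "lookup (Sum_any f) b = (\<Sum>a | f a \<noteq> 0. lookup (f a) b)"
  by (simp add: Sum_any.expand_set lookup_sum)

lemma lookup_ser_mult_nonzero:
  assumes "composable A B" "lookup ((A \<otimes>\<^sub>S B) k v) b \<noteq> 0"
  obtains n where "lookup (A (k - n) (B n v)) b \<noteq> 0"
proof -
  have "\<exists>n. lookup (A (k - n) (B n v)) b \<noteq> 0"
  proof (rule ccontr)
    assume "\<not> ?thesis"
    then have "lookup ((A \<otimes>\<^sub>S B) k v) b = 0"
      by (simp add: ser_mult_def lookup_Sum_any composableD[OF assms(1)])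
    with assms(2) show False by simp
  qed
  with that show ?thesis by blast
qed

text \<open>B acts first, so the order of A is taken at the shifted lattice point \<alpha> +
  \<gamma>.\<close>

lemma graded_ser_mult:
  assumes "\<And>k. lin (A k)" "composable A B" "graded N A f \<beta>" "graded N B g \<gamma>"
  shows "graded N (A \<otimes>\<^sub>S B) (\<lambda>\<alpha>. g \<alpha> + f (\<alpha> + \<gamma>)) (\<gamma> + \<beta>)"
  unfolding graded_def
proof (intro allI impI)
  fix k \<mu> \<alpha> \<nu> \<delta>
  assume "lookup ((A \<otimes>\<^sub>S B) k (bas (\<mu>, \<alpha>))) (\<nu>, \<delta>) \<noteq> 0"
  then obtain n where "lookup (A (k - n) (B n (bas (\<mu>, \<alpha>)))) (\<nu>, \<delta>) \<noteq> 0"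
    by (rule lookup_ser_mult_nonzero[OF assms(2)])
  then obtain b where "b \<in> keys (B n (bas (\<mu>, \<alpha>)))" "lookup (A (k - n) (bas b)) (\<nu>, \<delta>) \<noteq> 0"
    by (rule lin_lookup_nonzero[OF assms(1)])
  then obtain \<nu>' \<gamma>' where b: "lookup (B n (bas (\<mu>, \<alpha>))) (\<nu>', \<gamma>') \<noteq> 0"
      "lookup (A (k - n) (bas (\<nu>', \<gamma>'))) (\<nu>, \<delta>) \<noteq> 0"
    by (cases b) (auto simp: in_keys_iff)
  show "\<delta> = \<alpha> + (\<gamma> + \<beta>) \<and>
      int (weight \<nu>) = int (weight \<mu>) + k - (g \<alpha> + f (\<alpha> + \<gamma>)) \<and> (good N \<mu> \<longrightarrow> good N \<nu>)"
    using gradedD[OF assms(4) b(1)] gradedD[OF assms(3) b(2)] by (simp add: add.assoc)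
qed

text \<open>The Leibniz rule for the commutator with h; \<open>A'\<close> and \<open>B'\<close> are
  the commutators of h with the two factors.\<close>

lemma commute_ser_mult:
  assumes "lin h" "\<And>k. lin (A k)"
    and A: "\<And>k v. h (A k v) = A k (h v) + A' k v" and B: "\<And>k v. h (B k v) = B k (h v) + B' k v"
    and comp: "composable A B" "composable A' B" "composable A B'"
  shows "h ((A \<otimes>\<^sub>S B) k v) = (A \<otimes>\<^sub>S B) k (h v) + (A' \<otimes>\<^sub>S B) k v + (A \<otimes>\<^sub>S B') k v"
proof -
  have "h ((A \<otimes>\<^sub>S B) k v) = Sum_any (\<lambda>n. h (A (k - n) (B n v)))"
    unfolding ser_mult_def by (rule lin_Sum_any[OF assms(1) composableD[OF comp(1)]])
  also have "\<dots> = Sum_any (\<lambda>n. (A (k - n) (B n (h v)) + A' (k - n) (B n v)) + A (k - n) (B' n v))"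
    by (rule Sum_any.cong) (simp add: A B lin_add[OF assms(2)])
  also have "\<dots> = Sum_any (\<lambda>n. A (k - n) (B n (h v)) + A' (k - n) (B n v))
      + Sum_any (\<lambda>n. A (k - n) (B' n v))"
  proof (rule Sum_any.distrib)
    show "finite {n. A (k - n) (B n (h v)) + A' (k - n) (B n v) \<noteq> 0}"
      by (rule finite_subset[OF _ finite_UnI[OF composableD[OF comp(1), of k "h v"]
            composableD[OF comp(2), of k v]]]) auto
  qed (rule composableD[OF comp(3)])
  also have "Sum_any (\<lambda>n. A (k - n) (B n (h v)) + A' (k - n) (B n v))
     = Sum_any (\<lambda>n. A (k - n) (B n (h v))) + Sum_any (\<lambda>n. A' (k - n) (B n v))"
    by (rule Sum_any.distrib) (rule composableD[OF comp(1)], rule composableD[OF comp(2)])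
  finally show ?thesis by (simp add: ser_mult_def)
qed

lemma Sum_any_shift:
  fixes f :: "int \<Rightarrow> 'a::comm_monoid_add"
  shows "Sum_any (\<lambda>n. f (n - m)) = Sum_any f"
  by (rule Sum_any.reindex_cong[symmetric, where l = "\<lambda>n. n - m"])
    (auto intro!: bij_betw_byWitness[where f' = "\<lambda>n. n + m"])

lemma ser_mult_shift_right: "(A \<otimes>\<^sub>S (\<lambda>k v. B (k - m) v)) k v = (A \<otimes>\<^sub>S B) (k - m) v"
  using Sum_any_shift[of "\<lambda>n. A (k - m - n) (B n v)" m] by (simp add: ser_mult_def)

lemma ser_mult_shift_left: "((\<lambda>k v. A (k - m) v) \<otimes>\<^sub>S B) k v = (A \<otimes>\<^sub>S B) (k - m) v"
  unfolding ser_mult_def by (rule Sum_any.cong) (simp only: cancel_ab_semigroup_add_class.diff_right_commute[of k _ m])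

lemma composable_shift_right:
  assumes "composable A B"
  shows "composable A (\<lambda>k v. B (k - m) v)"
  unfolding composable_def
proof (intro allI)
  fix k v
  have "{n. A (k - n) (B (n - m) v) \<noteq> 0} = (\<lambda>n. n + m) ` {n. A (k - m - n) (B n v) \<noteq> 0}"
    by (auto simp: image_iff algebra_simps intro!: exI[of _ "_ - m"])
  then show "finite {n. A (k - n) (B (n - m) v) \<noteq> 0}"
    by (simp add: composableD[OF assms])
qed

lemma composable_shift_left:
  assumes "composable A B"
  shows "composable (\<lambda>k v. A (k - m) v) B"
  unfolding composable_def
proof (intro allI)
  fix k v
  show "finite {n. A (k - n - m) (B n v) \<noteq> 0}"
    using composableD[OF assms, of "k - m" v] by (simp add: diff_diff_eq add.commute)
qed

lemma composable_scale:
  assumes "\<And>k. lin (A k)" "composable A B"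
  shows "composable (\<lambda>k v. c *\<^sub>C A k v) B" "composable A (\<lambda>k v. c *\<^sub>C B k v)"
  using assms unfolding composable_def lin_cscale[OF assms(1)]
  by (auto elim!: finite_subset[rotated])

lemma ser_mult_scale:
  assumes "\<And>k. lin (A k)" "composable A B"
  shows "((\<lambda>k v. c *\<^sub>C A k v) \<otimes>\<^sub>S B) k v = c *\<^sub>C (A \<otimes>\<^sub>S B) k v"
    and "(A \<otimes>\<^sub>S (\<lambda>k v. c *\<^sub>C B k v)) k v = c *\<^sub>C (A \<otimes>\<^sub>S B) k v"
  by (simp_all add: ser_mult_def lin_cscale[OF assms(1)] cscale_Sum_any composableD[OF assms(2)])

lemma heis_covariant_ser_mult:
  assumes "\<And>k. lin (A k)" "\<And>k. lin (B k)" "composable A B"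
    and A: "heis_covariant N A \<phi>" and B: "heis_covariant N B \<psi>"
  shows "heis_covariant N (A \<otimes>\<^sub>S B) (\<lambda>a n. \<phi> a n + \<psi> a n)"
  unfolding heis_covariant_def
proof (intro allI impI)
  fix a n k v
  assume an: "a < N" "n \<noteq> (0::int)"
  define A' where "A' = (\<lambda>k v. \<phi> a n *\<^sub>C A (k - n) v)"
  define B' where "B' = (\<lambda>k v. \<psi> a n *\<^sub>C B (k - n) v)"
  have lA: "\<And>k. lin ((\<lambda>k v. A (k - n) v) k)" using assms(1) by simp
  note cl = composable_shift_left[OF assms(3), of n] and cr = composable_shift_right[OF assms(3), of n]
  have "heis N (int a) n ((A \<otimes>\<^sub>S B) k v) = (A \<otimes>\<^sub>S B) k (heis N (int a) n v)
     + (A' \<otimes>\<^sub>S B) k v + (A \<otimes>\<^sub>S B') k v"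
    unfolding A'_def B'_def
    by (rule commute_ser_mult) (use A B an in \<open>auto simp: heis_covariant_def intro!: lin_heis assms
        composable_scale(1)[OF lA cl] composable_scale(2)[OF assms(1) cr]\<close>)
  also have "(A' \<otimes>\<^sub>S B) k v = \<phi> a n *\<^sub>C (A \<otimes>\<^sub>S B) (k - n) v"
    unfolding A'_def by (simp only: ser_mult_scale(1)[OF lA cl] ser_mult_shift_left)
  also have "(A \<otimes>\<^sub>S B') k v = \<psi> a n *\<^sub>C (A \<otimes>\<^sub>S B) (k - n) v"
    unfolding B'_def by (simp only: ser_mult_scale(2)[OF assms(1) cr] ser_mult_shift_right)
  finally show "heis N (int a) n ((A \<otimes>\<^sub>S B) k v) = (A \<otimes>\<^sub>S B) k (heis N (int a) n v)
     + (\<phi> a n + \<psi> a n) *\<^sub>C (A \<otimes>\<^sub>S B) (k - n) v"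
    by (simp add: cscale_add_left add.assoc)
qed

lemma vertex_series_mult:
  assumes "vertex_series N A \<phi> f \<beta>" "vertex_series N B \<psi> g \<gamma>" "composable A B"
  shows "vertex_series N (A \<otimes>\<^sub>S B) (\<lambda>a n. \<phi> a n + \<psi> a n) (\<lambda>\<alpha>. g \<alpha> + f (\<alpha> + \<gamma>)) (\<gamma> + \<beta>)"
  using assms lin_ser_mult graded_ser_mult heis_covariant_ser_mult
  unfolding vertex_series_def by blast

text \<open>The weight of a monomial is nonnegative, so a graded series is bounded below on each vector.\<close>

lemma graded_bounded_below:
  assumes "\<And>k. lin (A k)" "graded N A f \<beta>"
  shows "\<exists>M. \<forall>n<M. A n v = 0"
proof (intro exI allI impI)
  fix n
  assume n: "n < - (\<Sum>(\<mu>, \<alpha>)\<in>keys v. int (weight \<mu>) + \<bar>f \<alpha>\<bar>)"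
  show "A n v = 0"
  proof (rule poly_mapping_eqI, rule ccontr)
    fix b
    assume "lookup (A n v) b \<noteq> lookup 0 b"
    then have "lookup (A n v) b \<noteq> 0" by simp
    then obtain b' where b': "b' \<in> keys v" "lookup (A n (bas b')) b \<noteq> 0"
      by (rule lin_lookup_nonzero[OF assms(1)])
    obtain \<mu> \<alpha> where "b' = (\<mu>, \<alpha>)" by (cases b')
    with b' have "0 \<le> int (weight \<mu>) + n - f \<alpha>"
      using assms(2) by (cases b) (force simp: graded_def)
    moreover have "int (weight \<mu>) + \<bar>f \<alpha>\<bar> \<le> (\<Sum>(\<mu>, \<alpha>)\<in>keys v. int (weight \<mu>) + \<bar>f \<alpha>\<bar>)"
      using member_le_sum[OF b'(1), of "\<lambda>(\<mu>, \<alpha>). int (weight \<mu>) + \<bar>f \<alpha>\<bar>"] \<open>b' = _\<close> by auto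
    ultimately show False using n by linarith
  qed
qed

text \<open>Serves for creation halves standing on the left: they bound the inner index above by k,
  while the order of B on the given vector bounds it below.\<close>

lemma composable_nonneg:
  assumes "\<And>k v. k < 0 \<Longrightarrow> A k v = 0" "\<And>k. lin (A k)" "\<And>k. lin (B k)" "graded N B f \<beta>"
  shows "composable A B"
  unfolding composable_def
proof (intro allI)
  fix k v
  obtain M where "\<forall>n<M. B n v = 0"
    using graded_bounded_below[OF assms(3,4)] by blast
  then have "{n. A (k - n) (B n v) \<noteq> 0} \<subseteq> {M..k}"
    using assms(1) lin_0[OF assms(2)] by (force simp: not_less[symmetric])
  then show "finite {n. A (k - n) (B n v) \<noteq> 0}"
    by (rule finite_subset) simp
qed

text \<open>On every vector the series is a Laurent polynomial. This is inherited by products of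
  series with linear coefficients and holds for constants, for z^\<beta> and for annihilation
  halves, that is, for everything to the right of the creation halves in a vertex operator.\<close>

definition pointwise_finite :: "op_series \<Rightarrow> bool" where
  "pointwise_finite A \<longleftrightarrow> (\<forall>v. finite {k. A k v \<noteq> 0})"

lemma composable_pointwise_finite:
  assumes "pointwise_finite B" "\<And>k. lin (A k)"
  shows "composable A B"
  unfolding composable_def
proof (intro allI)
  fix k v
  have "{n. A (k - n) (B n v) \<noteq> 0} \<subseteq> {n. B n v \<noteq> 0}"
    using lin_0[OF assms(2)] by auto
  then show "finite {n. A (k - n) (B n v) \<noteq> 0}"
    using assms(1) by (auto simp: pointwise_finite_def dest: finite_subset)
qed

lemma pointwise_finite_mult:
  assumes "pointwise_finite A" "pointwise_finite B" "\<And>k. lin (A k)"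
  shows "pointwise_finite (A \<otimes>\<^sub>S B)"
  unfolding pointwise_finite_def
proof (intro allI)
  fix v
  have fin: "finite (\<Union>n\<in>{n. B n v \<noteq> 0}. (\<lambda>k. k + n) ` {k. A k (B n v) \<noteq> 0})"
    using assms by (auto simp: pointwise_finite_def)
  have "{k. (A \<otimes>\<^sub>S B) k v \<noteq> 0} \<subseteq> (\<Union>n\<in>{n. B n v \<noteq> 0}. (\<lambda>k. k + n) ` {k. A k (B n v) \<noteq> 0})"
  proof
    fix k assume "k \<in> {k. (A \<otimes>\<^sub>S B) k v \<noteq> 0}"
    then obtain n where n: "A (k - n) (B n v) \<noteq> 0"
      by (auto simp: ser_mult_def elim: Sum_any.not_neutral_obtains_not_neutral)
    then have "B n v \<noteq> 0" using lin_0[OF assms(3)] by auto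
    moreover have "k \<in> (\<lambda>k. k + n) ` {k. A k (B n v) \<noteq> 0}"
      using n by (auto simp: image_iff intro!: exI[of _ "k - n"])
    ultimately show "k \<in> (\<Union>n\<in>{n. B n v \<noteq> 0}. (\<lambda>k. k + n) ` {k. A k (B n v) \<noteq> 0})"
      by blast
  qed
  then show "finite {k. (A \<otimes>\<^sub>S B) k v \<noteq> 0}"
    by (rule finite_subset) (rule fin)
qed

lemma pointwise_finite_nonpos:
  assumes "\<And>k v. k > 0 \<Longrightarrow> A k v = 0" "\<And>k. lin (A k)" "graded N A f \<beta>"
  shows "pointwise_finite A"
  unfolding pointwise_finite_def
proof (intro allI)
  fix v
  obtain M where "\<forall>n<M. A n v = 0"
    using graded_bounded_below[OF assms(2,3)] by blast
  then have "{k. A k v \<noteq> 0} \<subseteq> {M..0}"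
    using assms(1) by (force simp: not_less[symmetric])
  then show "finite {k. A k v \<noteq> 0}"
    by (rule finite_subset) simp
qed

lemma vertex_series_subst:
  assumes A: "vertex_series N A \<phi> f \<beta>" and "c \<noteq> 0"
  shows "vertex_series N (ser_subst c A) (\<lambda>a n. c powi n * \<phi> a n) f \<beta>"
proof (rule vertex_seriesI)
  fix k \<mu> \<alpha> \<nu> \<gamma>
  assume "lookup (ser_subst c A k (bas (\<mu>, \<alpha>))) (\<nu>, \<gamma>) \<noteq> 0"
  then have "lookup (A k (bas (\<mu>, \<alpha>))) (\<nu>, \<gamma>) \<noteq> 0"
    by (simp add: ser_subst_def)
  from gradedD[OF vertex_seriesD(2)[OF A] this]
  show "\<gamma> = \<alpha> + \<beta> \<and> int (weight \<nu>) = int (weight \<mu>) + k - f \<alpha> \<and> (good N \<mu> \<longrightarrow> good N \<nu>)"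
    by blast
next
  fix a n k v
  assume an: "a < N" "n \<noteq> (0::int)"
  have e: "c powi k * \<phi> a n = c powi n * \<phi> a n * c powi (k - n)"
    using power_int_add[of c n "k - n"] assms(2) by simp
  show "heis N (int a) n (ser_subst c A k v)
      = ser_subst c A k (heis N (int a) n v) + (c powi n * \<phi> a n) *\<^sub>C ser_subst c A (k - n) v"
    by (simp add: ser_subst_def lin_cscale[OF lin_heis] cscale_add vertex_seriesD(4)[OF A an] e)
qed (simp add: ser_subst_def lin_scale vertex_seriesD[OF A])

lemma vertex_series_const:
  assumes T: "lin T" "\<And>\<mu> \<alpha>. T (bas (\<mu>, \<alpha>)) = single (\<mu>, \<alpha> + \<beta>) (g \<alpha>)"
  shows "vertex_series N (ser_const T) (\<lambda>_ _. 0) (\<lambda>_. 0) \<beta>"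
proof (rule vertex_seriesI)
  fix k :: int
  show "lin (ser_const T k)"
    using T by (cases "k = 0") (simp_all add: ser_const_def lin_zero)
next
  fix k \<mu> \<alpha> \<nu> \<gamma>
  assume "lookup (ser_const T k (bas (\<mu>, \<alpha>))) (\<nu>, \<gamma>) \<noteq> 0"
  then show "\<gamma> = \<alpha> + \<beta> \<and> int (weight \<nu>) = int (weight \<mu>) + k - 0 \<and> (good N \<mu> \<longrightarrow> good N \<nu>)"
    by (auto simp: ser_const_def T lookup_single when_def split: if_splits)
next
  fix a n k v
  assume n: "n \<noteq> (0::int)"
  have "heis N i n (T v) = T (heis N i n v)" for i v
  proof (rule lin_eqI[OF lin_comp[OF lin_heis T(1)] lin_comp[OF T(1) lin_heis]])
    fix b :: fock_basis
    obtain \<mu> \<alpha> where b: "b = (\<mu>, \<alpha>)" by (cases b)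
    have s: "single (\<nu>, \<delta>) c = c *\<^sub>C bas (\<nu>, \<delta>)" for \<nu> c and \<delta> :: lattice
      by simp
    note [simp del] = cscale_single
    from n have "n < 0 \<or> n > 0" by linarith
    then show "heis N i n (T (bas b)) = T (heis N i n (bas b))"
      by (elim disjE) (simp_all add: b heis_bas_neg heis_bas_pos T(2) s[of _ _ "g _"]
          s[of _ _ "_ * _"] lin_cscale[OF lin_heis] lin_cscale[OF T(1)] mult.commute)
  qed
  then show "heis N (int a) n (ser_const T k v)
      = ser_const T k (heis N (int a) n v) + 0 *\<^sub>C ser_const T (k - n) v"
    by (simp add: ser_const_def lin_0[OF lin_heis])
qed

lemma pointwise_finite_const: "pointwise_finite (ser_const T)"
  unfolding pointwise_finite_def
proof
  show "finite {k. ser_const T k v \<noteq> 0}" for v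
    by (rule finite_subset[of _ "{0}"]) (auto simp: ser_const_def)
qed

lemma vertex_series_z_pow: "vertex_series N (z_pow \<beta> s) (\<lambda>_ _. 0) (\<lambda>\<alpha>. lform \<beta> \<alpha> + s) 0"
proof (rule vertex_seriesI)
  show "lin (z_pow \<beta> s k)" for k
    by (simp add: z_pow_def lin_linext)
next
  fix k \<mu> \<alpha> \<nu> \<gamma>
  assume "lookup (z_pow \<beta> s k (bas (\<mu>, \<alpha>))) (\<nu>, \<gamma>) \<noteq> 0"
  then show "\<gamma> = \<alpha> + 0 \<and> int (weight \<nu>) = int (weight \<mu>) + k - (lform \<beta> \<alpha> + s) \<and> (good N \<mu> \<longrightarrow> good N \<nu>)"
    by (auto simp: z_pow_def lookup_single when_def split: if_splits)
next
  fix a n k v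
  assume n: "n \<noteq> (0::int)"
  have l: "lin (z_pow \<beta> s k)" by (simp add: z_pow_def lin_linext)
  have "heis N (int a) n (z_pow \<beta> s k v) = z_pow \<beta> s k (heis N (int a) n v)"
  proof (rule lin_eqI[OF lin_comp[OF lin_heis l] lin_comp[OF l lin_heis]])
    fix b :: fock_basis
    obtain \<mu> \<alpha> where b: "b = (\<mu>, \<alpha>)" by (cases b)
    from n have "n < 0 \<or> n > 0" by linarith
    then show "heis N (int a) n (z_pow \<beta> s k (bas b)) = z_pow \<beta> s k (heis N (int a) n (bas b))"
      by (elim disjE) (simp_all add: b heis_bas_neg heis_bas_pos z_pow_def lin_0[OF lin_heis])
  qed
  then show "heis N (int a) n (z_pow \<beta> s k v)
      = z_pow \<beta> s k (heis N (int a) n v) + 0 *\<^sub>C z_pow \<beta> s (k - n) v"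
    by simp
qed

lemma pointwise_finite_z_pow: "pointwise_finite (z_pow \<beta> s)"
  unfolding pointwise_finite_def
proof
  fix v
  have "{k. z_pow \<beta> s k v \<noteq> 0} \<subseteq> (\<lambda>(\<mu>, \<alpha>). lform \<beta> \<alpha> + s) ` keys v"
  proof
    fix k assume "k \<in> {k. z_pow \<beta> s k v \<noteq> 0}"
    then have "(\<Sum>b\<in>keys v. lookup v b *\<^sub>C
        (case b of (\<mu>, \<alpha>) \<Rightarrow> if lform \<beta> \<alpha> + s = k then bas (\<mu>, \<alpha>) else 0)) \<noteq> 0"
      by (simp add: z_pow_def linext_def)
    then obtain b where "b \<in> keys v"
        "lookup v b *\<^sub>C (case b of (\<mu>, \<alpha>) \<Rightarrow> if lform \<beta> \<alpha> + s = k then bas (\<mu>, \<alpha>) else 0) \<noteq> 0"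
      by (rule sum.not_neutral_contains_not_neutral)
    then show "k \<in> (\<lambda>(\<mu>, \<alpha>). lform \<beta> \<alpha> + s) ` keys v"
      by (auto simp: image_iff split: if_splits prod.splits)
  qed
  then show "finite {k. z_pow \<beta> s k v \<noteq> 0}"
    by (rule finite_subset) simp
qed

text \<open>Only positive powers (\<open>s = 1\<close>) or only negative powers (\<open>s = -1\<close>) of the variable occur.\<close>

locale heis_exponent =
  fixes N :: nat and X :: op_series and s :: int and \<phi> :: "nat \<Rightarrow> int \<Rightarrow> complex"
  assumes s: "s = 1 \<or> s = -1"
    and lin_X: "\<And>k. lin (X k)"
    and X_zero: "\<And>k v. s * k \<le> 0 \<Longrightarrow> X k v = 0"
    and graded_X: "graded N X (\<lambda>_. 0) 0"
    and heis_X: "\<And>a n k v. a < N \<Longrightarrow> n \<noteq> 0 \<Longrightarrow>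
      heis N (int a) n (X k v) = X k (heis N (int a) n v) + (if k = n then \<phi> a n else 0) *\<^sub>C v"
begin

text \<open>Each factor contributes at least one power of the variable in the direction s. Hence
  only finitely many powers of X contribute to the exponential in a given degree.\<close>

lemma pow_zero: "s * k < int m \<Longrightarrow> ser_pow X m k v = 0"
proof (induction m arbitrary: k v)
  case 0
  then show ?case by (auto simp: ser_const_def)
next
  case (Suc m)
  have "X (k - n) (ser_pow X m n v) = 0" for n
  proof (cases "s * n < int m")
    case True
    then show ?thesis by (simp add: Suc.IH lin_0[OF lin_X])
  next
    case False
    then have "s * (k - n) \<le> 0" using Suc.prems by (simp add: right_diff_distrib)
    then show ?thesis by (rule X_zero)
  qed
  then show ?case by (simp add: ser_mult_def)
qed

text \<open>X lives in degrees of sign s and its powers in degrees of sign s or 0, so both summands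
  of k are bounded by |k|.\<close>

lemma composable_pow: "composable X (ser_pow X m)"
  unfolding composable_def
proof (intro allI)
  fix k v
  have "{n. X (k - n) (ser_pow X m n v) \<noteq> 0} \<subseteq> {n. s * n \<ge> 0 \<and> s * (k - n) > 0}"
  proof
    fix n assume "n \<in> {n. X (k - n) (ser_pow X m n v) \<noteq> 0}"
    then have "ser_pow X m n v \<noteq> 0" "\<not> s * (k - n) \<le> 0"
      using lin_0[OF lin_X] X_zero by auto
    then show "n \<in> {n. s * n \<ge> 0 \<and> s * (k - n) > 0}"
      using pow_zero[of n m v] by force
  qed
  also have "\<dots> \<subseteq> {-\<bar>k\<bar>..\<bar>k\<bar>}"
    using s by auto
  finally show "finite {n. X (k - n) (ser_pow X m n v) \<noteq> 0}"
    by (rule finite_subset) simp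
qed

lemma lin_pow: "lin (ser_pow X m k)"
proof (induction m arbitrary: k)
  case 0
  then show ?case by (cases "k = 0") (simp_all add: ser_const_def lin_def)
next
  case (Suc m)
  show ?case unfolding ser_pow.simps
    by (rule lin_ser_mult) (rule lin_X, rule Suc, rule composable_pow)
qed

lemma graded_pow: "graded N (ser_pow X m) (\<lambda>_. 0) 0"
proof (induction m)
  case 0
  then show ?case
    by (auto simp: graded_def ser_const_def lookup_single when_def split: if_splits)
next
  case (Suc m)
  show ?case
    using graded_ser_mult[OF lin_X composable_pow graded_X Suc] by simp
qed

text \<open>The commutator of a mode with X is a scalar, so it differentiates powers: [h, X^m] = m
  \<phi> z^n X^(m-1). At m = 0 the factor m absorbs the truncated m - 1.\<close>

lemma heis_pow:
  assumes "a < N" "n \<noteq> 0"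
  shows "heis N (int a) n (ser_pow X m k v)
    = ser_pow X m k (heis N (int a) n v) + (of_nat m * \<phi> a n) *\<^sub>C ser_pow X (m - 1) (k - n) v"
proof (induction m arbitrary: k v)
  case 0
  then show ?case by (simp add: ser_const_def lin_0[OF lin_heis])
next
  case (Suc m)
  define A' where "A' = (\<lambda>k v. (if k = n then \<phi> a n else 0) *\<^sub>C (v::fock))"
  define B' where "B' = (\<lambda>k v. (of_nat m * \<phi> a n) *\<^sub>C ser_pow X (m - 1) (k - n) v)"
  have fin: "{l. A' (k - l) (ser_pow X m l v) \<noteq> 0} \<subseteq> {k - n}" for k v
    by (auto simp: A'_def split: if_splits)
  have cB: "composable X (\<lambda>k v. ser_pow X (m - 1) (k - n) v)"
    by (rule composable_shift_right[OF composable_pow])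
  have "heis N (int a) n ((X \<otimes>\<^sub>S ser_pow X m) k v)
     = (X \<otimes>\<^sub>S ser_pow X m) k (heis N (int a) n v) + (A' \<otimes>\<^sub>S ser_pow X m) k v + (X \<otimes>\<^sub>S B') k v"
  proof (rule commute_ser_mult)
    show "composable A' (ser_pow X m)"
      unfolding composable_def using finite_subset[OF fin] by simp
    show "composable X B'"
      unfolding B'_def by (rule composable_scale[OF lin_X cB])
  qed (auto simp: A'_def B'_def heis_X[OF assms] Suc intro: lin_heis lin_X composable_pow)
  also have "(A' \<otimes>\<^sub>S ser_pow X m) k v = \<phi> a n *\<^sub>C ser_pow X m (k - n) v"
    unfolding ser_mult_def by (subst Sum_any.expand_superset[OF _ fin]) (simp_all add: A'_def)
  also have "(X \<otimes>\<^sub>S B') k v = (of_nat m * \<phi> a n) *\<^sub>C (X \<otimes>\<^sub>S ser_pow X (m - 1)) (k - n) v"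
    unfolding B'_def by (simp only: ser_mult_scale(2)[OF lin_X cB] ser_mult_shift_right)
  also have "\<dots> = (of_nat m * \<phi> a n) *\<^sub>C ser_pow X m (k - n) v"
    by (cases m) simp_all
  finally show ?case by (simp add: cscale_add_left algebra_simps)
qed

lemma exp_eq_sum:
  assumes "nat (s * k) \<le> M"
  shows "ser_exp X k v = (\<Sum>m\<le>M. (1 / fact m) *\<^sub>C ser_pow X m k v)"
  unfolding ser_exp_def
proof (rule Sum_any.expand_superset)
  show "{m. (1 / fact m) *\<^sub>C ser_pow X m k v \<noteq> 0} \<subseteq> {..M}"
    using assms pow_zero[of k _ v] by (fastforce simp: not_less[symmetric])
qed simp

lemma exp_zero: "s * k < 0 \<Longrightarrow> ser_exp X k v = 0"
  by (auto simp: exp_eq_sum[of k 0] ser_const_def)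

lemma exp_0: "ser_exp X 0 v = v"
  by (simp add: exp_eq_sum[of 0 0] ser_const_def)

lemma exp_vacuum:
  assumes "\<And>k. X k v = 0"
  shows "ser_exp X k v = (if k = 0 then v else 0)"
proof -
  have "ser_pow X m k v = 0" if "m > 0" for m k
    using that
  proof (induction m arbitrary: k rule: nat_induct_non_zero)
    case 1
    have "X (k - n) (ser_const id n v) = 0" for n
      by (simp add: ser_const_def assms lin_0[OF lin_X])
    then show ?case by (simp add: ser_mult_def)
  qed (simp add: ser_mult_def lin_0[OF lin_X])
  then have "ser_exp X k v = (\<Sum>m\<in>{0}. (1 / fact m) *\<^sub>C ser_pow X m k v)"
    unfolding ser_exp_def by (intro Sum_any.expand_superset) auto
  then show ?thesis by (simp add: ser_const_def)
qed

text \<open>Since [h, X] is a scalar, [h, exp X] = [h, X] exp X: the exponential has the same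
  covariance \<phi> as its exponent.\<close>

lemma vertex_series_exp: "vertex_series N (ser_exp X) \<phi> (\<lambda>_. 0) 0"
proof (rule vertex_seriesI)
  show "lin (ser_exp X k)" for k
    unfolding exp_eq_sum[OF order_refl] by (intro lin_setsum lin_scale lin_pow)
next
  fix k \<mu> \<alpha> \<nu> \<gamma>
  assume "lookup (ser_exp X k (bas (\<mu>, \<alpha>))) (\<nu>, \<gamma>) \<noteq> 0"
  then obtain m where "lookup (ser_pow X m k (bas (\<mu>, \<alpha>))) (\<nu>, \<gamma>) \<noteq> 0"
    unfolding exp_eq_sum[OF order_refl] lookup_sum lookup_cscale
    by (force dest: sum.not_neutral_contains_not_neutral)
  from gradedD[OF graded_pow this]
  show "\<gamma> = \<alpha> + 0 \<and> int (weight \<nu>) = int (weight \<mu>) + k - 0 \<and> (good N \<mu> \<longrightarrow> good N \<nu>)"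
    by simp
next
  fix a n k v
  assume an: "a < N" "n \<noteq> (0::int)"
  \<comment> \<open>Large enough for both degrees k and k - n. The sum for degree k runs to
    \<open>Suc M\<close> because lowering the power of X by one shifts the summation index, leaving
    exactly the sum up to M.\<close>
  define M where "M = max (nat (s * k)) (nat (s * (k - n)))"
  let ?P = "ser_pow X"
  have "(\<Sum>m\<le>Suc M. (1 / fact m * (of_nat m * \<phi> a n)) *\<^sub>C ?P (m - 1) (k - n) v)
    = (\<Sum>m\<le>M. (1 / fact (Suc m) * (of_nat (Suc m) * \<phi> a n)) *\<^sub>C ?P m (k - n) v)"
    by (subst sum.atMost_Suc_shift) simp
  also have "\<dots> = (\<Sum>m\<le>M. \<phi> a n *\<^sub>C (1 / fact m) *\<^sub>C ?P m (k - n) v)"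
  proof (rule sum.cong[OF refl])
    fix m
    have "1 / fact (Suc m) * (of_nat (Suc m) * \<phi> a n) = \<phi> a n * (1 / fact m)"
      by (simp add: fact_Suc field_simps del: of_nat_Suc)
    then show "(1 / fact (Suc m) * (of_nat (Suc m) * \<phi> a n)) *\<^sub>C ?P m (k - n) v
       = \<phi> a n *\<^sub>C (1 / fact m) *\<^sub>C ?P m (k - n) v"
      by (simp only: cscale_cscale)
  qed
  finally have shift: "(\<Sum>m\<le>Suc M. (1 / fact m * (of_nat m * \<phi> a n)) *\<^sub>C ?P (m - 1) (k - n) v)
    = \<phi> a n *\<^sub>C (\<Sum>m\<le>M. (1 / fact m) *\<^sub>C ?P m (k - n) v)"
    by (simp add: cscale_sum)
  have "heis N (int a) n (ser_exp X k v)
     = heis N (int a) n (\<Sum>m\<le>Suc M. (1 / fact m) *\<^sub>C ?P m k v)"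
    by (subst exp_eq_sum[of k "Suc M"]) (simp_all add: M_def)
  also have "\<dots> = (\<Sum>m\<le>Suc M. (1 / fact m) *\<^sub>C ?P m k (heis N (int a) n v)
       + (1 / fact m * (of_nat m * \<phi> a n)) *\<^sub>C ?P (m - 1) (k - n) v)"
    by (simp only: lin_sum[OF lin_heis] lin_cscale[OF lin_heis] heis_pow[OF an] cscale_add cscale_cscale)
  also have "\<dots> = (\<Sum>m\<le>Suc M. (1 / fact m) *\<^sub>C ?P m k (heis N (int a) n v))
       + \<phi> a n *\<^sub>C (\<Sum>m\<le>M. (1 / fact m) *\<^sub>C ?P m (k - n) v)"
    by (simp only: sum.distrib shift)
  also have "(\<Sum>m\<le>Suc M. (1 / fact m) *\<^sub>C ?P m k (heis N (int a) n v)) = ser_exp X k (heis N (int a) n v)"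
    by (rule exp_eq_sum[symmetric]) (simp add: M_def)
  also have "(\<Sum>m\<le>M. (1 / fact m) *\<^sub>C ?P m (k - n) v) = ser_exp X (k - n) v"
    by (rule exp_eq_sum[symmetric]) (simp add: M_def)
  finally show "heis N (int a) n (ser_exp X k v)
      = ser_exp X k (heis N (int a) n v) + \<phi> a n *\<^sub>C ser_exp X (k - n) v" .
qed

end

section \<open>Vacuum expectation values\<close>

abbreviation vac :: "lattice \<Rightarrow> fock" where
  "vac \<alpha> \<equiv> bas (0, \<alpha>)"

lemma mem_VQ: "v \<in> VQ N \<longleftrightarrow> (\<forall>(\<mu>, \<alpha>)\<in>keys v. good N \<mu> \<and> \<alpha> \<in> root_lattice N)"
  by (simp add: VQ_def good_def)

lemma good_0 [simp]: "good N 0"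
  by (simp add: good_def)

lemma good_add_single: "good N (\<mu> + single (i, n) 1)" if "good N \<mu>" "i < N" "n \<ge> 1"
  using that keys_add[of \<mu> "single (i, n) 1"] by (auto simp: good_def)

lemma good_minus_single: "good N \<mu> \<Longrightarrow> good N (\<mu> - single x k)"
proof -
  have "keys (\<mu> - single x k) \<subseteq> keys \<mu>"
    by (auto simp: in_keys_iff lookup_minus)
  then show "good N \<mu> \<Longrightarrow> good N (\<mu> - single x k)"
    unfolding good_def by blast
qed

lemma good_weight_0: "good N \<mu> \<Longrightarrow> weight \<mu> = 0 \<Longrightarrow> \<mu> = 0"
proof (rule poly_mapping_eqI, rule ccontr)
  fix x
  assume g: "good N \<mu>" "weight \<mu> = 0" and "lookup \<mu> x \<noteq> lookup 0 x"
  then have x: "x \<in> keys \<mu>" by (simp add: in_keys_iff)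
  then have "snd x \<ge> 1" using g by (auto simp: good_def)
  moreover have "snd x * lookup \<mu> x = 0" using g x by (auto simp: weight_def)
  ultimately show False using x by (auto simp: in_keys_iff)
qed

lemma good_cases:
  assumes "good N \<mu>" "\<mu> \<noteq> 0"
  obtains \<nu> i n where "\<mu> = \<nu> + single (i, n) 1" "i < N" "n \<ge> 1" "good N \<nu>" "weight \<nu> < weight \<mu>"
proof -
  obtain x where x: "lookup \<mu> x \<noteq> 0"
    using assms(2) by (metis lookup_zero poly_mapping_eqI)
  obtain i n where in_: "x = (i, n)" by (cases x)
  have "x \<in> keys \<mu>" using x by (simp add: in_keys_iff)
  then have *: "i < N" "n \<ge> 1" using assms(1) in_ by (auto simp: good_def)
  have "\<mu> = \<mu> - single x 1 + single x 1" using monomial_minus_single_add[OF x] by simp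
  moreover from arg_cong[OF this, of weight] have "weight (\<mu> - single x 1) < weight \<mu>"
    using * by (simp add: weight_add in_)
  ultimately show ?thesis
    using that[of "\<mu> - single x 1" i n] * good_minus_single[OF assms(1)] in_ by simp
qed

lemma heis_vac: "n > 0 \<Longrightarrow> heis N i n (vac \<alpha>) = 0"
  by (simp add: heis_bas_pos)

text \<open>The numerical factor is nonzero, so the coefficient of u at any monomial containing the
  variable (i, n) can be read off after applying one annihilator.\<close>

lemma lookup_heis_pos:
  assumes "i < N" "n > 0"
  shows "lookup (heis N (int i) (int n) u) (\<mu>, \<gamma>)
    = of_nat (n * (lookup \<mu> (i, n) + 1)) * lookup u (\<mu> + single (i, n) 1, \<gamma>)"
proof -
  let ?b = "(\<mu> + single (i, n) 1, \<gamma>)"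
  have b: "lookup (heis N (int i) (int n) (bas b)) (\<mu>, \<gamma>)
      = (if b = ?b then of_nat (n * (lookup \<mu> (i, n) + 1)) else 0)" for b
  proof -
    obtain \<nu> \<delta> where b: "b = (\<nu>, \<delta>)" by (cases b)
    have eq: "\<nu> = \<mu> + single (i, n) 1" if "\<mu> = \<nu> - single (i, n) 1" "lookup \<nu> (i, n) \<noteq> 0"
      using monomial_minus_single_add[OF that(2)] that(1) by simp
    show ?thesis
      using assms eq
      by (cases "lookup \<nu> (i, n) = 0")
        (auto simp: b heis_bas_pos lookup_single when_def lookup_add algebra_simps)
  qed
  have "lookup (heis N (int i) (int n) u) (\<mu>, \<gamma>)
      = (\<Sum>b\<in>keys u. lookup u b * (if b = ?b then of_nat (n * (lookup \<mu> (i, n) + 1)) else 0))"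
    by (subst lin_expansion[OF lin_heis]) (simp only: lookup_sum lookup_cscale b)
  also have "\<dots> = of_nat (n * (lookup \<mu> (i, n) + 1)) * lookup u ?b"
    by (simp add: if_distrib[of "(*) _"] sum.If_cases in_keys_iff mult.commute cong: if_cong)
  finally show ?thesis .
qed

lemma lookup_heis_neg: "n < 0 \<Longrightarrow> lookup (heis N i n u) (0, \<gamma>) = 0"
proof (rule ccontr)
  assume n: "n < 0" and "lookup (heis N i n u) (0, \<gamma>) \<noteq> 0"
  then obtain b where "lookup (heis N i n (bas b)) (0, \<gamma>) \<noteq> 0"
    by (auto elim: lin_lookup_nonzero[OF lin_heis])
  moreover obtain \<mu> \<alpha> where "b = (\<mu>, \<alpha>)" by (cases b)
  ultimately have "\<mu> + single (nat (i mod int N), nat (- n)) 1 = 0"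
    using n by (auto simp: heis_bas_neg lookup_single when_def split: if_splits)
  from arg_cong[OF this, of "\<lambda>\<mu>. lookup \<mu> (nat (i mod int N), nat (- n))"]
  show False by (simp add: lookup_add)
qed

text \<open>Each summand multiplies a monomial by n times its exponent at (a, n), and these add up
  to the weight. For r > 0 this writes u as creators applied to vectors of smaller weight, the
  source of the recursion for expectation values.\<close>

lemma euler:
  assumes "\<And>\<mu> \<alpha>. (\<mu>, \<alpha>) \<in> keys u \<Longrightarrow> good N \<mu> \<and> weight \<mu> = r"
  shows "of_nat r *\<^sub>C u = (\<Sum>n=1..r. \<Sum>a<N. heis N (int a) (- int n) (heis N (int a) (int n) u))"
proof -
  have "(\<lambda>v. of_nat r *\<^sub>C v) u = (\<lambda>v. \<Sum>n=1..r. \<Sum>a<N. heis N (int a) (- int n) (heis N (int a) (int n) v)) u"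
  proof (rule lin_eqI[OF lin_scale[OF lin_id]])
    show "lin (\<lambda>v. \<Sum>n=1..r. \<Sum>a<N. heis N (int a) (- int n) (heis N (int a) (int n) v))"
      by (intro lin_setsum lin_comp[OF lin_heis lin_heis])
    fix b assume b: "b \<in> keys u"
    obtain \<mu> \<alpha> where b': "b = (\<mu>, \<alpha>)" by (cases b)
    have g: "good N \<mu>" "weight \<mu> = r" using assms b b' by auto
    have 1: "heis N (int a) (- int n) (heis N (int a) (int n) (bas b)) = of_nat (n * lookup \<mu> (a, n)) *\<^sub>C bas b"
      if "n \<ge> 1" "a < N" for a n
    proof (cases "lookup \<mu> (a, n) = 0")
      case False
      have s: "single (\<nu>, \<delta>) c = c *\<^sub>C bas (\<nu>, \<delta>)" for \<nu> c and \<delta> :: lattice by simp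
      have "heis N (int a) (int n) (bas b) = of_nat (n * lookup \<mu> (a, n)) *\<^sub>C bas (\<mu> - single (a, n) 1, \<alpha>)"
        using that by (simp add: b' heis_bas_pos)
      with that monomial_minus_single_add[OF False] show ?thesis
        by (simp only: lin_cscale[OF lin_heis]) (simp add: b' heis_bas_neg)
    qed (use that in \<open>simp add: b' heis_bas_pos lin_0[OF lin_heis]\<close>)
    \<comment> \<open>A variable (a, n) that occurs has n at most the weight r, so the modes up to r
      see the whole monomial.\<close>
    have sub: "keys \<mu> \<subseteq> {..<N} \<times> {1..r}"
    proof
      fix x assume x: "x \<in> keys \<mu>"
      have "snd x * lookup \<mu> x \<le> weight \<mu>"
        unfolding weight_def by (rule member_le_sum[OF x]) auto
      moreover have "snd x \<le> snd x * lookup \<mu> x" using x by (simp add: in_keys_iff)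
      ultimately have "snd x \<le> weight \<mu>" by linarith
      with g x show "x \<in> {..<N} \<times> {1..r}" by (cases x) (auto simp: good_def)
    qed
    have "(\<Sum>n=1..r. \<Sum>a<N. heis N (int a) (- int n) (heis N (int a) (int n) (bas b)))
        = (\<Sum>n=1..r. \<Sum>a<N. of_nat (n * lookup \<mu> (a, n)) *\<^sub>C bas b)"
      by (intro sum.cong refl 1) auto
    also have "\<dots> = of_nat (\<Sum>n=1..r. \<Sum>a<N. n * lookup \<mu> (a, n)) *\<^sub>C bas b"
      by (simp only: cscale_sum_left of_nat_sum)
    also have "(\<Sum>n=1..r. \<Sum>a<N. n * lookup \<mu> (a, n)) = (\<Sum>a<N. \<Sum>n=1..r. n * lookup \<mu> (a, n))"
      by (rule sum.swap)
    also have "\<dots> = r"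
      using weight_superset[OF _ sub] g by (simp add: sum.cartesian_product case_prod_unfold)
    finally show "of_nat r *\<^sub>C bas b
      = (\<Sum>n=1..r. \<Sum>a<N. heis N (int a) (- int n) (heis N (int a) (int n) (bas b)))" by simp
  qed
  then show ?thesis .
qed

text \<open>Three indices for the three formal variables of the Serre relations; relations in two
  variables are constant in the last index and have coefficient 0 there. Unlike products of vertex
  series, these families are closed under sums and differences, so both sides of a relation can be
  compared directly.\<close>

definition heis_family ::
  "nat \<Rightarrow> (int \<Rightarrow> int \<Rightarrow> int \<Rightarrow> fock \<Rightarrow> fock) \<Rightarrow> (nat \<Rightarrow> int \<Rightarrow> complex) \<Rightarrow> (nat \<Rightarrow> int \<Rightarrow> complex) \<Rightarrow>
   (nat \<Rightarrow> int \<Rightarrow> complex) \<Rightarrow> bool" where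
  "heis_family N T \<phi> \<psi> \<chi> \<longleftrightarrow> (\<forall>k l m. lin (T k l m)) \<and> (\<forall>k l m. \<forall>v\<in>VQ N. T k l m v \<in> VQ N) \<and>
     (\<forall>a n k l m v. a < N \<longrightarrow> n \<noteq> 0 \<longrightarrow> heis N (int a) n (T k l m v) = T k l m (heis N (int a) n v)
        + \<phi> a n *\<^sub>C T (k - n) l m v + \<psi> a n *\<^sub>C T k (l - n) m v + \<chi> a n *\<^sub>C T k l (m - n) v)"

lemma heis_familyI:
  assumes "\<And>k l m. lin (T k l m)" "\<And>k l m v. v \<in> VQ N \<Longrightarrow> T k l m v \<in> VQ N"
    "\<And>a n k l m v. a < N \<Longrightarrow> n \<noteq> 0 \<Longrightarrow> heis N (int a) n (T k l m v) = T k l m (heis N (int a) n v)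
        + \<phi> a n *\<^sub>C T (k - n) l m v + \<psi> a n *\<^sub>C T k (l - n) m v + \<chi> a n *\<^sub>C T k l (m - n) v"
  shows "heis_family N T \<phi> \<psi> \<chi>"
  using assms by (simp add: heis_family_def)

lemma heis_familyD:
  assumes "heis_family N T \<phi> \<psi> \<chi>"
  shows "lin (T k l m)" "v \<in> VQ N \<Longrightarrow> T k l m v \<in> VQ N"
    "a < N \<Longrightarrow> n \<noteq> 0 \<Longrightarrow> heis N (int a) n (T k l m v) = T k l m (heis N (int a) n v)
        + \<phi> a n *\<^sub>C T (k - n) l m v + \<psi> a n *\<^sub>C T k (l - n) m v + \<chi> a n *\<^sub>C T k l (m - n) v"
  using assms by (simp_all add: heis_family_def)

text \<open>The annihilators determine \<open>T\<close> on the vacua from the vacuum expectation values, and the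
  creators then determine \<open>T\<close> everywhere.\<close>

theorem heis_family_eq_0:
  assumes T: "heis_family N T \<phi> \<psi> \<chi>"
    and vev: "\<And>k l m \<alpha> \<gamma>. \<alpha> \<in> root_lattice N \<Longrightarrow> lookup (T k l m (vac \<alpha>)) (0, \<gamma>) = 0"
    and v: "v \<in> VQ N"
  shows "T k l m v = 0"
proof -
  have coeff: "lookup (T k l m (vac \<alpha>)) (\<mu>, \<gamma>) = 0"
    if "good N \<mu>" "\<alpha> \<in> root_lattice N" for k l m \<mu> \<gamma> \<alpha>
    using that
  proof (induction "weight \<mu>" arbitrary: \<mu> k l m rule: less_induct)
    case less
    show ?case
    proof (cases "\<mu> = 0")
      case True
      then show ?thesis using vev less.prems by simp
    next
      case False
      then obtain \<nu> i n where \<nu>: "\<mu> = \<nu> + single (i, n) 1" "i < N" "n \<ge> 1" "good N \<nu>" "weight \<nu> < weight \<mu>"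
        using good_cases less.prems by blast
      \<comment> \<open>The annihilator kills e^\<alpha>, and the shifted terms vanish at \<nu> by
        the induction hypothesis, which is available for all indices k, l, m.\<close>
      have "lookup (heis N (int i) (int n) (T k l m (vac \<alpha>))) (\<nu>, \<gamma>) = 0"
        using \<nu> less by (subst heis_familyD(3)[OF T]) (simp_all add: heis_vac lin_0[OF heis_familyD(1)[OF T]] lookup_add)
      then show ?thesis
        using \<nu> lookup_heis_pos[of i N n "T k l m (vac \<alpha>)" \<nu> \<gamma>]
        by (simp del: of_nat_mult of_nat_Suc of_nat_add add: of_nat_eq_0_iff)
    qed
  qed
  have "T k l m (vac \<alpha>) = 0" if "\<alpha> \<in> root_lattice N" for k l m \<alpha>
  proof (rule poly_mapping_eqI)
    fix b :: fock_basis
    obtain \<mu> \<gamma> where b: "b = (\<mu>, \<gamma>)" by (cases b)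
    have "vac \<alpha> \<in> VQ N" using that by (simp add: mem_VQ)
    then have "T k l m (vac \<alpha>) \<in> VQ N" by (rule heis_familyD(2)[OF T])
    then have "good N \<mu> \<or> lookup (T k l m (vac \<alpha>)) b = 0"
      unfolding b mem_VQ by (auto simp: in_keys_iff)
    then show "lookup (T k l m (vac \<alpha>)) b = lookup 0 b"
      using coeff that b by auto
  qed
  then have "T k l m (bas (\<mu>, \<alpha>)) = 0" if "good N \<mu>" "\<alpha> \<in> root_lattice N" for k l m \<mu> \<alpha>
    using that
  proof (induction "weight \<mu>" arbitrary: \<mu> k l m rule: less_induct)
    case less
    show ?case
    proof (cases "\<mu> = 0")
      case True
      then show ?thesis using less.prems by simp
    next
      case False
      then obtain \<nu> i n where \<nu>: "\<mu> = \<nu> + single (i, n) 1" "i < N" "n \<ge> 1" "good N \<nu>" "weight \<nu> < weight \<mu>"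
        using good_cases less.prems by blast
      have z: "T k l m (bas (\<nu>, \<alpha>)) = 0" for k l m
        using less \<nu> by simp
      \<comment> \<open>As all T vanish on this smaller monomial, the shifted terms drop out and T
        commutes with the creator there.\<close>
      have "heis N (int i) (- int n) (T k l m (bas (\<nu>, \<alpha>))) = T k l m (heis N (int i) (- int n) (bas (\<nu>, \<alpha>)))"
        using \<nu> by (subst heis_familyD(3)[OF T]) (simp_all add: z)
      then show ?thesis
        using \<nu> by (simp add: z lin_0[OF lin_heis] heis_bas_neg)
    qed
  qed
  with v show ?thesis
    by (subst lin_expansion[OF heis_familyD(1)[OF T]]) (auto simp: mem_VQ intro!: sum.neutral)
qed

text \<open>The numbers c_n in the factor exp(\<Sum> c_n (w/z)^n / n) that A(z) B(w) acquires by
  normal ordering: a creator moving left through A contributes the minus sign and \<phi> at -n, the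
  annihilator acting on B contributes \<psi> at n.\<close>

definition contraction ::
  "nat \<Rightarrow> (nat \<Rightarrow> int \<Rightarrow> complex) \<Rightarrow> (nat \<Rightarrow> int \<Rightarrow> complex) \<Rightarrow> nat \<Rightarrow> complex" where
  "contraction N \<phi> \<psi> n = - (\<Sum>a<N. \<phi> a (- int n) * \<psi> a (int n))"

text \<open>\<open>exp_int c F\<close> states that $F = \exp(\sum_{n \ge 1} c_n X^n / n)$.\<close>

definition exp_int :: "(nat \<Rightarrow> complex) \<Rightarrow> complex fps \<Rightarrow> bool" where
  "exp_int c F \<longleftrightarrow> fps_nth F 0 = 1 \<and>
     (\<forall>r. of_nat r * fps_nth F r = (\<Sum>n=1..r. c n * fps_nth F (r - n)))"

text \<open>The value \<open>\<kappa> \<alpha>\<close> is the matrix coefficient of the leading term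
  on e^\<alpha>. Together with the covariance, the order and the lattice shift it determines the
  expectation values.\<close>

definition vertex_op ::
  "nat \<Rightarrow> op_series \<Rightarrow> (nat \<Rightarrow> int \<Rightarrow> complex) \<Rightarrow> (lattice \<Rightarrow> int) \<Rightarrow> lattice \<Rightarrow> (lattice \<Rightarrow> complex) \<Rightarrow> bool" where
  "vertex_op N A \<phi> f \<beta> \<kappa> \<longleftrightarrow> vertex_series N A \<phi> f \<beta> \<and>
     (\<forall>\<alpha>. lookup (A (f \<alpha>) (vac \<alpha>)) (0, \<alpha> + \<beta>) = \<kappa> \<alpha>)"

lemma vertex_opD:
  assumes "vertex_op N A \<phi> f \<beta> \<kappa>"
  shows "vertex_series N A \<phi> f \<beta>" "lookup (A (f \<alpha>) (vac \<alpha>)) (0, \<alpha> + \<beta>) = \<kappa> \<alpha>"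
  using assms by (simp_all add: vertex_op_def)

lemma one_point:
  assumes A: "vertex_op N A \<phi> f \<beta> \<kappa>"
  shows "lookup (A k (vac \<alpha>)) (0, \<gamma>) = (if k = f \<alpha> \<and> \<gamma> = \<alpha> + \<beta> then \<kappa> \<alpha> else 0)"
proof -
  note vs = vertex_opD(1)[OF A]
  have "lookup (A k (vac \<alpha>)) (0, \<gamma>) = 0" if "\<not> (k = f \<alpha> \<and> \<gamma> = \<alpha> + \<beta>)"
  proof (rule ccontr)
    assume "lookup (A k (vac \<alpha>)) (0, \<gamma>) \<noteq> 0"
    from gradedD[OF vertex_seriesD(2)[OF vs] this] that show False by simp
  qed
  with vertex_opD(2)[OF A] show ?thesis by auto
qed

text \<open>In the leading degree the weight is 0, and 1 is the only good monomial of weight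
  0.\<close>

lemma leading_vector:
  assumes A: "vertex_op N A \<phi> f \<beta> \<kappa>"
  shows "A (f \<alpha>) (vac \<alpha>) = \<kappa> \<alpha> *\<^sub>C vac (\<alpha> + \<beta>)"
proof (rule poly_mapping_eqI)
  fix b :: fock_basis
  obtain \<nu> \<gamma> where b: "b = (\<nu>, \<gamma>)" by (cases b)
  note vs = vertex_opD(1)[OF A]
  show "lookup (A (f \<alpha>) (vac \<alpha>)) b = lookup (\<kappa> \<alpha> *\<^sub>C vac (\<alpha> + \<beta>)) b"
  proof (cases "lookup (A (f \<alpha>) (vac \<alpha>)) b = 0")
    case True
    then show ?thesis
      using one_point[OF A, of "f \<alpha>" \<alpha> \<gamma>] by (auto simp: b lookup_single when_def)
  next
    case False
    from gradedD[OF vertex_seriesD(2)[OF vs] False[unfolded b]]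
    have "\<nu> = 0" "\<gamma> = \<alpha> + \<beta>" using good_weight_0[of N \<nu>] by auto
    then show ?thesis using vertex_opD(2)[OF A] by (simp add: b)
  qed
qed

lemma below_leading:
  assumes A: "vertex_op N A \<phi> f \<beta> \<kappa>" and "k < f \<alpha>"
  shows "A k (vac \<alpha>) = 0"
proof (rule poly_mapping_eqI, rule ccontr)
  fix b :: fock_basis
  assume "lookup (A k (vac \<alpha>)) b \<noteq> lookup 0 b"
  then have "lookup (A k (vac \<alpha>)) (fst b, snd b) \<noteq> 0" by simp
  from gradedD(2)[OF vertex_seriesD(2)[OF vertex_opD(1)[OF A]] this] assms(2)
  show False by simp
qed

lemma sum_triangle_swap:
  fixes h :: "nat \<Rightarrow> nat \<Rightarrow> 'a::comm_monoid_add"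
  shows "(\<Sum>n=1..r. \<Sum>u\<le>r-n. h n u) = (\<Sum>u\<le>r. \<Sum>n=1..r-u. h n u)"
    and "(\<Sum>n=1..r. \<Sum>u\<le>r-n. h n u) = (\<Sum>u\<le>r. \<Sum>n=1..u. h n (u - n))"
  unfolding sum.Sigma[OF finite_atLeastAtMost ballI[OF finite_atMost]]
    sum.Sigma[OF finite_atMost ballI[OF finite_atLeastAtMost]]
   apply (rule sum.reindex_bij_witness[of _ "\<lambda>(u, n). (n, u)" "\<lambda>(n, u). (u, n)"]; force)
  apply (rule sum.reindex_bij_witness[of _ "\<lambda>(u, n). (n, u - n)" "\<lambda>(n, u). (u + n, n)"]; force)
  done

text \<open>Strips the rightmost operator from an expectation value. D stands for the one or two
  operators on its left, with \<phi> and \<phi>' the covariance in their variables. Moving the modes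
  of B through D distributes the degree r over these two variables, weighted by the two contraction
  series.\<close>

lemma expectation_step:
  fixes D :: "int \<Rightarrow> int \<Rightarrow> fock \<Rightarrow> fock"
  assumes linD: "\<And>k l. lin (D k l)"
    and D: "\<And>a n k l v. a < N \<Longrightarrow> n \<noteq> 0 \<Longrightarrow> heis N (int a) n (D k l v)
      = D k l (heis N (int a) n v) + \<phi> a n *\<^sub>C D (k - n) l v + \<phi>' a n *\<^sub>C D k (l - n) v"
    and B: "vertex_op N B \<psi> g \<gamma> \<kappa>"
    and F: "exp_int (contraction N \<phi> \<psi>) F" "exp_int (contraction N \<phi>' \<psi>) F'"
  shows "lookup (D k l (B (g \<alpha> + int r) (vac \<alpha>))) (0, \<delta>)
    = \<kappa> \<alpha> * (\<Sum>u\<le>r. fps_nth F u * fps_nth F' (r - u) *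
        lookup (D (k + int u) (l + int (r - u)) (vac (\<alpha> + \<gamma>))) (0, \<delta>))"
proof (induction r arbitrary: k l rule: less_induct)
  case (less r)
  define W where "W k l r = lookup (D k l (B (g \<alpha> + int r) (vac \<alpha>))) (0, \<delta>)" for k l r
  define W0 where "W0 k l = lookup (D k l (vac (\<alpha> + \<gamma>))) (0, \<delta>)" for k l
  let ?c = "contraction N \<phi> \<psi>" and ?c' = "contraction N \<phi>' \<psi>"
  note vs = vertex_opD(1)[OF B]
  show ?case
  proof (cases "r = 0")
    case True
    then show ?thesis
      using F by (simp add: leading_vector[OF B] lin_cscale[OF linD] exp_int_def del: cscale_single)
  next
    case False
    define u where "u = B (g \<alpha> + int r) (vac \<alpha>)"
    have "good N \<mu> \<and> weight \<mu> = r" if "(\<mu>, \<beta>) \<in> keys u" for \<mu> \<beta>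
      using gradedD(2,3)[OF vertex_seriesD(2)[OF vs], of "g \<alpha> + int r" 0 \<alpha> \<mu> \<beta>] that
      by (simp add: u_def in_keys_iff)
    then have eu: "of_nat r *\<^sub>C u = (\<Sum>n=1..r. \<Sum>a<N. heis N (int a) (- int n) (heis N (int a) (int n) u))"
      by (rule euler)
    have hu: "heis N (int a) (int n) u = \<psi> a (int n) *\<^sub>C B (g \<alpha> + int (r - n)) (vac \<alpha>)"
      if "a < N" "n \<ge> 1" "n \<le> r" for a n
      using that by (simp add: u_def vertex_seriesD(4)[OF vs] heis_vac lin_0[OF vertex_seriesD(1)[OF vs]]
          of_nat_diff algebra_simps)
    \<comment> \<open>The vacuum functional kills a creator on the far left, so only its commutators
      with D survive.\<close>
    have D': "lookup (D k l (heis N (int a) (- int n) v)) (0, \<delta>)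
        = - (\<phi> a (- int n) * lookup (D (k + int n) l v) (0, \<delta>)
           + \<phi>' a (- int n) * lookup (D k (l + int n) v) (0, \<delta>))" if "a < N" "n \<ge> 1" for a n v
    proof -
      have "lookup (heis N (int a) (- int n) (D k l v)) (0, \<delta>) = 0"
        using that by (intro lookup_heis_neg) simp
      then show ?thesis
        using that by (simp add: D lookup_add add_eq_0_iff)
    qed
    have W: "W k l r' = \<kappa> \<alpha> * (\<Sum>u\<le>r'. fps_nth F u * fps_nth F' (r' - u) * W0 (k + int u) (l + int (r' - u)))"
      if "r' < r" for r' k l
      using less[OF that] by (simp add: W_def W0_def)
    have "of_nat r * W k l r = lookup (D k l (of_nat r *\<^sub>C u)) (0, \<delta>)"
      by (simp add: W_def u_def lin_cscale[OF linD])
    also have "\<dots> = (\<Sum>n=1..r. \<Sum>a<N. lookup (D k l (heis N (int a) (- int n) (heis N (int a) (int n) u))) (0, \<delta>))"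
      by (simp only: eu lin_sum[OF linD] lookup_sum)
    also have "\<dots> = (\<Sum>n=1..r. \<Sum>a<N. - (\<phi> a (- int n) * \<psi> a (int n)) * W (k + int n) l (r - n)
         + - (\<phi>' a (- int n) * \<psi> a (int n)) * W k (l + int n) (r - n))"
      by (intro sum.cong refl) (simp add: D' hu W_def lin_cscale[OF linD] algebra_simps)
    also have "\<dots> = (\<Sum>n=1..r. ?c n * W (k + int n) l (r - n) + ?c' n * W k (l + int n) (r - n))"
      by (simp add: contraction_def sum_subtractf sum_distrib_right sum_negf)
    also have "\<dots> = (\<Sum>n=1..r. ?c n * W (k + int n) l (r - n)) + (\<Sum>n=1..r. ?c' n * W k (l + int n) (r - n))"
      by (rule sum.distrib)
    also have "(\<Sum>n=1..r. ?c n * W (k + int n) l (r - n))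
      = (\<Sum>n=1..r. \<Sum>u\<le>r-n. \<kappa> \<alpha> * (?c n * fps_nth F u * fps_nth F' (r - (n + u)) * W0 (k + int (n + u)) (l + int (r - (n + u)))))"
      by (intro sum.cong refl) (simp add: W sum_distrib_left algebra_simps diff_diff_eq)
    also have "\<dots> = (\<Sum>u\<le>r. \<Sum>n=1..u. \<kappa> \<alpha> * (?c n * fps_nth F (u - n) * fps_nth F' (r - u) * W0 (k + int u) (l + int (r - u))))"
      by (subst sum_triangle_swap(2)) (intro sum.cong refl; simp)
    also have "\<dots> = (\<Sum>u\<le>r. \<kappa> \<alpha> * ((of_nat u * fps_nth F u) * fps_nth F' (r - u) * W0 (k + int u) (l + int (r - u))))"
      using F(1) by (intro sum.cong refl) (simp add: exp_int_def sum_distrib_left sum_distrib_right)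
    also have "(\<Sum>n=1..r. ?c' n * W k (l + int n) (r - n))
      = (\<Sum>n=1..r. \<Sum>u\<le>r-n. \<kappa> \<alpha> * (fps_nth F u * (?c' n * fps_nth F' (r - u - n)) * W0 (k + int u) (l + int (r - u))))"
    proof (intro sum.cong refl)
      fix n assume n: "n \<in> {1..r}"
      have "W k (l + int n) (r - n) = (\<Sum>u\<le>r-n. \<kappa> \<alpha> * (fps_nth F u * fps_nth F' (r - u - n) * W0 (k + int u) (l + int (r - u))))"
        unfolding W[OF diff_less, of n k "l + int n"] sum_distrib_left
        using n by (subst W) (auto simp: sum_distrib_left diff_diff_eq add.commute of_nat_diff algebra_simps intro!: sum.cong)
      then show "?c' n * W k (l + int n) (r - n) =
         (\<Sum>u\<le>r-n. \<kappa> \<alpha> * (fps_nth F u * (?c' n * fps_nth F' (r - u - n)) * W0 (k + int u) (l + int (r - u))))"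
        by (simp add: sum_distrib_left algebra_simps)
    qed
    also have "\<dots> = (\<Sum>u\<le>r. \<Sum>n=1..r-u. \<kappa> \<alpha> * (fps_nth F u * (?c' n * fps_nth F' (r - u - n)) * W0 (k + int u) (l + int (r - u))))"
      by (rule sum_triangle_swap(1))
    also have "\<dots> = (\<Sum>u\<le>r. \<kappa> \<alpha> * (fps_nth F u * (of_nat (r - u) * fps_nth F' (r - u)) * W0 (k + int u) (l + int (r - u))))"
    proof (intro sum.cong refl)
      fix u
      have "of_nat (r - u) * fps_nth F' (r - u) = (\<Sum>n=1..r-u. ?c' n * fps_nth F' (r - u - n))"
        using F(2) by (simp add: exp_int_def)
      then show "(\<Sum>n=1..r-u. \<kappa> \<alpha> * (fps_nth F u * (?c' n * fps_nth F' (r - u - n)) * W0 (k + int u) (l + int (r - u))))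
        = \<kappa> \<alpha> * (fps_nth F u * (of_nat (r - u) * fps_nth F' (r - u)) * W0 (k + int u) (l + int (r - u)))"
        by (simp only: sum_distrib_left sum_distrib_right)
    qed
    finally have "of_nat r * W k l r = (\<Sum>u\<le>r. \<kappa> \<alpha> * (of_nat u * fps_nth F u * fps_nth F' (r - u) * W0 (k + int u) (l + int (r - u))))
       + (\<Sum>u\<le>r. \<kappa> \<alpha> * (fps_nth F u * (of_nat (r - u) * fps_nth F' (r - u)) * W0 (k + int u) (l + int (r - u))))" .
    \<comment> \<open>The two sums carry the weights u and r - u, which add up to r. This is the
      product rule for the logarithmic derivatives of F and F', so their product solves the
      recursion.\<close>
    also have "\<dots> = (\<Sum>u\<le>r. of_nat r * (\<kappa> \<alpha> * (fps_nth F u * fps_nth F' (r - u) * W0 (k + int u) (l + int (r - u)))))"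
      unfolding sum.distrib[symmetric]
      by (intro sum.cong refl) (simp add: of_nat_diff algebra_simps)
    also have "\<dots> = of_nat r * (\<kappa> \<alpha> * (\<Sum>u\<le>r. fps_nth F u * fps_nth F' (r - u) * W0 (k + int u) (l + int (r - u))))"
      by (simp only: sum_distrib_left)
    finally show ?thesis
      using False by (simp add: W_def W0_def)
  qed
qed

lemma exp_int_0: "exp_int (\<lambda>_. 0) 1"
  by (simp add: exp_int_def)

lemma contraction_zero_left: "contraction N (\<lambda>_ _. 0) \<psi> = (\<lambda>_. 0)"
  by (simp add: contraction_def fun_eq_iff)

text \<open>With a single operator on the left the second contraction series is 1, and only the term
  u = r of the convolution remains.\<close>

lemma two_point:
  assumes A: "vertex_op N A \<phi> f \<beta> \<kappa>" and B: "vertex_op N B \<psi> g \<gamma> \<kappa>'"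
    and F: "exp_int (contraction N \<phi> \<psi>) F"
  shows "lookup (A k (B l (vac \<alpha>))) (0, \<delta>) =
    (if l \<ge> g \<alpha> \<and> k + l = g \<alpha> + f (\<alpha> + \<gamma>) \<and> \<delta> = \<alpha> + \<gamma> + \<beta>
     then \<kappa>' \<alpha> * \<kappa> (\<alpha> + \<gamma>) * fps_nth F (nat (l - g \<alpha>)) else 0)"
proof (cases "l < g \<alpha>")
  case True
  then show ?thesis
    using lin_0[OF vertex_seriesD(1)[OF vertex_opD(1)[OF A]]] by (simp add: below_leading[OF B])
next
  case False
  define r where "r = nat (l - g \<alpha>)"
  have l: "l = g \<alpha> + int r" using False by (simp add: r_def)
  have "lookup (A k (B (g \<alpha> + int r) (vac \<alpha>))) (0, \<delta>) = \<kappa>' \<alpha> * (\<Sum>u\<le>r. fps_nth F u * fps_nth 1 (r - u) *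
        lookup (A (k + int u) (vac (\<alpha> + \<gamma>))) (0, \<delta>))"
    by (rule expectation_step[where D = "\<lambda>k l. A k" and \<phi>' = "\<lambda>_ _. 0", OF _ _ B F])
      (simp_all add: vertex_seriesD[OF vertex_opD(1)[OF A]] contraction_zero_left exp_int_0)
  also have "(\<Sum>u\<le>r. fps_nth F u * fps_nth 1 (r - u) * lookup (A (k + int u) (vac (\<alpha> + \<gamma>))) (0, \<delta>))
     = fps_nth F r * lookup (A (k + int r) (vac (\<alpha> + \<gamma>))) (0, \<delta>)"
    by (subst sum.mono_neutral_right[of _ "{r}"]) (auto simp: fps_one_nth)
  finally show ?thesis
    using False by (auto simp: l one_point[OF A])
qed

lemma three_point_step:
  assumes A: "vertex_series N A \<phi> f \<beta>" and A': "vertex_series N A' \<phi>' f' \<beta>'"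
    and B: "vertex_op N B \<psi> g \<gamma> \<kappa>"
    and F: "exp_int (contraction N \<phi> \<psi>) F" "exp_int (contraction N \<phi>' \<psi>) F'"
  shows "lookup (A k (A' l (B m (vac \<alpha>)))) (0, \<delta>) = (if m < g \<alpha> then 0 else
    \<kappa> \<alpha> * (\<Sum>u\<le>nat (m - g \<alpha>). fps_nth F u * fps_nth F' (nat (m - g \<alpha>) - u) *
       lookup (A (k + int u) (A' (l + int (nat (m - g \<alpha>) - u)) (vac (\<alpha> + \<gamma>)))) (0, \<delta>)))"
proof (cases "m < g \<alpha>")
  case True
  then show ?thesis
    by (simp add: below_leading[OF B] lin_0[OF vertex_seriesD(1)[OF A]] lin_0[OF vertex_seriesD(1)[OF A']])
next
  case False
  then have m: "m = g \<alpha> + int (nat (m - g \<alpha>))" by simp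
  have "lookup (A k (A' (l) (B (g \<alpha> + int (nat (m - g \<alpha>))) (vac \<alpha>)))) (0, \<delta>)
    = \<kappa> \<alpha> * (\<Sum>u\<le>nat (m - g \<alpha>). fps_nth F u * fps_nth F' (nat (m - g \<alpha>) - u) *
       lookup (A (k + int u) (A' (l + int (nat (m - g \<alpha>) - u)) (vac (\<alpha> + \<gamma>)))) (0, \<delta>))"
    by (rule expectation_step[where D = "\<lambda>k l v. A k (A' l v)", OF _ _ B F])
      (simp_all add: lin_comp[OF vertex_seriesD(1)[OF A] vertex_seriesD(1)[OF A']]
        vertex_seriesD(4)[OF A] vertex_seriesD(4)[OF A'] lin_add[OF vertex_seriesD(1)[OF A]]
        lin_cscale[OF vertex_seriesD(1)[OF A]] algebra_simps)
  with False show ?thesis by (simp only: m[symmetric] if_False)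
qed

section \<open>The lattice form\<close>

lemma lform_superset: "finite A \<Longrightarrow> keys \<alpha> \<subseteq> A \<Longrightarrow> lform \<alpha> \<beta> = (\<Sum>i\<in>A. lookup \<alpha> i * lookup \<beta> i)"
  unfolding lform_def by (rule sum.mono_neutral_left) (auto simp: in_keys_iff)

lemma lform_add_left: "lform (\<alpha> + \<beta>) \<gamma> = lform \<alpha> \<gamma> + lform \<beta> \<gamma>"
  using keys_add[of \<alpha> \<beta>]
  by (simp add: lform_superset[of "keys \<alpha> \<union> keys \<beta>"] lookup_add distrib_right sum.distrib)

lemma lform_add_right: "lform \<gamma> (\<alpha> + \<beta>) = lform \<gamma> \<alpha> + lform \<gamma> \<beta>"
  by (simp add: lform_def lookup_add distrib_left sum.distrib)

lemma lform_uminus_left: "lform (- \<alpha>) \<beta> = - lform \<alpha> \<beta>"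
  using lform_add_left[of \<alpha> "- \<alpha>" \<beta>] by (simp add: lform_def)

lemma lform_uminus_right: "lform \<beta> (- \<alpha>) = - lform \<beta> \<alpha>"
  by (simp add: lform_def sum_negf)

lemma lform_diff_left: "lform (\<alpha> - \<beta>) \<gamma> = lform \<alpha> \<gamma> - lform \<beta> \<gamma>"
  using lform_add_left[of \<alpha> "- \<beta>" \<gamma>] by (simp add: lform_uminus_left)

lemma lform_cmul_left: "lform (frag_cmul c \<alpha>) \<beta> = c * lform \<alpha> \<beta>"
proof -
  have "lform (frag_cmul c \<alpha>) \<beta> = (\<Sum>i\<in>keys \<alpha>. lookup (frag_cmul c \<alpha>) i * lookup \<beta> i)"
    by (rule lform_superset) auto
  then show ?thesis by (simp add: lform_def sum_distrib_left mult.assoc)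
qed

lemma lform_eps_vec: "lform (eps_vec N i) \<alpha> = lookup \<alpha> (nat (i mod int N))"
  by (simp add: lform_def eps_vec_def)

lemma lookup_eps_vec: "lookup (eps_vec N i) a = (if a = nat (i mod int N) then 1 else 0)"
  by (simp add: eps_vec_def lookup_single when_def)

lemma mod_int_eq_iff: "int N > 0 \<Longrightarrow> nat (i mod int N) = nat (j mod int N) \<longleftrightarrow> i mod int N = j mod int N"
  by (simp add: nat_eq_iff)

lemma lform_root:
  assumes "N > 0" "i mod int N \<noteq> j mod int N"
  shows "lform (eps_vec N i - eps_vec N j) (eps_vec N i - eps_vec N j) = 2"
    and "lform (eps_vec N j) (eps_vec N i - eps_vec N j) = -1"
  using assms mod_int_eq_iff[of N i j] by (auto simp: lform_diff_left lform_eps_vec lookup_minus lookup_eps_vec)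

section \<open>Exponentials of Heisenberg modes and the operators X_ij\<close>

lemma lookup_heis_bas_nonzero:
  assumes "lookup (heis N i (- k) (bas (\<mu>, \<alpha>))) (\<nu>, \<gamma>) \<noteq> 0" "k \<noteq> 0" "N > 0"
  shows "\<gamma> = \<alpha> \<and> int (weight \<nu>) = int (weight \<mu>) + k \<and> (good N \<mu> \<longrightarrow> good N \<nu>)"
proof (cases "k > 0")
  case True
  let ?x = "(nat (i mod int N), nat k)"
  have "\<nu> = \<mu> + single ?x 1" "\<gamma> = \<alpha>"
    using assms True by (auto simp: heis_bas_neg lookup_single when_def split: if_splits)
  moreover have "nat (i mod int N) < N" using assms(3) by (simp add: nat_less_iff)
  ultimately show ?thesis
    using True good_add_single[of N \<mu> "nat (i mod int N)" "nat k"] by (simp add: weight_add)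
next
  case False
  let ?x = "(nat (i mod int N), nat (- k))"
  have \<nu>: "\<nu> = \<mu> - single ?x 1" "\<gamma> = \<alpha>" "lookup \<mu> ?x \<noteq> 0"
    using assms False by (auto simp: heis_bas_pos lookup_single when_def split: if_splits)
  have "weight \<mu> = weight \<nu> + nat (- k)"
    using arg_cong[OF monomial_minus_single_add[OF \<nu>(3)], of weight] by (simp add: weight_add \<nu>(1))
  then show ?thesis
    using \<nu> False good_minus_single by auto
qed

text \<open>The exponents in the vertex operators combine the modes of at most two indices; i = j
  with \<open>c' = 0\<close> gives a single one. The factor n comes from [epsilon(n), epsilon(-n)] =
  n and cancels the denominators n of the exponents.\<close>

lemma heis_exponentI:
  assumes N: "N > 0" and s: "s = 1 \<or> s = -1"
    and X: "X = (\<lambda>k v. if s * k > 0 then c k *\<^sub>C heis N i (- k) v + c' k *\<^sub>C heis N j (- k) v else 0)"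
    and \<phi>: "\<phi> = (\<lambda>a n. if s * n > 0 then of_int n * ((if int a mod int N = i mod int N then c n else 0)
        + (if int a mod int N = j mod int N then c' n else 0)) else 0)"
  shows "heis_exponent N X s \<phi>"
proof
  fix k
  show "lin (X k)"
    unfolding X by (cases "s * k > 0") (simp_all add: lin_zero lin_plus lin_scale lin_heis)
next
  show "graded N X (\<lambda>_. 0) 0"
    unfolding graded_def
  proof (intro allI impI)
    fix k \<mu> \<alpha> \<nu> \<gamma>
    assume "lookup (X k (bas (\<mu>, \<alpha>))) (\<nu>, \<gamma>) \<noteq> 0"
    then have "k \<noteq> 0" "lookup (heis N i (- k) (bas (\<mu>, \<alpha>))) (\<nu>, \<gamma>) \<noteq> 0 \<or>
        lookup (heis N j (- k) (bas (\<mu>, \<alpha>))) (\<nu>, \<gamma>) \<noteq> 0"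
      by (auto simp: X lookup_add split: if_splits)
    then show "\<gamma> = \<alpha> + 0 \<and> int (weight \<nu>) = int (weight \<mu>) + k - 0 \<and> (good N \<mu> \<longrightarrow> good N \<nu>)"
      using lookup_heis_bas_nonzero N by fastforce
  qed
next
  fix a n k v
  assume an: "a < N" "n \<noteq> (0::int)"
  show "heis N (int a) n (X k v) = X k (heis N (int a) n v) + (if k = n then \<phi> a n else 0) *\<^sub>C v"
  proof (cases "s * k > 0")
    case True
    then have k: "k \<noteq> 0" by auto
    have 1: "heis N (int a) n (c *\<^sub>C heis N i (- k) v) = c *\<^sub>C heis N i (- k) (heis N (int a) n v)
       + (if int a mod int N = i mod int N \<and> k = n then of_int n * c else 0) *\<^sub>C v"
      if "k \<noteq> 0" for c i k
      using heis_commute[OF N an(2), of "- k"] that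
      by (simp add: lin_cscale[OF lin_heis] cscale_add mult.commute)
    show ?thesis
      using True k an
      by (cases "k = n") (simp_all add: X \<phi> lin_add[OF lin_heis] 1 cscale_add_left distrib_left)
  qed (use s in \<open>auto simp: X \<phi> lin_0[OF lin_heis]\<close>)
qed (use s in \<open>auto simp: X\<close>)

lemma heis_exponent_E_minus:
  assumes "N > 0"
  shows "heis_exponent N (\<lambda>k v. if k > 0 then (s / of_int k) *\<^sub>C heis N i (- k) v else 0) 1
     (\<lambda>a n. if n > 0 \<and> int a mod int N = i mod int N then s else 0)"
  by (rule heis_exponentI[where c = "\<lambda>k. s / of_int k" and c' = "\<lambda>_. 0" and i = i and j = i])
    (use assms in \<open>auto simp: fun_eq_iff\<close>)

lemma heis_exponent_E_plus:
  assumes "N > 0"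
  shows "heis_exponent N (\<lambda>k v. if k < 0 then (- (s / of_int (- k))) *\<^sub>C heis N i (- k) v else 0) (-1)
     (\<lambda>a n. if n < 0 \<and> int a mod int N = i mod int N then s else 0)"
  by (rule heis_exponentI[where c = "\<lambda>k. s / of_int k" and c' = "\<lambda>_. 0" and i = i and j = i])
    (use assms in \<open>auto simp: fun_eq_iff\<close>)

lemma E_minus:
  assumes "N > 0"
  shows "vertex_series N (E_minus N s i) (\<lambda>a n. if n > 0 \<and> int a mod int N = i mod int N then s else 0) (\<lambda>_. 0) 0"
    and "k < 0 \<Longrightarrow> E_minus N s i k v = 0" and "E_minus N s i 0 v = v"
  using heis_exponent.vertex_series_exp[OF heis_exponent_E_minus[OF assms, of s i]]
    heis_exponent.exp_zero[OF heis_exponent_E_minus[OF assms, of s i], of k v]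
    heis_exponent.exp_0[OF heis_exponent_E_minus[OF assms, of s i], of v]
  by (simp_all add: E_minus_def)

lemma E_plus:
  assumes "N > 0"
  shows "vertex_series N (E_plus N s i) (\<lambda>a n. if n < 0 \<and> int a mod int N = i mod int N then s else 0) (\<lambda>_. 0) 0"
    and "k > 0 \<Longrightarrow> E_plus N s i k v = 0" and "E_plus N s i k (vac \<alpha>) = (if k = 0 then vac \<alpha> else 0)"
proof -
  note he = heis_exponent_E_plus[OF assms, of s i]
  show "vertex_series N (E_plus N s i) (\<lambda>a n. if n < 0 \<and> int a mod int N = i mod int N then s else 0) (\<lambda>_. 0) 0"
    unfolding E_plus_def by (rule heis_exponent.vertex_series_exp[OF he])
  show "k > 0 \<Longrightarrow> E_plus N s i k v = 0"
    unfolding E_plus_def by (rule heis_exponent.exp_zero[OF he]) simp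
  show "E_plus N s i k (vac \<alpha>) = (if k = 0 then vac \<alpha> else 0)"
    unfolding E_plus_def by (rule heis_exponent.exp_vacuum[OF he]) (simp add: heis_vac)
qed

lemma vertex_series_cong:
  assumes "vertex_series N A \<phi> f \<beta>" "\<And>a n. a < N \<Longrightarrow> n \<noteq> 0 \<Longrightarrow> \<phi> a n = \<psi> a n" "\<And>\<alpha>. f \<alpha> = g \<alpha>" "\<beta> = \<gamma>"
  shows "vertex_series N A \<psi> g \<gamma>"
proof -
  have "f = g" using assms(3) by (rule ext)
  then show ?thesis
    using assms unfolding vertex_series_def heis_covariant_def by simp
qed

lemma vertex_op_cong:
  assumes "vertex_op N A \<phi> f \<beta> \<kappa>" "\<And>a n. a < N \<Longrightarrow> n \<noteq> 0 \<Longrightarrow> \<phi> a n = \<psi> a n" "\<And>\<alpha>. f \<alpha> = g \<alpha>" "\<beta> = \<gamma>"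
    "\<And>\<alpha>. \<kappa> \<alpha> = \<kappa>' \<alpha>"
  shows "vertex_op N A \<psi> g \<gamma> \<kappa>'"
  using assms vertex_series_cong[of N A \<phi> f \<beta> \<psi> g \<gamma>] unfolding vertex_op_def by auto

lemma vertex_op_subst:
  assumes "vertex_op N A \<phi> f \<beta> \<kappa>" "c \<noteq> 0"
  shows "vertex_op N (ser_subst c A) (\<lambda>a n. c powi n * \<phi> a n) f \<beta> (\<lambda>\<alpha>. c powi (f \<alpha>) * \<kappa> \<alpha>)"
  using assms vertex_series_subst unfolding vertex_op_def by (auto simp: ser_subst_def)

lemma ser_mult_const_right: "(\<And>n. lin (A n)) \<Longrightarrow> (A \<otimes>\<^sub>S ser_const T) k v = A k (T v)"
  unfolding ser_mult_def
  by (subst Sum_any.expand_superset[of "{0}"]) (auto simp: ser_const_def lin_0)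

lemma ser_mult_const_left: "lin T \<Longrightarrow> (ser_const T \<otimes>\<^sub>S A) k v = T (A k v)"
  unfolding ser_mult_def
  by (subst Sum_any.expand_superset[of "{k}"]) (auto simp: ser_const_def)

lemma ser_mult_concentrated:
  assumes "\<And>k. B k v = (if k = k0 then w else 0)" "\<And>k. lin (A k)"
  shows "(A \<otimes>\<^sub>S B) k v = A (k - k0) w"
  unfolding ser_mult_def
  by (subst Sum_any.expand_superset[of "{k0}"]) (auto simp: assms(1) lin_0[OF assms(2)])

lemma ser_mult_leading:
  assumes "\<And>k. k < k0 \<Longrightarrow> B k v = 0" "\<And>k v. k < 0 \<Longrightarrow> A k v = 0" "\<And>v. A 0 v = v" "\<And>k. lin (A k)"
  shows "(A \<otimes>\<^sub>S B) k0 v = B k0 v"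
proof -
  have "{n. A (k0 - n) (B n v) \<noteq> 0} \<subseteq> {k0}"
  proof
    fix n assume n: "n \<in> {n. A (k0 - n) (B n v) \<noteq> 0}"
    then have "\<not> n < k0" "\<not> k0 - n < 0"
      using assms(1)[of n] assms(2) lin_0[OF assms(4)] by auto
    then show "n \<in> {k0}" by simp
  qed
  then show ?thesis
    unfolding ser_mult_def by (subst Sum_any.expand_superset[of "{k0}"]) (simp_all add: assms(3))
qed

text \<open>The creation half contains q^(i-j) p^r and the annihilation half q^(j-i) p^r; their n-th
  powers combine to q^((i-j)|n|) p^(rn). The shift by 1 in the order is (\<beta>, \<beta>)/2, and
  (epsilon_j, \<beta>) = -1 turns the last factor of X_ij into \<open>sp powi r\<close>.\<close>

lemma vertex_op_X:
  assumes N: "N > 0" and ij: "i mod int N \<noteq> j mod int N" and q: "q \<noteq> 0" "p \<noteq> 0"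
  shows "vertex_op N (X_op N \<epsilon> q p sp i j r)
     (\<lambda>a n. (if int a mod int N = i mod int N then 1 else 0)
        - (if int a mod int N = j mod int N then q powi ((i - j) * \<bar>n\<bar>) * p powi (r * n) else 0))
     (\<lambda>\<alpha>. lform (eps_vec N i - eps_vec N j) \<alpha> + 1) (eps_vec N i - eps_vec N j)
     (\<lambda>\<alpha>. \<epsilon> (eps_vec N i - eps_vec N j) \<alpha> * p powi (- r * lookup \<alpha> (nat (j mod int N))) * sp powi r)"
proof -
  define \<beta> where "\<beta> = eps_vec N i - eps_vec N j"
  define S where "S = (\<lambda>v. sp powi (- (lform (eps_vec N j) \<beta> * r)) *\<^sub>C
                    scalar_op p (frag_cmul (- r) (eps_vec N j)) v)"
  define x where "x = q powi (i - j) * p powi r"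
  define y where "y = q powi (j - i) * p powi r"
  have xy: "x \<noteq> 0" "y \<noteq> 0" using q by (auto simp: x_def y_def)
  have \<beta>: "lform \<beta> \<beta> div 2 = 1" "lform (eps_vec N j) \<beta> = -1"
    using lform_root[OF N ij] by (simp_all add: \<beta>_def)
  then have \<beta>': "lookup \<beta> (nat (j mod int N)) = -1" by (simp add: lform_eps_vec)
  have linS: "lin S"
    unfolding S_def scalar_op_def by (intro lin_scale lin_linext)
  have S: "S (bas (\<mu>, \<alpha>)) = single (\<mu>, \<alpha> + 0) (sp powi r * p powi (- r * lookup \<alpha> (nat (j mod int N))))" for \<mu> \<alpha>
    by (simp add: S_def \<beta>' scalar_op_def lform_cmul_left lform_eps_vec)
  have linE: "lin (e_op \<epsilon> \<beta>)"
    unfolding e_op_def by (rule lin_linext)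
  have E: "e_op \<epsilon> \<beta> (bas (\<mu>, \<alpha>)) = single (\<mu>, \<alpha> + \<beta>) (\<epsilon> \<beta> \<alpha>)" for \<mu> \<alpha>
    by (simp add: e_op_def)
  \<comment> \<open>Z collects the lattice factors. The partial products from the right are Laurent
    polynomials on each vector up to and including the annihilation halves; for the creation halves
    \<open>composable_nonneg\<close> takes over.\<close>
  define Z where "Z = ser_const (e_op \<epsilon> \<beta>) \<otimes>\<^sub>S z_pow \<beta> 1 \<otimes>\<^sub>S ser_const S"
  define P2 where "P2 = ser_subst y (E_plus N (-1) j)"
  define P1 where "P1 = E_plus N 1 i"
  define M2 where "M2 = ser_subst x (E_minus N (-1) j)"
  define M1 where "M1 = E_minus N 1 i"
  have X: "X_op N \<epsilon> q p sp i j r = M1 \<otimes>\<^sub>S M2 \<otimes>\<^sub>S P1 \<otimes>\<^sub>S P2 \<otimes>\<^sub>S Z"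
    unfolding X_op_def Let_def \<beta>_def[symmetric] \<beta>(1) Z_def S_def x_def y_def P1_def P2_def M1_def M2_def ..
  note vS = vertex_series_const[OF linS S, of N] and vE = vertex_series_const[OF linE E, of N]
    and vz = vertex_series_z_pow[of N \<beta> 1]
    and vM1 = E_minus(1)[OF N, of 1 i, folded M1_def]
    and vM2 = vertex_series_subst[OF E_minus(1)[OF N, of "-1" j] xy(1), folded M2_def]
    and vP1 = E_plus(1)[OF N, of 1 i, folded P1_def]
    and vP2 = vertex_series_subst[OF E_plus(1)[OF N, of "-1" j] xy(2), folded P2_def]
  have c1: "composable (z_pow \<beta> 1) (ser_const S)"
    by (rule composable_pointwise_finite[OF pointwise_finite_const vertex_seriesD(1)[OF vz]])
  note v1 = vertex_series_mult[OF vz vS c1]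
  have f1: "pointwise_finite (z_pow \<beta> 1 \<otimes>\<^sub>S ser_const S)"
    by (rule pointwise_finite_mult[OF pointwise_finite_z_pow pointwise_finite_const vertex_seriesD(1)[OF vz]])
  note c2 = composable_pointwise_finite[OF f1 vertex_seriesD(1)[OF vE]]
  note v2 = vertex_series_mult[OF vE v1 c2, folded Z_def]
  have f2: "pointwise_finite Z"
    unfolding Z_def by (rule pointwise_finite_mult[OF pointwise_finite_const f1 vertex_seriesD(1)[OF vE]])
  note c3 = composable_pointwise_finite[OF f2 vertex_seriesD(1)[OF vP2]]
  note v3 = vertex_series_mult[OF vP2 v2 c3]
  have f3: "pointwise_finite P2"
    by (rule pointwise_finite_nonpos[OF _ vertex_seriesD(1,2)[OF vP2]])
      (simp add: P2_def ser_subst_def E_plus[OF N])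
  have f3: "pointwise_finite (P2 \<otimes>\<^sub>S Z)"
    by (rule pointwise_finite_mult[OF f3 f2 vertex_seriesD(1)[OF vP2]])
  note c4 = composable_pointwise_finite[OF f3 vertex_seriesD(1)[OF vP1]]
  note v4 = vertex_series_mult[OF vP1 v3 c4]
  have M2z: "k < 0 \<Longrightarrow> M2 k v = 0" "M2 0 v = v" for k v
    by (simp_all add: M2_def ser_subst_def E_minus[OF N])
  have M1z: "k < 0 \<Longrightarrow> M1 k v = 0" "M1 0 v = v" for k v
    by (simp_all add: M1_def E_minus[OF N])
  have c5: "composable M2 (P1 \<otimes>\<^sub>S P2 \<otimes>\<^sub>S Z)"
    by (rule composable_nonneg[OF _ vertex_seriesD(1)[OF vM2] vertex_seriesD(1,2)[OF v4]]) (rule M2z)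
  note v5 = vertex_series_mult[OF vM2 v4 c5]
  have c6: "composable M1 (M2 \<otimes>\<^sub>S P1 \<otimes>\<^sub>S P2 \<otimes>\<^sub>S Z)"
    by (rule composable_nonneg[OF _ vertex_seriesD(1)[OF vM1] vertex_seriesD(1,2)[OF v5]]) (rule M1z)
  note v6 = vertex_series_mult[OF vM1 v5 c6, folded X]
  have ser: "vertex_series N (X_op N \<epsilon> q p sp i j r)
     (\<lambda>a n. (if int a mod int N = i mod int N then 1 else 0)
        - (if int a mod int N = j mod int N then q powi ((i - j) * \<bar>n\<bar>) * p powi (r * n) else 0))
     (\<lambda>\<alpha>. lform \<beta> \<alpha> + 1) \<beta>"
    by (rule vertex_series_cong[OF v6])
      (use q ij in \<open>auto simp: x_def y_def power_int_mult_distrib power_int_mult[symmetric] abs_if mult.commute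
        right_diff_distrib\<close>)
  have P2v: "P2 k (vac \<alpha>) = (if k = 0 then vac \<alpha> else 0)" for k \<alpha>
    by (simp add: P2_def ser_subst_def E_plus[OF N])
  have P1v: "P1 k (vac \<alpha>) = (if k = 0 then vac \<alpha> else 0)" for k \<alpha>
    by (simp add: P1_def E_plus[OF N])
  show ?thesis
    unfolding vertex_op_def \<beta>_def[symmetric]
  proof (intro conjI allI ser)
    fix \<alpha>
    define c where "c = \<epsilon> \<beta> \<alpha> * p powi (- r * lookup \<alpha> (nat (j mod int N))) * sp powi r"
    define k0 where "k0 = lform \<beta> \<alpha> + 1"
    \<comment> \<open>On e^\<alpha> the lattice factors yield a single power of z, the annihilation
      halves act as the identity, and the creation halves begin with 1; so the leading term of X is
      that of Z.\<close>
    have Z: "Z k (vac \<alpha>) = (if k = k0 then c *\<^sub>C vac (\<alpha> + \<beta>) else 0)" for k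
    proof -
      have "Z k (vac \<alpha>) = e_op \<epsilon> \<beta> (z_pow \<beta> 1 k (S (vac \<alpha>)))"
        unfolding Z_def by (simp add: ser_mult_const_left[OF linE] ser_mult_const_right vertex_seriesD(1)[OF vz])
      then show ?thesis
        by (simp add: S z_pow_def E e_op_def c_def k0_def lin_0[OF lin_linext] mult_ac)
    qed
    have 2: "(P2 \<otimes>\<^sub>S Z) k (vac \<alpha>) = (if k = k0 then c *\<^sub>C vac (\<alpha> + \<beta>) else 0)" for k
      by (subst ser_mult_concentrated[where B = Z and v = "vac \<alpha>" and w = "c *\<^sub>C vac (\<alpha> + \<beta>)" and ?k0.0 = k0, OF Z vertex_seriesD(1)[OF vP2]])
        (simp add: lin_cscale[OF vertex_seriesD(1)[OF vP2]] P2v del: cscale_single)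
    have 1: "(P1 \<otimes>\<^sub>S P2 \<otimes>\<^sub>S Z) k (vac \<alpha>) = (if k = k0 then c *\<^sub>C vac (\<alpha> + \<beta>) else 0)" for k
      by (subst ser_mult_concentrated[where B = "P2 \<otimes>\<^sub>S Z" and v = "vac \<alpha>" and w = "c *\<^sub>C vac (\<alpha> + \<beta>)" and ?k0.0 = k0, OF 2 vertex_seriesD(1)[OF vP1]])
        (simp add: lin_cscale[OF vertex_seriesD(1)[OF vP1]] P1v del: cscale_single)
    have M2: "(M2 \<otimes>\<^sub>S P1 \<otimes>\<^sub>S P2 \<otimes>\<^sub>S Z) k (vac \<alpha>) = M2 (k - k0) (c *\<^sub>C vac (\<alpha> + \<beta>))" for k
      by (rule ser_mult_concentrated[where B = "P1 \<otimes>\<^sub>S P2 \<otimes>\<^sub>S Z" and v = "vac \<alpha>" and w = "c *\<^sub>C vac (\<alpha> + \<beta>)" and ?k0.0 = k0, OF 1 vertex_seriesD(1)[OF vM2]])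
    have "X_op N \<epsilon> q p sp i j r k0 (vac \<alpha>) = (M2 \<otimes>\<^sub>S P1 \<otimes>\<^sub>S P2 \<otimes>\<^sub>S Z) k0 (vac \<alpha>)"
      unfolding X by (rule ser_mult_leading) (simp_all add: M2 M2z M1z vertex_seriesD(1)[OF vM1])
    then show "lookup (X_op N \<epsilon> q p sp i j r (lform \<beta> \<alpha> + 1) (vac \<alpha>)) (0, \<alpha> + \<beta>)
        = \<epsilon> \<beta> \<alpha> * p powi (- r * lookup \<alpha> (nat (j mod int N))) * sp powi r"
      by (simp add: M2 M2z c_def flip: k0_def)
  qed
qed

lemma vertex_op_scalar_exp:
  assumes X: "heis_exponent N X s \<phi>" 
  shows "vertex_op N (ser_const (scalar_op c \<beta>) \<otimes>\<^sub>S ser_exp X) \<phi> (\<lambda>_. 0) 0 (\<lambda>\<alpha>. c powi lform \<beta> \<alpha>)"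
proof -
  have lin: "lin (scalar_op c \<beta>)" by (simp add: scalar_op_def lin_linext)
  have s: "scalar_op c \<beta> (bas (\<mu>, \<alpha>)) = single (\<mu>, \<alpha> + 0) (c powi lform \<beta> \<alpha>)" for \<mu> \<alpha>
    by (simp add: scalar_op_def)
  note vs = heis_exponent.vertex_series_exp[OF X]
  have "composable (ser_const (scalar_op c \<beta>)) (ser_exp X)"
    unfolding composable_def
  proof (intro allI)
    fix k v
    show "finite {n. ser_const (scalar_op c \<beta>) (k - n) (ser_exp X n v) \<noteq> 0}"
      by (rule finite_subset[of _ "{k}"]) (auto simp: ser_const_def)
  qed
  from vertex_series_mult[OF vertex_series_const[OF lin s] vs this]
  have "vertex_series N (ser_const (scalar_op c \<beta>) \<otimes>\<^sub>S ser_exp X) \<phi> (\<lambda>_. 0) 0"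
    by simp
  then show ?thesis
    by (simp add: vertex_op_def ser_mult_const_left[OF lin] heis_exponent.exp_0[OF X] s)
qed

context heis_exponent
begin

lemma pow_subst: "c \<noteq> 0 \<Longrightarrow> ser_pow (ser_subst c X) m k v = c powi k *\<^sub>C ser_pow X m k v"
proof (induction m arbitrary: k v)
  case (Suc m)
  have "ser_subst c X (k - n) (ser_pow (ser_subst c X) m n v) = c powi k *\<^sub>C X (k - n) (ser_pow X m n v)" for n
    using Suc power_int_add[of c "k - n" n] by (simp add: ser_subst_def lin_cscale[OF lin_X])
  then show ?case
    by (simp add: ser_mult_def cscale_Sum_any composableD[OF composable_pow])
qed (simp add: ser_const_def)

text \<open>Allows the scale of the variable to be moved into the exponents of the Cartan
  currents.\<close>

lemma exp_subst:
  assumes "c \<noteq> 0"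
  shows "ser_exp (ser_subst c X) = ser_subst c (ser_exp X)"
proof (intro ext)
  fix k v
  have "{m. (1 / fact m) *\<^sub>C ser_pow X m k v \<noteq> 0} \<subseteq> {..nat (s * k)}"
    using pow_zero[of k _ v] by (fastforce simp: not_less[symmetric])
  then have "finite {m. (1 / fact m) *\<^sub>C ser_pow X m k v \<noteq> 0}"
    by (rule finite_subset) simp
  from cscale_Sum_any[OF this, of "c powi k"]
  show "ser_exp (ser_subst c X) k v = ser_subst c (ser_exp X) k v"
    unfolding ser_exp_def pow_subst[OF assms] unfolding ser_subst_def by (simp add: mult.commute)
qed

end

lemma ser_subst_const_mult:
  assumes "lin T"
  shows "ser_subst c (ser_const T \<otimes>\<^sub>S A) = ser_const T \<otimes>\<^sub>S ser_subst c A"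
  by (intro ext) (simp add: ser_subst_def ser_mult_const_left[OF assms] lin_cscale[OF assms])

lemma vertex_op_scale:
  assumes A: "vertex_op N A \<phi> f \<beta> \<kappa>"
  shows "vertex_op N (\<lambda>k v. c *\<^sub>C A k v) \<phi> f \<beta> (\<lambda>\<alpha>. c * \<kappa> \<alpha>)"
proof -
  note vs = vertex_opD(1)[OF A]
  have "vertex_series N (\<lambda>k v. c *\<^sub>C A k v) \<phi> f \<beta>"
  proof (rule vertex_seriesI)
    fix k \<mu> \<alpha> \<nu> \<gamma>
    assume "lookup (c *\<^sub>C A k (bas (\<mu>, \<alpha>))) (\<nu>, \<gamma>) \<noteq> 0"
    then have "lookup (A k (bas (\<mu>, \<alpha>))) (\<nu>, \<gamma>) \<noteq> 0" by simp
    from gradedD[OF vertex_seriesD(2)[OF vs] this]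
    show "\<gamma> = \<alpha> + \<beta> \<and> int (weight \<nu>) = int (weight \<mu>) + k - f \<alpha> \<and> (good N \<mu> \<longrightarrow> good N \<nu>)"
      by blast
  qed (simp_all add: lin_scale vertex_seriesD[OF vs] lin_cscale[OF lin_heis] cscale_add mult.commute)
  then show ?thesis
    using vertex_opD(2)[OF A] by (simp add: vertex_op_def)
qed

section \<open>The operators of the representation\<close>

locale fock_rep =
  fixes N :: nat and q d p sq sp :: complex and \<epsilon> :: "lattice \<Rightarrow> lattice \<Rightarrow> complex"
  assumes N3: "N \<ge> 3"
    and q_nz: "q \<noteq> 0" and q_gen: "\<forall>n::nat. n > 0 \<longrightarrow> q ^ n \<noteq> 1"
    and d_nz: "d \<noteq> 0" and p_eq: "p = d powi (- int N)"
    and sq_eq: "sq ^ 2 = q" and sp_eq: "sp ^ 2 = p"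
    and cocycle: "lattice_cocycle N \<epsilon>"
begin

definition nxt :: "nat \<Rightarrow> nat" where
  "nxt i = Suc i mod N"

definition simple_root :: "nat \<Rightarrow> lattice" where
  "simple_root i = eps_vec N (int i) - eps_vec N (int i + 1)"

text \<open>Rescaling the variable, $\epsilon_i$ sits at \<open>pos i * z\<close> and $\epsilon_{i+1}$ at \<open>pos' i * z\<close> in
  the vertex operators of node \<open>i\<close>; only at the node \<open>0\<close> do the two differ.\<close>

definition pos :: "nat \<Rightarrow> complex" where
  "pos i = (if i = 0 then inverse sp else sp * d ^ i)"

definition pos' :: "nat \<Rightarrow> complex" where
  "pos' i = sp * d ^ i"

lemma p_nz: "p \<noteq> 0" and sp_nz: "sp \<noteq> 0" and sq_nz: "sq \<noteq> 0"
  using d_nz q_nz p_eq sp_eq sq_eq by auto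

lemma pos_nz: "pos i \<noteq> 0" "pos' i \<noteq> 0"
  using sp_nz d_nz by (auto simp: pos_def pos'_def)

lemma N_pos: "N > 0" using N3 by simp

lemma nxt_less: "nxt i < N"
  using N_pos by (simp add: nxt_def)

lemma nxt_neq: "i < N \<Longrightarrow> nxt i \<noteq> i"
  using N3 by (auto simp: nxt_def mod_Suc)

lemma nat_mod: "i < N \<Longrightarrow> nat (int i mod int N) = i" "nat ((int i + 1) mod int N) = nxt i"
  using nat_int[of "Suc i mod N"] by (simp_all add: nxt_def zmod_int add.commute)

lemma int_mod_eq: "a < N \<Longrightarrow> i < N \<Longrightarrow> int a mod int N = int i mod int N \<longleftrightarrow> a = i"
  by simp

lemma int_mod_nxt: "a < N \<Longrightarrow> int a mod int N = (int i + 1) mod int N \<longleftrightarrow> a = nxt i"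
  using zmod_int[of "Suc i" N] by (auto simp: nxt_def add.commute)

lemma mod_neq: "i < N \<Longrightarrow> int i mod int N \<noteq> (int i + 1) mod int N"
  using int_mod_nxt[of i i] nxt_neq[of i] by auto

lemma lform_simple_root: "i < N \<Longrightarrow> lform (simple_root i) \<alpha> = lookup \<alpha> i - lookup \<alpha> (nxt i)"
  by (simp add: simple_root_def lform_diff_left lform_eps_vec nat_mod)

text \<open>At node 0 the variable is scaled by p^(-1/2), and r = 1 multiplies the position of
  epsilon_1 by p. So epsilon_1 ends up at p^(1/2), which is \<open>pos' 0\<close>.\<close>

lemma inverse_sp_p: "inverse sp powi n * p powi n = sp powi n"
  using sp_nz by (simp add: sp_eq[symmetric] power2_eq_square power_int_mult_distrib field_simps)

definition E_coeff :: "nat \<Rightarrow> nat \<Rightarrow> int \<Rightarrow> complex" where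
  "E_coeff i a n = (if a = i then pos i powi n else 0) - (if a = nxt i then q powi (- \<bar>n\<bar>) * pos' i powi n else 0)"

definition F_coeff :: "nat \<Rightarrow> nat \<Rightarrow> int \<Rightarrow> complex" where
  "F_coeff i a n = (if a = nxt i then pos' i powi n else 0) - (if a = i then q powi \<bar>n\<bar> * pos i powi n else 0)"

text \<open>What the summand (\<beta>, \<beta>)/2 = 1 of the exponent of z leaves after rescaling:
  the scale \<open>sp * d ^ i\<close>, whereas at node 0 the scale cancels against the factor
  \<open>sp powi r\<close> of \<open>vertex_op_X\<close>. Splitting it off makes
  \<open>E_char\<close> and \<open>F_char\<close> multiplicative in the lattice point.\<close>

definition norm_const :: "nat \<Rightarrow> complex" where
  "norm_const i = (if i = 0 then 1 else pos' i)"

definition E_char :: "nat \<Rightarrow> lattice \<Rightarrow> complex" where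
  "E_char i \<alpha> = \<epsilon> (simple_root i) \<alpha> * pos i powi lookup \<alpha> i * pos' i powi (- lookup \<alpha> (nxt i))"

definition F_char :: "nat \<Rightarrow> lattice \<Rightarrow> complex" where
  "F_char i \<alpha> = \<epsilon> (- simple_root i) \<alpha> * pos i powi (- lookup \<alpha> i) * pos' i powi lookup \<alpha> (nxt i)"

definition F_op :: "nat \<Rightarrow> op_series" where
  "F_op i = (\<lambda>k v. (-1) *\<^sub>C F_ser N \<epsilon> q p sp d i k v)"

lemma vertex_op_E:
  assumes i: "i < N"
  shows "vertex_op N (E_ser N \<epsilon> q p sp d i) (E_coeff i) (\<lambda>\<alpha>. lform (simple_root i) \<alpha> + 1) (simple_root i)
     (\<lambda>\<alpha>. norm_const i * E_char i \<alpha>)"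
proof (cases "i = 0")
  case False
  have "sp * d ^ i \<noteq> 0" using sp_nz d_nz by simp
  from vertex_op_subst[OF vertex_op_X[OF N_pos mod_neq[OF i] q_nz p_nz] this]
  show ?thesis
    unfolding E_ser_def if_not_P[OF False] simple_root_def[symmetric]
  proof (rule vertex_op_cong)
    fix a n assume a: "a < N" "n \<noteq> (0::int)"
    show "(sp * d ^ i) powi n * ((if int a mod int N = int i mod int N then 1 else 0) -
       (if int a mod int N = (int i + 1) mod int N
        then q powi ((int i - (int i + 1)) * \<bar>n\<bar>) * p powi (0 * n) else 0)) = E_coeff i a n"
      unfolding int_mod_nxt[OF a(1)] int_mod_eq[OF a(1) i]
      using False by (auto simp: E_coeff_def pos_def pos'_def right_diff_distrib algebra_simps)
  next
    fix \<alpha>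
    show "(sp * d ^ i) powi (lform (simple_root i) \<alpha> + 1) *
         (\<epsilon> (simple_root i) \<alpha> * p powi (- 0 * lookup \<alpha> (nat ((int i + 1) mod int N))) * sp powi 0) =
         norm_const i * E_char i \<alpha>"
      using False pos_nz(2)[of i] i
      by (simp add: lform_simple_root norm_const_def E_char_def pos_def pos'_def power_int_add power_int_diff
        power_int_minus field_simps)
  qed simp_all
next
  case True
  have m: "(0::int) mod int N \<noteq> 1 mod int N" using mod_neq[of 0] N_pos by simp
  have r: "simple_root 0 = eps_vec N 0 - eps_vec N 1" by (simp add: simple_root_def)
  have n: "nat (1 mod int N) = nxt 0" using nat_mod(2)[of 0] by simp
  have im: "a < N \<Longrightarrow> int a = 1 mod int N \<longleftrightarrow> a = nxt 0" for a
    using int_mod_nxt[of a 0] by simp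
  have i2: "inverse sp \<noteq> 0" using sp_nz by simp
  from vertex_op_subst[OF vertex_op_X[OF N_pos m q_nz p_nz] i2]
  show ?thesis
    unfolding E_ser_def if_P[OF True] unfolding True r[symmetric]
  proof (rule vertex_op_cong)
    fix \<alpha>
    \<comment> \<open>The scale of node 0 is a half power of p, so p has to be split to combine the
      exponents.\<close>
    have "p powi (- x) = sp powi (- x) * sp powi (- x)" for x :: int
      by (simp add: sp_eq[symmetric] power2_eq_square power_int_mult_distrib)
    then show "inverse sp powi (lform (simple_root 0) \<alpha> + 1) *
         (\<epsilon> (simple_root 0) \<alpha> * p powi (- 1 * lookup \<alpha> (nat (1 mod int N))) * sp powi 1) = norm_const 0 * E_char 0 \<alpha>"
      using sp_nz N_pos by (simp add: lform_simple_root n norm_const_def E_char_def pos_def pos'_def power_int_add power_int_diff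
        power_int_minus field_simps)
  next
    fix a n assume "a < N" "n \<noteq> (0::int)"
    then show "inverse sp powi n * ((if int a mod int N = 0 mod int N then 1 else 0) -
       (if int a mod int N = 1 mod int N then q powi ((0 - 1) * \<bar>n\<bar>) * p powi (1 * n) else 0)) = E_coeff 0 a n"
      using inverse_sp_p[of n] by (auto simp: E_coeff_def pos_def pos'_def im right_diff_distrib algebra_simps)
  qed auto
qed

lemma vertex_op_F:
  assumes i: "i < N"
  shows "vertex_op N (F_op i) (F_coeff i) (\<lambda>\<alpha>. - lform (simple_root i) \<alpha> + 1) (- simple_root i)
     (\<lambda>\<alpha>. - norm_const i * F_char i \<alpha>)"
proof -
  have l: "lform (eps_vec N (int i + 1) - eps_vec N (int i)) \<alpha> = - lform (simple_root i) \<alpha>" for \<alpha>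
    by (simp add: simple_root_def lform_diff_left)
  have r: "eps_vec N (int i + 1) - eps_vec N (int i) = - simple_root i" by (simp add: simple_root_def)
  note m = mod_neq[OF i, symmetric]
  have "vertex_op N (F_ser N \<epsilon> q p sp d i) (F_coeff i) (\<lambda>\<alpha>. - lform (simple_root i) \<alpha> + 1) (- simple_root i)
     (\<lambda>\<alpha>. norm_const i * F_char i \<alpha>)"
  proof (cases "i = 0")
    case False
    have "sp * d ^ i \<noteq> 0" using sp_nz d_nz by simp
    from vertex_op_subst[OF vertex_op_X[OF N_pos m q_nz p_nz] this]
    show ?thesis
      unfolding F_ser_def if_not_P[OF False] r
    proof (rule vertex_op_cong)
      fix a n assume a: "a < N" "n \<noteq> (0::int)"
      show "(sp * d ^ i) powi n * ((if int a mod int N = (int i + 1) mod int N then 1 else 0) -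
         (if int a mod int N = int i mod int N
          then q powi ((int i + 1 - int i) * \<bar>n\<bar>) * p powi (0 * n) else 0)) = F_coeff i a n"
        unfolding int_mod_nxt[OF a(1)] int_mod_eq[OF a(1) i]
        using False by (auto simp: F_coeff_def pos_def pos'_def right_diff_distrib algebra_simps)
    next
      fix \<alpha>
      show "(sp * d ^ i) powi (lform (- simple_root i) \<alpha> + 1) *
           (\<epsilon> (- simple_root i) \<alpha> * p powi (- 0 * lookup \<alpha> (nat (int i mod int N))) * sp powi 0) =
           norm_const i * F_char i \<alpha>"
        using False pos_nz(2)[of i] i
        by (simp add: lform_simple_root lform_uminus_left norm_const_def F_char_def pos_def pos'_def power_int_add
          power_int_diff power_int_minus field_simps)
    qed (simp_all add: lform_uminus_left)
  next
    case True
    have m: "1 mod int N \<noteq> (0::int) mod int N" using mod_neq[of 0] N_pos by simp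
    have r: "- simple_root 0 = eps_vec N 1 - eps_vec N 0" by (simp add: simple_root_def)
    have im: "a < N \<Longrightarrow> int a = 1 mod int N \<longleftrightarrow> a = nxt 0" for a
      using int_mod_nxt[of a 0] by simp
    from vertex_op_subst[OF vertex_op_X[OF N_pos m q_nz p_nz] sp_nz]
    show ?thesis
      unfolding F_ser_def if_P[OF True] unfolding True r[symmetric]
    proof (rule vertex_op_cong)
      fix \<alpha>
      have "p powi x = sp powi x * sp powi x" for x :: int
        by (simp add: sp_eq[symmetric] power2_eq_square power_int_mult_distrib)
      then show "sp powi (lform (- simple_root 0) \<alpha> + 1) *
         (\<epsilon> (- simple_root 0) \<alpha> * p powi (- (- 1) * lookup \<alpha> (nat (0 mod int N))) * sp powi (- 1)) = norm_const 0 * F_char 0 \<alpha>"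
        using sp_nz N_pos by (simp add: lform_simple_root lform_uminus_left norm_const_def F_char_def pos_def pos'_def power_int_add power_int_diff
          power_int_minus field_simps)
    next
      fix a n assume "a < N" "n \<noteq> (0::int)"
      moreover have "sp powi n * p powi (- n) = inverse sp powi n"
        using sp_nz by (simp add: sp_eq[symmetric] power2_eq_square power_int_mult_distrib power_int_minus field_simps)
      ultimately show "sp powi n * ((if int a mod int N = 1 mod int N then 1 else 0) -
         (if int a mod int N = 0 mod int N then q powi ((1 - 0) * \<bar>n\<bar>) * p powi (- 1 * n) else 0)) = F_coeff 0 a n"
        by (auto simp: F_coeff_def pos_def pos'_def im right_diff_distrib algebra_simps)
    qed (auto simp: lform_uminus_left)
  qed
  from vertex_op_scale[OF this, of "-1"] show ?thesis
    by (simp add: F_op_def)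
qed

definition Kp_coeff :: "nat \<Rightarrow> nat \<Rightarrow> int \<Rightarrow> complex" where
  "Kp_coeff i a n = (if n < 0 then - (q powi (- n) - q powi n) *
     ((if a = i then sq powi (- n) * pos i powi n else 0) - (if a = nxt i then sq powi n * pos' i powi n else 0)) else 0)"

definition Km_coeff :: "nat \<Rightarrow> nat \<Rightarrow> int \<Rightarrow> complex" where
  "Km_coeff i a n = (if n > 0 then (q powi (- n) - q powi n) *
     ((if a = i then sq powi n * pos i powi n else 0) - (if a = nxt i then sq powi (- n) * pos' i powi n else 0)) else 0)"

text \<open>The exponent of u_(i,i+1) with the rescaling carried out, in the shape required by
  \<open>heis_exponentI\<close>. Divided by q - q^(-1), its coefficients will represent
  \<open>GH i l\<close> for l > 0.\<close>

definition Kp_exponent :: "nat \<Rightarrow> op_series" where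
  "Kp_exponent i = (\<lambda>k v. if (-1) * k > 0 then
     (- (q powi (- k) - q powi k) / of_int k * (sq powi (- k) * pos i powi k)) *\<^sub>C heis N (int i) (- k) v +
     ((q powi (- k) - q powi k) / of_int k * (sq powi k * pos' i powi k)) *\<^sub>C heis N (int i + 1) (- k) v else 0)"

definition Km_exponent :: "nat \<Rightarrow> op_series" where
  "Km_exponent i = (\<lambda>k v. if 1 * k > 0 then
     ((q powi (- k) - q powi k) / of_int k * (sq powi k * pos i powi k)) *\<^sub>C heis N (int i) (- k) v +
     (- (q powi (- k) - q powi k) / of_int k * (sq powi (- k) * pos' i powi k)) *\<^sub>C heis N (int i + 1) (- k) v else 0)"

definition commutator_coeff :: "int \<Rightarrow> int \<Rightarrow> (int \<Rightarrow> complex) \<Rightarrow> (int \<Rightarrow> complex) \<Rightarrow> nat \<Rightarrow> int \<Rightarrow> complex" where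
  "commutator_coeff s i c c' = (\<lambda>a n. if s * n > 0 then of_int n * ((if int a mod int N = i mod int N then c n else 0)
        + (if int a mod int N = (i + 1) mod int N then c' n else 0)) else 0)"

lemma heis_exponent_Kp:
  "heis_exponent N (Kp_exponent i) (-1) (commutator_coeff (-1) (int i)
     (\<lambda>k. - (q powi (- k) - q powi k) / of_int k * (sq powi (- k) * pos i powi k))
     (\<lambda>k. (q powi (- k) - q powi k) / of_int k * (sq powi k * pos' i powi k)))"
  by (rule heis_exponentI[OF N_pos _ Kp_exponent_def commutator_coeff_def]) simp

lemma heis_exponent_Km:
  "heis_exponent N (Km_exponent i) 1 (commutator_coeff 1 (int i)
     (\<lambda>k. (q powi (- k) - q powi k) / of_int k * (sq powi k * pos i powi k))
     (\<lambda>k. - (q powi (- k) - q powi k) / of_int k * (sq powi (- k) * pos' i powi k)))"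
  by (rule heis_exponentI[OF N_pos _ Km_exponent_def commutator_coeff_def]) simp

lemma lin_scalar_op: "lin (scalar_op c \<beta>)"
  by (simp add: scalar_op_def lin_linext)

text \<open>Only the rescaled exponent Y is known to be a \<open>heis_exponent\<close>, so X is
  expressed as Y rescaled back, and the two rescalings cancel outside the exponential.\<close>

lemma ser_exp_unsubst:
  assumes "heis_exponent N Y s \<phi>" "c \<noteq> 0" "ser_subst c X = Y" "T = T'" "lin T'"
  shows "ser_subst c (ser_const T \<otimes>\<^sub>S ser_exp X) = ser_const T' \<otimes>\<^sub>S ser_exp Y"
proof -
  have "X = ser_subst (inverse c) Y"
    using assms(2) unfolding assms(3)[symmetric]
    by (simp add: ser_subst_def fun_eq_iff flip: power_int_mult_distrib)
  then have "ser_exp X = ser_subst (inverse c) (ser_exp Y)"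
    using heis_exponent.exp_subst[OF assms(1), of "inverse c"] assms(2) by simp
  then have "ser_subst c (ser_exp X) = ser_exp Y"
    using assms(2) by (simp add: ser_subst_def fun_eq_iff flip: power_int_mult_distrib)
  then show ?thesis
    using assms(4,5) by (simp add: ser_subst_const_mult)
qed

lemma cscale_combination_eqI:
  "w * x = a \<Longrightarrow> w * y = - b \<Longrightarrow> w *\<^sub>C (x *\<^sub>C u - y *\<^sub>C v) = a *\<^sub>C u + b *\<^sub>C (v :: fock)"
  by (simp add: cscale_diff cscale_uminus_left)

lemma Kp_ser_eq:
  assumes i: "i < N"
  shows "Kp_ser N q sq p sp d i = ser_const (scalar_op q (simple_root i)) \<otimes>\<^sub>S ser_exp (Kp_exponent i)"
proof (cases "i = 0")
  case False
  have "sp * d ^ i \<noteq> 0" using sp_nz d_nz by simp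
  then show ?thesis
    unfolding Kp_ser_def if_not_P[OF False] u_op_def
    by (rule ser_exp_unsubst[OF heis_exponent_Kp])
      (use False in \<open>auto simp: simple_root_def lin_scalar_op ser_subst_def Kp_exponent_def pos_def pos'_def
        Let_def fun_eq_iff power_int_minus intro!: cscale_combination_eqI\<close>,
        (simp_all add: field_simps)?, (simp_all add: minus_divide_left)?)
next
  case True
  have "inverse sp \<noteq> 0" using sp_nz by simp
  then show ?thesis
    unfolding Kp_ser_def if_P[OF True] unfolding True u_op_def
    by (rule ser_exp_unsubst[OF heis_exponent_Kp])
      (use sp_nz in \<open>auto simp: simple_root_def lin_scalar_op ser_subst_def Kp_exponent_def pos_def pos'_def
        Let_def fun_eq_iff power_int_minus inverse_sp_p[symmetric] intro!: cscale_combination_eqI\<close>,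
        (simp_all add: field_simps)?, (simp_all add: minus_divide_left)?)
qed

lemma Km_ser_eq:
  assumes i: "i < N"
  shows "Km_ser N q sq p sp d i = ser_const (scalar_op (inverse q) (simple_root i)) \<otimes>\<^sub>S ser_exp (Km_exponent i)"
proof (cases "i = 0")
  case False
  have "sp * d ^ i \<noteq> 0" using sp_nz d_nz by simp
  then show ?thesis
    unfolding Km_ser_def if_not_P[OF False] v_op_def
    by (rule ser_exp_unsubst[OF heis_exponent_Km])
      (use False in \<open>auto simp: simple_root_def lin_scalar_op ser_subst_def Km_exponent_def pos_def pos'_def
        Let_def fun_eq_iff power_int_minus intro!: cscale_combination_eqI\<close>,
        (simp_all add: field_simps)?, (simp_all add: minus_divide_left)?)
next
  case True
  have "inverse sp \<noteq> 0" using sp_nz by simp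
  then show ?thesis
    unfolding Km_ser_def if_P[OF True] unfolding True v_op_def
    by (rule ser_exp_unsubst[OF heis_exponent_Km])
      (use sp_nz in \<open>auto simp: simple_root_def lin_scalar_op ser_subst_def Km_exponent_def pos_def pos'_def
        Let_def fun_eq_iff power_int_minus inverse_sp_p[symmetric] intro!: cscale_combination_eqI\<close>,
        (simp_all add: field_simps)?, (simp_all add: minus_divide_left)?)
qed

lemma vertex_op_Kp:
  assumes i: "i < N"
  shows "vertex_op N (Kp_ser N q sq p sp d i) (Kp_coeff i) (\<lambda>_. 0) 0 (\<lambda>\<alpha>. q powi lform (simple_root i) \<alpha>)"
  unfolding Kp_ser_eq[OF i]
proof (rule vertex_op_cong[OF vertex_op_scalar_exp[OF heis_exponent_Kp]])
  fix a n assume "a < N" "n \<noteq> (0::int)"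
  then show "commutator_coeff (-1) (int i)
     (\<lambda>k. - (q powi (- k) - q powi k) / of_int k * (sq powi (- k) * pos i powi k))
     (\<lambda>k. (q powi (- k) - q powi k) / of_int k * (sq powi k * pos' i powi k)) a n = Kp_coeff i a n"
    using nxt_neq[OF i] unfolding commutator_coeff_def Kp_coeff_def
    by (simp only: int_mod_eq[OF _ i] int_mod_nxt) (auto simp: field_simps)
qed auto

lemma vertex_op_Km:
  assumes i: "i < N"
  shows "vertex_op N (Km_ser N q sq p sp d i) (Km_coeff i) (\<lambda>_. 0) 0 (\<lambda>\<alpha>. q powi (- lform (simple_root i) \<alpha>))"
  unfolding Km_ser_eq[OF i]
proof (rule vertex_op_cong[OF vertex_op_scalar_exp[OF heis_exponent_Km]])
  fix a n assume "a < N" "n \<noteq> (0::int)"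
  then show "commutator_coeff 1 (int i)
     (\<lambda>k. (q powi (- k) - q powi k) / of_int k * (sq powi k * pos i powi k))
     (\<lambda>k. - (q powi (- k) - q powi k) / of_int k * (sq powi (- k) * pos' i powi k)) a n = Km_coeff i a n"
    using nxt_neq[OF i] unfolding commutator_coeff_def Km_coeff_def
    by (simp only: int_mod_eq[OF _ i] int_mod_nxt) (auto simp: field_simps)
qed (use q_nz in \<open>auto simp: power_int_minus power_int_inverse\<close>)

lemma K_zero: "i < N \<Longrightarrow> k > 0 \<Longrightarrow> Kp_ser N q sq p sp d i k v = 0"
    "i < N \<Longrightarrow> k < 0 \<Longrightarrow> Km_ser N q sq p sp d i k v = 0"
  using heis_exponent.exp_zero[OF heis_exponent_Kp, of k i v] heis_exponent.exp_zero[OF heis_exponent_Km, of k i v]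
  by (simp_all add: Kp_ser_eq Km_ser_eq ser_mult_const_left[OF lin_scalar_op] lin_0[OF lin_scalar_op])

end

section \<open>The root lattice and the subspace V_Q\<close>

lemma root_lattice_0: "0 \<in> root_lattice N"
proof -
  have "(0 :: lattice) = (\<Sum>i = 1..int N - 1. frag_cmul 0 (eps_vec N i - eps_vec N (i + 1)))"
    by simp
  then show ?thesis unfolding root_lattice_def by (rule range_eqI[where x = "\<lambda>_. 0"])
qed

lemma root_lattice_add: "\<alpha> \<in> root_lattice N \<Longrightarrow> \<beta> \<in> root_lattice N \<Longrightarrow> \<alpha> + \<beta> \<in> root_lattice N"
proof -
  assume "\<alpha> \<in> root_lattice N" "\<beta> \<in> root_lattice N"
  then obtain c c' where "\<alpha> = (\<Sum>i = 1..int N - 1. frag_cmul (c i) (eps_vec N i - eps_vec N (i + 1)))"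
      "\<beta> = (\<Sum>i = 1..int N - 1. frag_cmul (c' i) (eps_vec N i - eps_vec N (i + 1)))"
    unfolding root_lattice_def by blast
  then have "\<alpha> + \<beta> = (\<Sum>i = 1..int N - 1. frag_cmul (c i + c' i) (eps_vec N i - eps_vec N (i + 1)))"
    by (simp add: frag_cmul_distrib sum.distrib)
  then show ?thesis unfolding root_lattice_def by (rule range_eqI[where x = "\<lambda>i. c i + c' i"])
qed

lemma root_lattice_uminus: "\<alpha> \<in> root_lattice N \<Longrightarrow> - \<alpha> \<in> root_lattice N"
proof -
  assume "\<alpha> \<in> root_lattice N"
  then obtain c where "\<alpha> = (\<Sum>i = 1..int N - 1. frag_cmul (c i) (eps_vec N i - eps_vec N (i + 1)))"
    unfolding root_lattice_def by blast
  then have "- \<alpha> = (\<Sum>i = 1..int N - 1. frag_cmul (- c i) (eps_vec N i - eps_vec N (i + 1)))"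
    unfolding minus_frag_cmul[symmetric] sum_negf by simp
  then show ?thesis unfolding root_lattice_def by (rule range_eqI[where x = "\<lambda>i. - c i"])
qed

lemma telescope_int:
  fixes g :: "int \<Rightarrow> 'a::ab_group_add"
  shows "(\<Sum>i = 1..int m. g i - g (i + 1)) = g 1 - g (int m + 1)"
proof (induction m)
  case (Suc m)
  have "{1..int (Suc m)} = insert (int m + 1) {1..int m}" by auto
  then show ?case using Suc by (simp add: add.commute)
qed simp

text \<open>The spanning roots are those of the nodes 1, ..., N - 1. The affine root at i = 0 is
  epsilon_N - epsilon_1, minus their telescoping sum.\<close>

lemma simple_root_in_root_lattice:
  assumes "i < N"
  shows "eps_vec N (int i) - eps_vec N (int i + 1) \<in> root_lattice N"
proof (cases "i = 0")
  case False
  have "(\<Sum>k = 1..int N - 1. frag_cmul (if k = int i then 1 else 0) (eps_vec N k - eps_vec N (k + 1)))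
     = (\<Sum>k\<in>{int i}. frag_cmul (if k = int i then 1 else 0) (eps_vec N k - eps_vec N (k + 1)))"
    by (rule sum.mono_neutral_right) (use assms False in auto)
  then have "eps_vec N (int i) - eps_vec N (int i + 1)
     = (\<Sum>k = 1..int N - 1. frag_cmul (if k = int i then 1 else 0) (eps_vec N k - eps_vec N (k + 1)))"
    by simp
  then show ?thesis unfolding root_lattice_def by (rule range_eqI[where x = "\<lambda>k. if k = int i then 1 else 0"])
next
  case True
  have N: "int (N - 1) = int N - 1" using assms by simp
  have "(\<Sum>k = 1..int N - 1. frag_cmul (- 1) (eps_vec N k - eps_vec N (k + 1)))
     = - (\<Sum>k = 1..int (N - 1). eps_vec N k - eps_vec N (k + 1))"
    unfolding N by (simp only: frag_cmul_minus_one sum_negf)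
  also have "\<dots> = eps_vec N (int i) - eps_vec N (int i + 1)"
    unfolding telescope_int using True N by (simp add: eps_vec_def)
  finally have "eps_vec N (int i) - eps_vec N (int i + 1)
     = (\<Sum>k = 1..int N - 1. frag_cmul (- 1) (eps_vec N k - eps_vec N (k + 1)))" ..
  then show ?thesis unfolding root_lattice_def by (rule range_eqI[where x = "\<lambda>_. - 1"])
qed

lemma VQ_zero: "0 \<in> VQ N"
  by (simp add: VQ_def)

lemma VQ_add: "u \<in> VQ N \<Longrightarrow> v \<in> VQ N \<Longrightarrow> u + v \<in> VQ N"
  using keys_add[of u v] unfolding mem_VQ by blast

lemma VQ_cscale: "v \<in> VQ N \<Longrightarrow> c *\<^sub>C v \<in> VQ N"
  using keys_cscale[of c v] unfolding mem_VQ by blast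

lemma VQ_diff: "u \<in> VQ N \<Longrightarrow> v \<in> VQ N \<Longrightarrow> u - v \<in> VQ N"
  using VQ_add[of u N "(- 1) *\<^sub>C v"] VQ_cscale[of v N "- 1"] by (simp add: cscale_uminus_left)

lemma vertex_series_VQ:
  assumes A: "vertex_series N A \<phi> f \<beta>" and "\<beta> \<in> root_lattice N" "v \<in> VQ N"
  shows "A k v \<in> VQ N"
  unfolding mem_VQ
proof safe
  fix \<nu> \<gamma>
  assume "(\<nu>, \<gamma>) \<in> keys (A k v)"
  then have "lookup (A k v) (\<nu>, \<gamma>) \<noteq> 0" by (simp add: in_keys_iff)
  then obtain b where b: "b \<in> keys v" "lookup (A k (bas b)) (\<nu>, \<gamma>) \<noteq> 0"
    by (rule lin_lookup_nonzero[OF vertex_seriesD(1)[OF A]])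
  obtain \<mu> \<alpha> where "b = (\<mu>, \<alpha>)" by (cases b)
  with b assms(2,3) gradedD[OF vertex_seriesD(2)[OF A], of k \<mu> \<alpha> \<nu> \<gamma>]
  show "good N \<nu>" "\<gamma> \<in> root_lattice N" by (auto simp: mem_VQ root_lattice_add)
qed

section \<open>Closure properties of families with Heisenberg covariance\<close>

lemma heis_family_comp2:
  assumes A: "vertex_series N A \<phi> f \<beta>" "\<beta> \<in> root_lattice N"
    and B: "vertex_series N B \<psi> g \<gamma>" "\<gamma> \<in> root_lattice N"
  shows "heis_family N (\<lambda>k l m v. A k (B l v)) \<phi> \<psi> (\<lambda>_ _. 0)"
  by (rule heis_familyI)
    (simp_all add: lin_comp vertex_seriesD[OF A(1)] vertex_seriesD[OF B(1)] vertex_series_VQ[OF A]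
      vertex_series_VQ[OF B] lin_add[OF vertex_seriesD(1)[OF A(1)]]
      lin_cscale[OF vertex_seriesD(1)[OF A(1)]] algebra_simps)

lemma heis_family_comp3:
  assumes A: "vertex_series N A \<phi> f \<beta>" "\<beta> \<in> root_lattice N"
    and B: "vertex_series N B \<psi> g \<gamma>" "\<gamma> \<in> root_lattice N"
    and C: "vertex_series N C \<chi> h \<delta>" "\<delta> \<in> root_lattice N"
  shows "heis_family N (\<lambda>k l m v. A k (B l (C m v))) \<phi> \<psi> \<chi>"
proof (rule heis_familyI)
  show "lin (\<lambda>v. A k (B l (C m v)))" for k l m
    using lin_comp[OF vertex_seriesD(1)[OF A(1)] lin_comp[OF vertex_seriesD(1)[OF B(1)] vertex_seriesD(1)[OF C(1)]]] .
qed (simp_all add: vertex_seriesD[OF A(1)] vertex_seriesD[OF B(1)] vertex_seriesD[OF C(1)]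
      vertex_series_VQ[OF A] vertex_series_VQ[OF B] vertex_series_VQ[OF C]
      lin_add[OF vertex_seriesD(1)[OF A(1)]] lin_cscale[OF vertex_seriesD(1)[OF A(1)]]
      lin_add[OF vertex_seriesD(1)[OF B(1)]] lin_cscale[OF vertex_seriesD(1)[OF B(1)]] algebra_simps)

lemma heis_family_swap12:
  "heis_family N T \<phi> \<psi> \<chi> \<Longrightarrow> heis_family N (\<lambda>k l m. T l k m) \<psi> \<phi> \<chi>"
  by (rule heis_familyI) (simp_all add: heis_familyD algebra_simps)

lemma heis_family_swap23:
  "heis_family N T \<phi> \<psi> \<chi> \<Longrightarrow> heis_family N (\<lambda>k l m. T k m l) \<phi> \<chi> \<psi>"
  by (rule heis_familyI) (simp_all add: heis_familyD algebra_simps)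

lemma heis_family_diff:
  "heis_family N T \<phi> \<psi> \<chi> \<Longrightarrow> heis_family N S \<phi> \<psi> \<chi> \<Longrightarrow>
   heis_family N (\<lambda>k l m v. T k l m v - S k l m v) \<phi> \<psi> \<chi>"
  by (rule heis_familyI)
    (simp_all add: heis_familyD lin_minus VQ_diff lin_diff[OF lin_heis] cscale_diff)

lemma heis_family_add:
  "heis_family N T \<phi> \<psi> \<chi> \<Longrightarrow> heis_family N S \<phi> \<psi> \<chi> \<Longrightarrow>
   heis_family N (\<lambda>k l m v. T k l m v + S k l m v) \<phi> \<psi> \<chi>"
  by (rule heis_familyI)
    (simp_all add: heis_familyD lin_plus VQ_add lin_add[OF lin_heis] cscale_add)

lemma heis_family_scale:
  "heis_family N T \<phi> \<psi> \<chi> \<Longrightarrow> heis_family N (\<lambda>k l m v. c *\<^sub>C T k l m v) \<phi> \<psi> \<chi>"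
  by (rule heis_familyI)
    (simp_all add: heis_familyD lin_scale VQ_cscale lin_cscale[OF lin_heis] cscale_add mult.commute)

lemma heis_family_shift:
  assumes T: "heis_family N T \<phi> \<psi> \<chi>"
  shows "heis_family N (\<lambda>k l m. T (k + a) (l + b) (m + c)) \<phi> \<psi> \<chi>"
proof (rule heis_familyI)
  fix a' n k l m v
  assume an: "a' < N" "n \<noteq> (0::int)"
  have e: "k - n + a = k + a - n" "l - n + b = l + b - n" "m - n + c = m + c - n" by simp_all
  show "heis N (int a') n (T (k + a) (l + b) (m + c) v) = T (k + a) (l + b) (m + c) (heis N (int a') n v)
     + \<phi> a' n *\<^sub>C T (k - n + a) (l + b) (m + c) v + \<psi> a' n *\<^sub>C T (k + a) (l - n + b) (m + c) v
     + \<chi> a' n *\<^sub>C T (k + a) (l + b) (m - n + c) v"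
    unfolding e by (rule heis_familyD(3)[OF T an])
qed (simp_all add: heis_familyD[OF T])

lemma heis_family_zero: "heis_family N (\<lambda>_ _ _ _. 0) \<phi> \<psi> \<chi>"
  by (rule heis_familyI) (simp_all add: lin_zero VQ_zero lin_0[OF lin_heis])

lemma heis_family_sum:
  "(\<And>a. a \<in> A \<Longrightarrow> heis_family N (T a) \<phi> \<psi> \<chi>) \<Longrightarrow>
   heis_family N (\<lambda>k l m v. \<Sum>a\<in>A. T a k l m v) \<phi> \<psi> \<chi>"
  by (induction A rule: infinite_finite_induct) (simp_all add: heis_family_zero heis_family_add)

text \<open>The exchange relations contain sums whose upper bound depends on k and l, while
  covariance compares T at shifted indices. One bound M serves the finitely many index triples in
  one such comparison.\<close>

lemma heis_family_eventually:
  fixes b :: "int \<Rightarrow> int \<Rightarrow> int \<Rightarrow> nat"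
  assumes S: "\<And>M. heis_family N (S M) \<phi> \<psi> \<chi>" and eq: "\<And>k l m M. b k l m \<le> M \<Longrightarrow> T k l m = S M k l m"
  shows "heis_family N T \<phi> \<psi> \<chi>"
proof (rule heis_familyI)
  show "lin (T k l m)" for k l m
    using heis_familyD(1)[OF S] by (simp add: eq[OF order_refl])
  show "T k l m v \<in> VQ N" if "v \<in> VQ N" for k l m v
    using heis_familyD(2)[OF S that] by (simp add: eq[OF order_refl])
next
  fix a n k l m v
  assume an: "a < N" "n \<noteq> (0::int)"
  define M where "M = max (max (b k l m) (b (k - n) l m)) (max (b k (l - n) m) (b k l (m - n)))"
  have "T k l m = S M k l m" "T (k - n) l m = S M (k - n) l m" "T k (l - n) m = S M k (l - n) m"
      "T k l (m - n) = S M k l (m - n)"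
    by (rule eq, simp add: M_def)+
  then show "heis N (int a) n (T k l m v) = T k l m (heis N (int a) n v)
        + \<phi> a n *\<^sub>C T (k - n) l m v + \<psi> a n *\<^sub>C T k (l - n) m v + \<chi> a n *\<^sub>C T k l (m - n) v"
    by (simp only: heis_familyD(3)[OF S an])
qed

section \<open>Quadratic relations and Serre relations\<close>

text \<open>Extended by 0 to negative exponents, so that the vanishing below the leading power needs
  no separate case in the two-point formulas.\<close>

definition fps_coeff :: "'a::zero fps \<Rightarrow> int \<Rightarrow> 'a" where
  "fps_coeff F k = (if k \<ge> 0 then fps_nth F (nat k) else 0)"

lemma two_point_fps_coeff:
  assumes "vertex_op N A \<phi> f \<beta> \<kappa>" "vertex_op N B \<psi> g \<gamma> \<kappa>'" "exp_int (contraction N \<phi> \<psi>) F"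
  shows "lookup (A k (B l (vac \<alpha>))) (0, \<delta>) =
    (if k + l = g \<alpha> + f (\<alpha> + \<gamma>) \<and> \<delta> = \<alpha> + \<gamma> + \<beta>
     then \<kappa>' \<alpha> * \<kappa> (\<alpha> + \<gamma>) * fps_coeff F (l - g \<alpha>) else 0)"
  by (simp add: two_point[OF assms] fps_coeff_def)

section \<open>Exponentials of power sums as products of the series 1 - aX and their
  inverses\<close>

lemma exp_int_cong: "exp_int c F \<Longrightarrow> (\<And>n. n \<ge> 1 \<Longrightarrow> c n = c' n) \<Longrightarrow> exp_int c' F"
  unfolding exp_int_def by (metis (no_types, lifting) atLeastAtMost_iff sum.cong)

text \<open>The recursion is the equation X F' = C F for the logarithmic derivative, with C the
  generating series of c. In this form products of series visibly correspond to sums of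
  exponents.\<close>

lemma exp_int_iff:
  "exp_int c F \<longleftrightarrow> fps_nth F 0 = 1 \<and>
     fps_X * fps_deriv F = Abs_fps (\<lambda>n. if n = 0 then 0 else c n) * F"
proof -
  have 1: "fps_nth (fps_X * fps_deriv F) r = of_nat r * fps_nth F r" for r
    by (cases r) auto
  have 2: "fps_nth (Abs_fps (\<lambda>n. if n = 0 then 0 else c n) * F) r
      = (\<Sum>n=1..r. c n * fps_nth F (r - n))" for r
  proof -
    have "fps_nth (Abs_fps (\<lambda>n. if n = 0 then 0 else c n) * F) r
        = (\<Sum>n=0..r. (if n = 0 then 0 else c n) * fps_nth F (r - n))"
      by (simp add: fps_mult_nth)
    also have "\<dots> = (\<Sum>n=1..r. (if n = 0 then 0 else c n) * fps_nth F (r - n))"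
      by (rule sum.mono_neutral_right) auto
    also have "\<dots> = (\<Sum>n=1..r. c n * fps_nth F (r - n))"
      by (rule sum.cong) auto
    finally show ?thesis .
  qed
  show ?thesis
    unfolding exp_int_def fps_eq_iff by (simp only: 1 2)
qed

lemma exp_int_mult:
  assumes "exp_int c F" "exp_int c' G"
  shows "exp_int (\<lambda>n. c n + c' n) (F * G)"
proof -
  have "Abs_fps (\<lambda>n. if n = 0 then 0 else c n + c' n)
      = Abs_fps (\<lambda>n. if n = 0 then 0 else c n) + Abs_fps (\<lambda>n. if n = 0 then 0 else c' n)"
    by (simp add: fps_eq_iff)
  with assms show ?thesis
    unfolding exp_int_iff by (simp add: algebra_simps)
qed

definition geom :: "complex \<Rightarrow> complex fps" where
  "geom a = Abs_fps (\<lambda>n. a ^ n)"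

lemma geom_mult: "geom a * (1 - fps_const a * fps_X) = 1"
proof (rule fps_ext)
  fix n
  show "fps_nth (geom a * (1 - fps_const a * fps_X)) n = fps_nth 1 n"
    by (cases n) (simp_all add: geom_def algebra_simps fps_mult_fps_X_plus_1_nth)
qed

lemma exp_int_geom: "exp_int (\<lambda>n. a ^ n) (geom a)"
  unfolding exp_int_def
proof (intro conjI allI)
  fix r
  have "(\<Sum>n=1..r. a ^ n * fps_nth (geom a) (r - n)) = (\<Sum>n=1..r. a ^ r)"
    by (rule sum.cong) (simp_all add: geom_def flip: power_add)
  then show "of_nat r * fps_nth (geom a) r = (\<Sum>n=1..r. a ^ n * fps_nth (geom a) (r - n))"
    by (simp add: geom_def)
qed (simp add: geom_def)

lemma exp_int_one_minus: "exp_int (\<lambda>n. - (a ^ n)) (1 - fps_const a * fps_X)"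
proof -
  let ?G = "Abs_fps (\<lambda>n. if n = 0 then 0 else a ^ n)"
  have "?G = geom a - 1" by (simp add: fps_eq_iff geom_def)
  then have "?G * (1 - fps_const a * fps_X) = fps_const a * fps_X"
    using geom_mult[of a] by (simp add: left_diff_distrib)
  moreover have "Abs_fps (\<lambda>n. if n = 0 then 0 else - (a ^ n)) = - ?G"
    by (simp add: fps_eq_iff)
  ultimately show ?thesis
    unfolding exp_int_iff by (simp add: mult.commute flip: fps_const_neg)
qed

lemma heis_family_eqI:
  assumes "heis_family N T \<phi> \<psi> \<chi>" "heis_family N S \<phi> \<psi> \<chi>"
    and "\<And>k l m \<alpha> \<gamma>. \<alpha> \<in> root_lattice N \<Longrightarrow> lookup (T k l m (vac \<alpha>)) (0, \<gamma>) = lookup (S k l m (vac \<alpha>)) (0, \<gamma>)"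
    and "v \<in> VQ N"
  shows "T k l m v = S k l m v"
  using heis_family_eq_0[OF heis_family_diff[OF assms(1,2)] _ assms(4), of k l m] assms(3)
  by (simp add: lookup_minus)

lemma fps_coeff_geom: "fps_coeff (geom a) k = (if k \<ge> 0 then a ^ nat k else 0)"
  by (simp add: fps_coeff_def geom_def)

text \<open>For the quadratic relation at adjacent nodes: c' and c are the lattice factors of the
  two orders, and s and t the multiples of a delta that remain on the two sides.\<close>

lemma linear_relation_scaled:
  fixes a b :: complex
  assumes "u * a - v * a' = s" "u' * b - b' = t" "c' * s = c * t"
  shows "u * (c' * a) - v * (c' * a') = u' * (c * b) - c * b'"
proof -
  have "u * (c' * a) - v * (c' * a') = c' * (u * a - v * a')" by (simp add: algebra_simps)
  also have "\<dots> = c * (u' * b - b')" using assms by simp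
  also have "\<dots> = u' * (c * b) - c * b'" by (simp add: algebra_simps)
  finally show ?thesis .
qed

text \<open>(1 - aX) \<open>geom a\<close> = 1 read off at every integer index; the delta at 0 is
  what is left when a linear factor cancels the pole.\<close>

lemma geom_recurrence:
  "fps_coeff (geom a) k = a * fps_coeff (geom a) (k - 1) + (if k = 0 then 1 else 0)"
proof (cases "k > 0")
  case True
  then have "nat k = Suc (nat (k - 1))" by simp
  then show ?thesis using True by (simp add: fps_coeff_geom)
qed (simp add: fps_coeff_geom)

lemma fps_coeff_quadratic:
  "fps_coeff ((1 - fps_const a * fps_X) * (1 - fps_const b * fps_X)) k
    = (if k = 0 then 1 else if k = 1 then - (a + b) else if k = 2 then a * b else (0 :: complex))"
proof -
  have "(1 - fps_const a * fps_X) * (1 - fps_const b * fps_X)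
      = 1 - fps_const (a + b) * fps_X + fps_const (a * b) * fps_X ^ 2"
    by (simp add: algebra_simps power2_eq_square flip: fps_const_mult fps_const_add)
  then show ?thesis
    by (auto simp: fps_coeff_def fps_X_power_iff nat_eq_iff)
qed

section \<open>Arithmetic of the cyclic Dynkin diagram\<close>

context fock_rep
begin

text \<open>This is where N >= 3 matters: with two nodes each would precede and follow the other,
  and the two directions of an edge, told apart by \<open>mcoef\<close>, would coincide.\<close>

lemma nxt_nxt_neq: "i < N \<Longrightarrow> nxt (nxt i) \<noteq> i"
proof -
  assume i: "i < N"
  have "nxt (nxt i) = (i + 2) mod N" by (simp add: nxt_def mod_Suc_eq)
  also have "\<dots> \<noteq> i"
  proof (cases "i + 2 < N")
    case False
    then have "(i + 2) mod N = i + 2 - N" using i N3 by (simp add: mod_if)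
    then show ?thesis using N3 i False by simp
  qed simp
  finally show ?thesis .
qed

lemma nxt_inject: "i < N \<Longrightarrow> j < N \<Longrightarrow> nxt i = nxt j \<longleftrightarrow> i = j"
  by (auto simp: nxt_def mod_Suc split: if_splits)

lemma kron_eq: "i < N \<Longrightarrow> j < N \<Longrightarrow> kron N i j = (if i = j then 1 else 0)"
  "i < N \<Longrightarrow> kron N i (Suc j) = (if i = nxt j then 1 else 0)"
  "j < N \<Longrightarrow> kron N (Suc i) j = (if j = nxt i then 1 else 0)"
  by (auto simp: kron_def nxt_def)

lemma cartan_eq: "i < N \<Longrightarrow> j < N \<Longrightarrow> cartan N i j
    = (if i = j then 2 else if j = nxt i \<or> i = nxt j then -1 else 0)"
  using nxt_neq[of i] nxt_neq[of j] nxt_nxt_neq[of i] nxt_nxt_neq[of j]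
  unfolding cartan_def by (auto simp: kron_eq)

lemma mcoef_eq: "i < N \<Longrightarrow> j < N \<Longrightarrow> mcoef N i j = (if i = nxt j then 1 else if j = nxt i then -1 else 0)"
  using nxt_nxt_neq[of i] nxt_nxt_neq[of j] unfolding mcoef_def by (auto simp: kron_eq)

lemma simple_root_in: "i < N \<Longrightarrow> simple_root i \<in> root_lattice N"
  by (simp add: simple_root_def simple_root_in_root_lattice)

lemma lookup_simple_root: "i < N \<Longrightarrow> a < N \<Longrightarrow>
    lookup (simple_root i) a = (if a = i then 1 else 0) - (if a = nxt i then 1 else 0)"
  by (simp add: simple_root_def lookup_minus lookup_eps_vec nat_mod)

lemma lform_simple_roots: "i < N \<Longrightarrow> j < N \<Longrightarrow> lform (simple_root i) (simple_root j) = cartan N i j"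
  using nxt_neq[of i] nxt_neq[of j] nxt_less[of i] nxt_nxt_neq[of i] nxt_nxt_neq[of j]
  by (auto simp: lform_simple_root lookup_simple_root cartan_eq nxt_inject)

end

text \<open>Common setting for E, with Q the inverse of q, and for -F, with Q = q. The contraction
  series are (1 - X)(1 - Q^2 X) at equal nodes, and 1/(1 - Q d X) or 1/(1 - (Q/d) X) along an edge,
  depending on its direction. \<open>ch_rt\<close> compares the lattice factors of the two orders;
  its signs come from the cocycle.\<close>

locale current = fock_rep +
  fixes A :: "nat \<Rightarrow> op_series" and \<phi> :: "nat \<Rightarrow> nat \<Rightarrow> int \<Rightarrow> complex" and h :: "nat \<Rightarrow> lattice \<Rightarrow> int"
    and rt :: "nat \<Rightarrow> lattice" and w :: "nat \<Rightarrow> complex" and ch :: "nat \<Rightarrow> lattice \<Rightarrow> complex" and Q :: complex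
  assumes vertex: "\<And>i. i < N \<Longrightarrow> vertex_op N (A i) (\<phi> i) (\<lambda>\<alpha>. h i \<alpha> + 1) (rt i) (\<lambda>\<alpha>. w i * ch i \<alpha>)"
    and rt: "\<And>i. i < N \<Longrightarrow> rt i \<in> root_lattice N"
    and h_add: "\<And>i \<alpha> \<beta>. h i (\<alpha> + \<beta>) = h i \<alpha> + h i \<beta>"
    and h_rt: "\<And>i j. i < N \<Longrightarrow> j < N \<Longrightarrow> h i (rt j) = cartan N i j"
    and Q_nz: "Q \<noteq> 0"
    and contraction_A: "\<And>i j n. i < N \<Longrightarrow> j < N \<Longrightarrow> n \<ge> 1 \<Longrightarrow> contraction N (\<phi> i) (\<phi> j) n
       = (if i = j then - (1 ^ n) + - ((Q\<^sup>2) ^ n) else if j = nxt i then (Q * d) ^ n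
          else if i = nxt j then (Q / d) ^ n else 0)"
    and ch_add: "\<And>i \<alpha> \<beta>. i < N \<Longrightarrow> \<alpha> \<in> root_lattice N \<Longrightarrow> \<beta> \<in> root_lattice N \<Longrightarrow> ch i (\<alpha> + \<beta>) = ch i \<alpha> * ch i \<beta>"
    and ch_rt: "\<And>i j. i < N \<Longrightarrow> j < N \<Longrightarrow> i \<noteq> j \<Longrightarrow> ch j (rt i)
       = (if j = nxt i then - (1 / d) else if i = nxt j then - d else 1) * ch i (rt j)"
begin

definition pair_fps :: "nat \<Rightarrow> nat \<Rightarrow> complex fps" where
  "pair_fps i j = (if i = j then (1 - fps_const 1 * fps_X) * (1 - fps_const (Q\<^sup>2) * fps_X)
     else if j = nxt i then geom (Q * d) else if i = nxt j then geom (Q / d) else 1)"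

lemma exp_int_pair:
  assumes "i < N" "j < N"
  shows "exp_int (contraction N (\<phi> i) (\<phi> j)) (pair_fps i j)"
proof -
  have "exp_int (\<lambda>n. if i = j then - (1 ^ n) + - ((Q\<^sup>2) ^ n) else if j = nxt i then (Q * d) ^ n
          else if i = nxt j then (Q / d) ^ n else 0) (pair_fps i j)"
    unfolding pair_fps_def
    using exp_int_mult[OF exp_int_one_minus exp_int_one_minus, of 1 "Q\<^sup>2"] exp_int_geom exp_int_0
    by simp
  then show ?thesis
    by (rule exp_int_cong) (simp add: contraction_A[OF assms])
qed

lemma expectation2:
  assumes "i < N" "j < N" "\<alpha> \<in> root_lattice N"
  shows "lookup (A i k (A j l (vac \<alpha>))) (0, \<delta>) =
    (if k + l = h i \<alpha> + h j \<alpha> + cartan N i j + 2 \<and> \<delta> = \<alpha> + rt j + rt i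
     then w i * w j * ch i \<alpha> * ch j \<alpha> * ch i (rt j) * fps_coeff (pair_fps i j) (l - h j \<alpha> - 1) else 0)"
  by (subst two_point_fps_coeff[OF vertex[OF assms(1)] vertex[OF assms(2)] exp_int_pair[OF assms(1,2)]])
    (auto simp: h_add h_rt assms ch_add rt algebra_simps)

lemma family2: "i < N \<Longrightarrow> j < N \<Longrightarrow> heis_family N (\<lambda>k l m v. A i k (A j l v)) (\<phi> i) (\<phi> j) (\<lambda>_ _. 0)"
  using heis_family_comp2 vertex_opD(1)[OF vertex] rt by blast

lemma family2': "i < N \<Longrightarrow> j < N \<Longrightarrow> heis_family N (\<lambda>k l m v. A j l (A i k v)) (\<phi> i) (\<phi> j) (\<lambda>_ _. 0)"
  using heis_family_swap12[OF family2] by blast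

text \<open>Both contraction series are 1, so each order contributes at a single pair of indices,
  the same for both, with equal lattice factors.\<close>

lemma commute:
  assumes "i < N" "j < N" "cartan N i j = 0" "v \<in> VQ N"
  shows "A i k (A j l v) = A j l (A i k v)"
proof -
  have ij: "i \<noteq> j" "j \<noteq> nxt i" "i \<noteq> nxt j" using assms by (auto simp: cartan_eq split: if_splits)
  have "cartan N j i = 0" using ij assms by (simp add: cartan_eq)
  with ij show ?thesis
    by (intro heis_family_eqI[OF family2[OF assms(1,2)] family2'[OF assms(1,2)] _ assms(4)])
      (auto simp: expectation2 assms pair_fps_def ch_rt[of i j] fps_coeff_def add.commute add.left_commute)
qed

lemma pair_fps_self: "fps_coeff (pair_fps i i) k
   = (if k = 0 then 1 else if k = 1 then - (1 + Q\<^sup>2) else if k = 2 then Q\<^sup>2 else 0)"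
  by (simp only: pair_fps_def fps_coeff_quadratic simp_thms if_True mult_1)

text \<open>One form for both currents: Q^(-a_ij) is q^(a_ij) for E, while for F this is the
  toroidal relation divided by q^(a_ij). Multiplication by a variable appears as lowering the index
  of its coefficient by 1.\<close>

lemma quadratic:
  assumes i: "i < N" and j: "j < N" and v: "v \<in> VQ N"
  shows "d powi mcoef N i j *\<^sub>C A i (k - 1) (A j l v) - Q powi (- cartan N i j) *\<^sub>C A i k (A j (l - 1) v)
    = (Q powi (- cartan N i j) * d powi mcoef N i j) *\<^sub>C A j l (A i (k - 1) v) - A j (l - 1) (A i k v)"
proof -
  \<comment> \<open>The shifts, zero included, are written as additions to match
    \<open>heis_family_shift\<close>.\<close>
  let ?T = "\<lambda>k l (m::int) v. d powi mcoef N i j *\<^sub>C A i (k + (- 1)) (A j (l + 0) v)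
     - Q powi (- cartan N i j) *\<^sub>C A i (k + 0) (A j (l + (- 1)) v)"
  let ?S = "\<lambda>k l (m::int) v. (Q powi (- cartan N i j) * d powi mcoef N i j) *\<^sub>C A j (l + 0) (A i (k + (- 1)) v)
     - 1 *\<^sub>C A j (l + (- 1)) (A i (k + 0) v)"
  have T: "heis_family N ?T (\<phi> i) (\<phi> j) (\<lambda>_ _. 0)"
    by (intro heis_family_diff heis_family_scale heis_family_shift[OF family2[OF i j]])
  have S: "heis_family N ?S (\<phi> i) (\<phi> j) (\<lambda>_ _. 0)"
    by (intro heis_family_diff heis_family_scale heis_family_shift[OF family2'[OF i j]])
  have "?T k l 0 v = ?S k l 0 v"
  proof (rule heis_family_eqI[OF T S _ v])
    fix k l m :: int and \<alpha> \<gamma>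
    assume \<alpha>: "\<alpha> \<in> root_lattice N"
    define x where "x = l - h j \<alpha> - 1"
    have sym: "cartan N j i = cartan N i j" using i j by (auto simp: cartan_eq)
    show "lookup (?T k l m (vac \<alpha>)) (0, \<gamma>) = lookup (?S k l m (vac \<alpha>)) (0, \<gamma>)"
    proof (cases "k - 1 + l = h i \<alpha> + h j \<alpha> + cartan N i j + 2 \<and> \<gamma> = \<alpha> + rt j + rt i")
      case False
      then show ?thesis
        by (auto simp: lookup_minus expectation2[OF i j \<alpha>] expectation2[OF j i \<alpha>] sym ac_simps)
    next
      case True
      then have k: "k = h i \<alpha> + h j \<alpha> + cartan N i j + 3 - l" and \<gamma>: "\<gamma> = \<alpha> + rt j + rt i" "\<gamma> = \<alpha> + rt i + rt j"
        by (simp_all add: ac_simps)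
      let ?c = "w i * w j * ch i \<alpha> * ch j \<alpha>"
      have e: "lookup (A i (k - 1) (A j l (vac \<alpha>))) (0, \<gamma>) = ?c * ch i (rt j) * fps_coeff (pair_fps i j) x"
        "lookup (A i k (A j (l - 1) (vac \<alpha>))) (0, \<gamma>) = ?c * ch i (rt j) * fps_coeff (pair_fps i j) (x - 1)"
        "lookup (A j l (A i (k - 1) (vac \<alpha>))) (0, \<gamma>) = ?c * ch j (rt i) * fps_coeff (pair_fps j i) (cartan N i j - x)"
        "lookup (A j (l - 1) (A i k (vac \<alpha>))) (0, \<gamma>) = ?c * ch j (rt i) * fps_coeff (pair_fps j i) (cartan N i j + 1 - x)"
        using \<gamma> by (simp_all add: k expectation2[OF i j \<alpha>] expectation2[OF j i \<alpha>] sym x_def algebra_simps)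
      have main: "d powi mcoef N i j * (ch i (rt j) * fps_coeff (pair_fps i j) x)
         - Q powi (- cartan N i j) * (ch i (rt j) * fps_coeff (pair_fps i j) (x - 1))
         = Q powi (- cartan N i j) * d powi mcoef N i j * (ch j (rt i) * fps_coeff (pair_fps j i) (cartan N i j - x))
         - ch j (rt i) * fps_coeff (pair_fps j i) (cartan N i j + 1 - x)"
      proof -
        have e: "- 1 - x = - x - 1" by simp
        \<comment> \<open>At equal nodes both sides are explicit polynomials. Along an edge the
          linear factor cancels the pole in either order, which leaves multiples of a delta at x =
          0, made equal by \<open>ch_rt\<close>.\<close>
        consider "i = j" | "j = nxt i" "i \<noteq> j" "i \<noteq> nxt j" | "i = nxt j" "i \<noteq> j" "j \<noteq> nxt i"
          | "i \<noteq> j" "j \<noteq> nxt i" "i \<noteq> nxt j"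
          using nxt_nxt_neq[OF i] nxt_nxt_neq[OF j] nxt_neq[OF i] nxt_neq[OF j] by auto
        then show ?thesis
        proof cases
          case 1
          have cm: "cartan N i i = 2" "mcoef N i i = 0"
            using i nxt_neq[OF i] by (auto simp: cartan_eq mcoef_eq)
          have e: "fps_coeff (pair_fps i i) x - Q powi (- 2) * fps_coeff (pair_fps i i) (x - 1)
            = Q powi (- 2) * fps_coeff (pair_fps i i) (2 - x) - fps_coeff (pair_fps i i) (3 - x)"
            using Q_nz by (auto simp: pair_fps_self power_int_minus field_simps)
          then show ?thesis
            unfolding 1[symmetric] cm by (simp add: algebra_simps flip: distrib_left)
        next
          case 2
          then have cm: "cartan N i j = -1" "mcoef N i j = -1" and pf: "pair_fps i j = geom (Q * d)" "pair_fps j i = geom (Q / d)"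
            using i j by (auto simp: cartan_eq mcoef_eq pair_fps_def)
          have "d powi (- 1) * fps_coeff (geom (Q * d)) x - Q * fps_coeff (geom (Q * d)) (x - 1)
             = (if x = 0 then 1 / d else 0)"
            using geom_recurrence[of "Q * d" x] d_nz by (auto simp: power_int_minus field_simps)
          moreover have "Q * d powi (- 1) * fps_coeff (geom (Q / d)) (- 1 - x) - fps_coeff (geom (Q / d)) (- x)
             = (if x = 0 then - 1 else 0)"
            unfolding e using geom_recurrence[of "Q / d" "- x"] d_nz by (auto simp: power_int_minus field_simps)
          moreover have "ch j (rt i) = - (1 / d) * ch i (rt j)" using ch_rt[OF i j] 2 by simp
          ultimately show ?thesis
            unfolding cm pf by (intro linear_relation_scaled) auto
        next
          case 3
          then have cm: "cartan N i j = -1" "mcoef N i j = 1" and pf: "pair_fps i j = geom (Q / d)" "pair_fps j i = geom (Q * d)"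
            using i j by (auto simp: cartan_eq mcoef_eq pair_fps_def)
          have "d * fps_coeff (geom (Q / d)) x - Q * fps_coeff (geom (Q / d)) (x - 1)
             = (if x = 0 then d else 0)"
            using geom_recurrence[of "Q / d" x] d_nz by (auto simp: power_int_minus field_simps)
          moreover have "Q * d * fps_coeff (geom (Q * d)) (- 1 - x) - fps_coeff (geom (Q * d)) (- x)
             = (if x = 0 then - 1 else 0)"
            unfolding e using geom_recurrence[of "Q * d" "- x"] d_nz by (auto simp: power_int_minus field_simps)
          moreover have "ch j (rt i) = - d * ch i (rt j)" using ch_rt[OF i j] 3 by simp
          ultimately show ?thesis
            unfolding cm pf by (intro linear_relation_scaled) auto
        next
          case 4
          then have cm: "cartan N i j = 0" "mcoef N i j = 0" and pf: "pair_fps i j = 1" "pair_fps j i = 1"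
            using i j by (auto simp: cartan_eq mcoef_eq pair_fps_def)
          have "ch j (rt i) = ch i (rt j)" using ch_rt[OF i j] 4 by simp
          then show ?thesis
            unfolding cm pf by (auto simp: fps_coeff_def)
        qed
      qed
      show ?thesis
        using arg_cong[OF main, of "\<lambda>t. ?c * t"]
        by (simp add: lookup_minus e algebra_simps)
    qed
  qed
  then show ?thesis by simp
qed

end

section \<open>Three-point functions and the Serre relations\<close>

lemma fps_coeff_nat: "fps_nth F n = fps_coeff F (int n)"
  by (simp add: fps_coeff_def)

text \<open>Here c is the coefficient function of a polynomial of degree 2, as in the contraction of
  a current with itself. Because \<open>fps_coeff\<close> is 0 outside the range, the same three
  terms are correct for every r, small ones included.\<close>

lemma sum_quadratic_coeff:
  assumes "\<And>u. c u = (if u = 0 then p0 else if u = 1 then p1 else if u = 2 then p2 else (0::complex))"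
  shows "(\<Sum>u\<le>r. c (int u) * fps_nth G (r - u) * h (int u)) =
    p0 * fps_coeff G (int r) * h 0 + p1 * fps_coeff G (int r - 1) * h 1 + p2 * fps_coeff G (int r - 2) * h 2"
proof -
  have "(\<Sum>u\<le>r. c (int u) * fps_nth G (r - u) * h (int u))
      = (\<Sum>u\<in>{0, 1, 2} \<inter> {..r}. c (int u) * fps_nth G (r - u) * h (int u))"
    by (rule sum.mono_neutral_right) (auto simp: assms)
  also have "\<dots> = (\<Sum>u\<in>{0, 1, 2}. c (int u) * fps_coeff G (int r - int u) * h (int u))"
  proof -
    have *: "fps_coeff G (int r - int u) = (if u \<le> r then fps_nth G (r - u) else 0)" for u
      by (auto simp: fps_coeff_def nat_diff_distrib)
    show ?thesis
      by (rule sum.mono_neutral_cong_left) (auto simp: *)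
  qed
  finally show ?thesis
    by (simp add: assms algebra_simps)
qed

text \<open>The polynomial is now evaluated at z + (r - u), so each of its three coefficients
  selects one u. If that u lies outside the summation range, one of the two \<open>fps_coeff\<close>
  factors is 0.\<close>

lemma sum_quadratic_coeff_shift:
  assumes "\<And>u. c u = (if u = 0 then p0 else if u = 1 then p1 else if u = 2 then p2 else (0::complex))"
  shows "(\<Sum>u\<le>r. fps_nth F u * fps_nth G (r - u) * c (z + int (r - u))) =
    p0 * (fps_coeff F (int r + z) * fps_coeff G (- z)) + p1 * (fps_coeff F (int r + z - 1) * fps_coeff G (1 - z))
    + p2 * (fps_coeff F (int r + z - 2) * fps_coeff G (2 - z))"
proof -
  have 1: "(\<Sum>u\<le>r. fps_nth F u * fps_nth G (r - u) * (if z + int (r - u) = a then p else 0))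
      = p * (fps_coeff F (int r + z - a) * fps_coeff G (a - z))" for a p
  proof (cases "0 \<le> a - z \<and> a - z \<le> int r")
    case True
    then have "(\<Sum>u\<le>r. fps_nth F u * fps_nth G (r - u) * (if z + int (r - u) = a then p else 0))
       = (\<Sum>u\<in>{nat (int r + z - a)}. fps_nth F u * fps_nth G (r - u) * (if z + int (r - u) = a then p else 0))"
      by (intro sum.mono_neutral_right) (auto simp: of_nat_diff)
    also have "\<dots> = p * (fps_coeff F (int r + z - a) * fps_coeff G (a - z))"
    proof -
      obtain m where m: "a - z = int m" "m \<le> r"
        using True by (metis nonneg_int_cases of_nat_le_iff)
      then have "int r + z - a = int (r - m)" by (simp add: of_nat_diff)
      then have "r - nat (int r + z - a) = nat (a - z)" using m by simp
      then show ?thesis using True by (simp add: fps_coeff_def)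
    qed
    finally show ?thesis .
  qed (auto simp: fps_coeff_def intro!: sum.neutral)
  have "fps_nth F u * fps_nth G (r - u) * c (z + int (r - u))
    = fps_nth F u * fps_nth G (r - u) * (if z + int (r - u) = 0 then p0 else 0)
    + fps_nth F u * fps_nth G (r - u) * (if z + int (r - u) = 1 then p1 else 0)
    + fps_nth F u * fps_nth G (r - u) * (if z + int (r - u) = 2 then p2 else 0)" for u
    by (simp add: assms)
  then show ?thesis
    by (simp only: sum.distrib 1) simp
qed

text \<open>With $a(z) = 1/(z - x)$ and $b(z) = 1/(z - 1/y)$ expanded at infinity and at $0$, this is the
  coefficient of $z_1^{K_1} z_2^{K_2}$ in the rational identity behind the Serre relations; it
  uses only $(z - x) a(z) = 1 = (z - 1/y) b(z)$.\<close>

definition serre_sum :: "complex \<Rightarrow> complex \<Rightarrow> complex \<Rightarrow> int \<Rightarrow> int \<Rightarrow> complex" where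
  "serre_sum Q x y K L =
    (let a = fps_coeff (geom x); b = fps_coeff (geom y);
         T = (\<lambda>g g'. g 0 * g' 0 - (1 + Q\<^sup>2) * (g 1 * g' 1) + Q\<^sup>2 * (g 2 * g' 2));
         aK = (\<lambda>u. a (1 - u - K)); aL = (\<lambda>u. a (u - 1 - L)); bK = (\<lambda>u. b (K + u - 2)); bL = (\<lambda>u. b (L - u))
     in T aK aL + (Q + inverse Q) * (y / Q) * T aK bL + (y / Q)\<^sup>2 * T bK bL)"

text \<open>The recurrences express the three values of each geometric series through the one at the
  lowest index and two deltas. After inserting x = Q^2 / y a polynomial identity in these quantities
  remains.\<close>

lemma serre_sum_symmetric:
  assumes "x * y = Q\<^sup>2" "Q \<noteq> 0"
  shows "serre_sum Q x y K L + serre_sum Q x y L K = 0"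
proof -
  have y: "y \<noteq> 0" using assms by auto
  then have x: "x = Q\<^sup>2 / y" using assms by (simp add: nonzero_eq_divide_eq)
  let ?a = "fps_coeff (geom x)" and ?b = "fps_coeff (geom y)"
  have a: "?a (- M) = x * ?a (- 1 - M) + (if M = 0 then 1 else 0)"
    "?a (1 - M) = x * ?a (- M) + (if M = 1 then 1 else 0)" for M
  proof -
    have "- 1 - M = - M - 1" "1 - M - 1 = - M" by simp_all
    then show "?a (- M) = x * ?a (- 1 - M) + (if M = 0 then 1 else 0)"
      "?a (1 - M) = x * ?a (- M) + (if M = 1 then 1 else 0)"
      using geom_recurrence[of x "- M"] geom_recurrence[of x "1 - M"] by (simp_all only:) auto
  qed
  have b: "?b (M - 1) = y * ?b (M - 2) + (if M = 1 then 1 else 0)"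
    "?b M = y * ?b (M - 1) + (if M = 0 then 1 else 0)" for M
    using geom_recurrence[of y "M - 1"] geom_recurrence[of y M] by auto
  define a1 where "a1 = ?a (- 1 - K)" define a2 where "a2 = ?a (- 1 - L)"
  define b1 where "b1 = ?b (K - 2)" define b2 where "b2 = ?b (L - 2)"
  define k0 :: complex where "k0 = (if K = 0 then 1 else 0)" define k1 :: complex where "k1 = (if K = 1 then 1 else 0)"
  define l0 :: complex where "l0 = (if L = 0 then 1 else 0)" define l1 :: complex where "l1 = (if L = 1 then 1 else 0)"
  have e: "?a (- K) = x * a1 + k0" "?a (1 - K) = x * (x * a1 + k0) + k1" "?a (- 1 - K) = a1"
    "?a (- L) = x * a2 + l0" "?a (1 - L) = x * (x * a2 + l0) + l1" "?a (- 1 - L) = a2"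
    "?b (K - 1) = y * b1 + k1" "?b K = y * (y * b1 + k1) + k0" "?b (K - 2) = b1"
    "?b (L - 1) = y * b2 + l1" "?b L = y * (y * b2 + l1) + l0" "?b (L - 2) = b2"
    using a[of K] a[of L] b[of K] b[of L] by (simp_all only: a1_def a2_def b1_def b2_def k0_def k1_def l0_def l1_def)
  show ?thesis
    unfolding serre_sum_def Let_def
    apply (simp add: e)
    apply (simp add: x power2_eq_square)
    using y assms(2) apply (simp add: field_simps)
    done
qed

context current
begin

text \<open>The pair (x, y) is (Q d, Q / d) or its reversal, according to the direction of the edge.
  The Serre computation then runs for both directions through x y = Q^2 and the lattice ratio
  -y/Q.\<close>

lemma adjacent:
  assumes "i < N" "j < N" "cartan N i j = -1"
  obtains x y where "pair_fps i j = geom x" "pair_fps j i = geom y" "x * y = Q\<^sup>2" "i \<noteq> j" "cartan N j i = -1"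
    "ch j (rt i) = - (y / Q) * ch i (rt j)"
proof -
  have "i \<noteq> j" and adj: "j = nxt i \<or> i = nxt j" and c: "cartan N j i = -1"
    using assms by (auto simp: cartan_eq split: if_splits)
  note nn = nxt_nxt_neq[OF assms(1)] nxt_nxt_neq[OF assms(2)]
  from adj show thesis
  proof
    assume j: "j = nxt i"
    then have "pair_fps i j = geom (Q * d)" "pair_fps j i = geom (Q / d)"
      using \<open>i \<noteq> j\<close> nn by (auto simp: pair_fps_def)
    moreover have "ch j (rt i) = - (Q / d / Q) * ch i (rt j)"
      using ch_rt[OF assms(1,2) \<open>i \<noteq> j\<close>] j Q_nz by simp
    ultimately show thesis
      using that d_nz \<open>i \<noteq> j\<close> c by (simp add: power2_eq_square)
  next
    assume i: "i = nxt j"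
    then have j: "j \<noteq> nxt i" using nn by auto
    then have "pair_fps i j = geom (Q / d)" "pair_fps j i = geom (Q * d)"
      using \<open>i \<noteq> j\<close> i by (auto simp: pair_fps_def)
    moreover have "ch j (rt i) = - (Q * d / Q) * ch i (rt j)"
      using ch_rt[OF assms(1,2) \<open>i \<noteq> j\<close>] i j Q_nz by simp
    ultimately show thesis
      using that d_nz \<open>i \<noteq> j\<close> c by (simp add: power2_eq_square)
  qed
qed

text \<open>The three orderings share the same condition on the total degree. They differ in the
  expansion of the contractions between i and j and in a lattice factor -y/Q for every exchange of
  an i with j. Their combination is \<open>serre_sum\<close>, whose symmetrization in the two
  i-variables vanishes.\<close>

lemma serre:
  assumes i: "i < N" and j: "j < N" and aij: "cartan N i j = -1" and v: "v \<in> VQ N"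
  shows "(A i k (A i l (A j m v)) - (Q + inverse Q) *\<^sub>C A i k (A j m (A i l v)) + A j m (A i k (A i l v)))
    + (A i l (A i k (A j m v)) - (Q + inverse Q) *\<^sub>C A i l (A j m (A i k v)) + A j m (A i l (A i k v))) = 0"
proof -
  obtain x y where pf: "pair_fps i j = geom x" "pair_fps j i = geom y" and xy: "x * y = Q\<^sup>2"
    and ij: "i \<noteq> j" and aji: "cartan N j i = -1" and ch: "ch j (rt i) = - (y / Q) * ch i (rt j)"
    using adjacent[OF i j aij] .
  have aii: "cartan N i i = 2" using i nxt_neq[OF i] by (simp add: cartan_eq)
  define S where "S = (\<lambda>k l m v. A i k (A i l (A j m v)) - (Q + inverse Q) *\<^sub>C A i k (A j m (A i l v))
     + A j m (A i k (A i l v)))"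
  note vi = vertex_opD(1)[OF vertex[OF i]] rt[OF i] and vj = vertex_opD(1)[OF vertex[OF j]] rt[OF j]
  have S: "heis_family N S (\<phi> i) (\<phi> i) (\<phi> j)"
    unfolding S_def
    by (intro heis_family_add heis_family_diff heis_family_scale heis_family_comp3[OF vi vi vj]
        heis_family_swap23[OF heis_family_comp3[OF vi vj vi]]
        heis_family_swap23[OF heis_family_swap12[OF heis_family_comp3[OF vj vi vi]]])
  have S2: "heis_family N (\<lambda>k l m v. S k l m v + S l k m v) (\<phi> i) (\<phi> i) (\<phi> j)"
    by (rule heis_family_add[OF S heis_family_swap12[OF S]])
  have vev: "lookup (S k l m (vac \<alpha>)) (0, \<gamma>) =
     (if k + l + m = 2 * h i \<alpha> + h j \<alpha> + 3 \<and> \<gamma> = \<alpha> + rt j + rt i + rt i then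
      w i * w i * w j * (ch i \<alpha>)\<^sup>2 * ch j \<alpha> * ch i (rt i) * (ch i (rt j))\<^sup>2 *
      serre_sum Q x y (k - h i \<alpha> - 1) (l - h i \<alpha> - 1) else 0)" if \<alpha>: "\<alpha> \<in> root_lattice N" for k l m \<alpha> \<gamma>
  proof -
    \<comment> \<open>K and L are the powers of the two i-variables counted from the order of
      \<open>A i\<close> on e^\<alpha>.\<close>
    define K where "K = k - h i \<alpha> - 1"
    define L where "L = l - h i \<alpha> - 1"
    define C where "C \<longleftrightarrow> k + l + m = 2 * h i \<alpha> + h j \<alpha> + 3 \<and> \<gamma> = \<alpha> + rt j + rt i + rt i"
    define c where "c = w i * w i * w j * (ch i \<alpha>)\<^sup>2 * ch j \<alpha> * ch i (rt i)"
    let ?a = "fps_coeff (geom x)" and ?b = "fps_coeff (geom y)" and ?P = "fps_coeff (pair_fps i i)"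
    note \<alpha>i = root_lattice_add[OF \<alpha> rt[OF i]] and \<alpha>j = root_lattice_add[OF \<alpha> rt[OF j]]
    have hj: "h i (\<alpha> + rt j) = h i \<alpha> - 1" and hi: "h i (\<alpha> + rt i) = h i \<alpha> + 2" "h j (\<alpha> + rt i) = h j \<alpha> - 1"
      by (simp_all add: h_add h_rt i j aij aji aii)
    have ci: "ch i (\<alpha> + rt j) = ch i \<alpha> * ch i (rt j)" "ch i (\<alpha> + rt i) = ch i \<alpha> * ch i (rt i)"
       "ch j (\<alpha> + rt i) = ch j \<alpha> * ch j (rt i)"
      using ch_add i j \<alpha> rt by simp_all
    \<comment> \<open>On the support C the inequality m < h j \<alpha> + 1 means K + L > 0; then the
      two arguments in each product of W1 add up to a negative number.\<close>
    have neg: "fps_coeff F u * fps_coeff F' u' = 0" if "u + u' < 0" for F F' :: "complex fps" and u u'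
      using that by (auto simp: fps_coeff_def)
    \<comment> \<open>\<open>A j\<close> is stripped first. Its contractions with both copies of
      \<open>A i\<close> are 1/(1 - xX), and the remaining pair of equal nodes supplies the
      polynomial.\<close>
    have W1: "lookup (A i k (A i l (A j m (vac \<alpha>)))) (0, \<gamma>) = (if C then c * (ch i (rt j))\<^sup>2 *
      (?a (1 - K) * ?a (- 1 - L) - (1 + Q\<^sup>2) * (?a (- K) * ?a (- L)) + Q\<^sup>2 * (?a (- 1 - K) * ?a (1 - L))) else 0)"
    proof (cases "m < h j \<alpha> + 1")
      case True
      then show ?thesis
        unfolding three_point_step[OF vi(1) vi(1) vertex[OF j] exp_int_pair[OF i j] exp_int_pair[OF i j]]
        by (simp add: neg C_def K_def L_def)
    next
      case False
      define r where "r = nat (m - (h j \<alpha> + 1))"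
      have m: "m = h j \<alpha> + 1 + int r" using False by (simp add: r_def)
      have *: "lookup (A i (k + int u) (A i (l + int (r - u)) (vac (\<alpha> + rt j)))) (0, \<gamma>)
         = (if C then w i * w i * (ch i \<alpha> * ch i (rt j))\<^sup>2 * ch i (rt i) * ?P (L + 1 + int (r - u)) else 0)"
        if "u \<le> r" for u
        using that
        by (simp add: expectation2[OF i i \<alpha>j] hj ci aii C_def m L_def of_nat_diff power2_eq_square algebra_simps)
      have "lookup (A i k (A i l (A j m (vac \<alpha>)))) (0, \<gamma>) = w j * ch j \<alpha> * (\<Sum>u\<le>r. fps_nth (geom x) u * fps_nth (geom x) (r - u) *
          (if C then w i * w i * (ch i \<alpha> * ch i (rt j))\<^sup>2 * ch i (rt i) * ?P (L + 1 + int (r - u)) else 0))"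
        unfolding three_point_step[OF vi(1) vi(1) vertex[OF j] exp_int_pair[OF i j] exp_int_pair[OF i j]]
          r_def[symmetric] pf if_not_P[OF False] using * by simp
      also have "\<dots> = (if C then c * (ch i (rt j))\<^sup>2 *
          (\<Sum>u\<le>r. fps_nth (geom x) u * fps_nth (geom x) (r - u) * ?P (L + 1 + int (r - u))) else 0)"
        by (simp add: c_def sum_distrib_left power2_eq_square algebra_simps)
      also have "(\<Sum>u\<le>r. fps_nth (geom x) u * fps_nth (geom x) (r - u) * ?P (L + 1 + int (r - u)))
         = 1 * (?a (int r + (L + 1)) * ?a (- (L + 1))) + - (1 + Q\<^sup>2) * (?a (int r + (L + 1) - 1) * ?a (1 - (L + 1)))
         + Q\<^sup>2 * (?a (int r + (L + 1) - 2) * ?a (2 - (L + 1)))"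
        by (rule sum_quadratic_coeff_shift) (rule pair_fps_self)
      finally show ?thesis
      proof (cases C)
        case True
        then have r: "int r = - K - L" by (simp add: C_def K_def L_def m)
        have e: "- K - L + (L + 1) = 1 - K" "- K - L + (L + 1) - 1 = - K" "- K - L + (L + 1) - 2 = - 1 - K"
          "- (L + 1) = - 1 - L" "1 - (L + 1) = - L" "2 - (L + 1) = 1 - L" by simp_all
        assume "lookup (A i k (A i l (A j m (vac \<alpha>)))) (0, \<gamma>) = (if C then c * (ch i (rt j))\<^sup>2 * (
          1 * (?a (int r + (L + 1)) * ?a (- (L + 1))) + - (1 + Q\<^sup>2) * (?a (int r + (L + 1) - 1) * ?a (1 - (L + 1)))
         + Q\<^sup>2 * (?a (int r + (L + 1) - 2) * ?a (2 - (L + 1)))) else 0)"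
        then show ?thesis unfolding r e using True by (simp only: if_True) (simp add: algebra_simps)
      qed simp
    qed
    \<comment> \<open>The rightmost \<open>A i\<close> is stripped: it contracts with the other
      \<open>A i\<close> through the polynomial and with \<open>A j\<close> through 1/(1 - yX). The
      pair left over contributes 1/(1 - xX).\<close>
    have W2: "lookup (A i k (A j m (A i l (vac \<alpha>)))) (0, \<gamma>) = (if C then c * (ch i (rt j) * ch j (rt i)) *
      (?a (1 - K) * ?b L - (1 + Q\<^sup>2) * (?a (- K) * ?b (L - 1)) + Q\<^sup>2 * (?a (- 1 - K) * ?b (L - 2))) else 0)"
    proof (cases "L < 0")
      case True
      then have "l < h i \<alpha> + 1" by (simp add: L_def)
      with True show ?thesis
        unfolding three_point_step[OF vi(1) vj(1) vertex[OF i] exp_int_pair[OF i i] exp_int_pair[OF j i]]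
        by (simp add: fps_coeff_def)
    next
      case False
      define r where "r = nat L"
      have l: "L = int r" using False by (simp add: r_def)
      have r': "nat (l - (h i \<alpha> + 1)) = r" by (simp add: r_def L_def diff_diff_eq)
      have *: "lookup (A i (k + int u) (A j (m + int (r - u)) (vac (\<alpha> + rt i)))) (0, \<gamma>)
         = (if C then w i * w j * (ch i \<alpha> * ch j \<alpha> * ch i (rt i) * ch j (rt i) * ch i (rt j)) * ?a (1 - K - int u) else 0)"
        if "u \<le> r" for u
      proof -
        have "k + int u + (m + int (r - u)) = h i (\<alpha> + rt i) + h j (\<alpha> + rt i) + cartan N i j + 2 \<longleftrightarrow>
          k + l + m = 2 * h i \<alpha> + h j \<alpha> + 3"
          using that l by (auto simp: hi aij L_def of_nat_diff)
        moreover have "\<alpha> + rt i + rt j + rt i = \<alpha> + rt j + rt i + rt i" by (simp add: ac_simps)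
        moreover have "?a (m + int (r - u) - h j (\<alpha> + rt i) - 1) = ?a (1 - K - int u)" if "k + l + m = 2 * h i \<alpha> + h j \<alpha> + 3"
          by (rule arg_cong[where f = ?a]) (use that l \<open>u \<le> r\<close> in \<open>simp add: hi K_def L_def of_nat_diff\<close>)
        ultimately show ?thesis
          unfolding expectation2[OF i j \<alpha>i] C_def pf by (auto simp: ci)
      qed
      have "lookup (A i k (A j m (A i l (vac \<alpha>)))) (0, \<gamma>) = w i * ch i \<alpha> * (\<Sum>u\<le>r. fps_nth (pair_fps i i) u * fps_nth (geom y) (r - u) *
          (if C then w i * w j * (ch i \<alpha> * ch j \<alpha> * ch i (rt i) * ch j (rt i) * ch i (rt j)) * ?a (1 - K - int u) else 0))"
        unfolding three_point_step[OF vi(1) vj(1) vertex[OF i] exp_int_pair[OF i i] exp_int_pair[OF j i]]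
          r' pf using * False by (simp add: L_def)
      also have "\<dots> = (if C then c * (ch i (rt j) * ch j (rt i)) *
          (\<Sum>u\<le>r. ?P (int u) * fps_nth (geom y) (r - u) * ?a (1 - K - int u)) else 0)"
        by (simp add: c_def sum_distrib_left power2_eq_square fps_coeff_nat[of "pair_fps i i"] algebra_simps)
      also have "(\<Sum>u\<le>r. ?P (int u) * fps_nth (geom y) (r - u) * ?a (1 - K - int u))
        = 1 * ?b (int r) * ?a (1 - K - 0) + - (1 + Q\<^sup>2) * ?b (int r - 1) * ?a (1 - K - 1) + Q\<^sup>2 * ?b (int r - 2) * ?a (1 - K - 2)"
        by (rule sum_quadratic_coeff) (rule pair_fps_self)
      also have "1 - K - 2 = - 1 - K" by simp
      finally show ?thesis unfolding l by (simp add: algebra_simps)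
    qed
    have W3: "lookup (A j m (A i k (A i l (vac \<alpha>)))) (0, \<gamma>) = (if C then c * (ch j (rt i))\<^sup>2 *
      (?b (K - 2) * ?b L - (1 + Q\<^sup>2) * (?b (K - 1) * ?b (L - 1)) + Q\<^sup>2 * (?b K * ?b (L - 2))) else 0)"
    proof (cases "L < 0")
      case True
      then have "l < h i \<alpha> + 1" by (simp add: L_def)
      with True show ?thesis
        unfolding three_point_step[OF vj(1) vi(1) vertex[OF i] exp_int_pair[OF j i] exp_int_pair[OF i i]]
        by (simp add: fps_coeff_def)
    next
      case False
      define r where "r = nat L"
      have l: "L = int r" using False by (simp add: r_def)
      have r': "nat (l - (h i \<alpha> + 1)) = r" by (simp add: r_def L_def diff_diff_eq)
      have *: "lookup (A j (m + int u) (A i (k + int (r - u)) (vac (\<alpha> + rt i)))) (0, \<gamma>)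
         = (if C then w i * w j * (ch i \<alpha> * ch j \<alpha> * ch i (rt i) * (ch j (rt i))\<^sup>2) * ?b (K - 2 + int (r - u)) else 0)"
        if "u \<le> r" for u
      proof -
        have "m + int u + (k + int (r - u)) = h j (\<alpha> + rt i) + h i (\<alpha> + rt i) + cartan N j i + 2 \<longleftrightarrow>
          k + l + m = 2 * h i \<alpha> + h j \<alpha> + 3"
          using that l by (auto simp: hi aji L_def of_nat_diff)
        moreover have "\<alpha> + rt i + rt i + rt j = \<alpha> + rt j + rt i + rt i" by (simp add: ac_simps)
        moreover have "?b (k + int (r - u) - h i (\<alpha> + rt i) - 1) = ?b (K - 2 + int (r - u))"
          by (rule arg_cong[where f = ?b]) (simp add: hi K_def)
        ultimately show ?thesis
          unfolding expectation2[OF j i \<alpha>i] C_def pf by (auto simp: ci power2_eq_square)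
      qed
      have "lookup (A j m (A i k (A i l (vac \<alpha>)))) (0, \<gamma>) = w i * ch i \<alpha> * (\<Sum>u\<le>r. fps_nth (geom y) u * fps_nth (pair_fps i i) (r - u) *
          (if C then w i * w j * (ch i \<alpha> * ch j \<alpha> * ch i (rt i) * (ch j (rt i))\<^sup>2) * ?b (K - 2 + int (r - u)) else 0))"
        unfolding three_point_step[OF vj(1) vi(1) vertex[OF i] exp_int_pair[OF j i] exp_int_pair[OF i i]]
          r' pf using * False by (simp add: L_def)
      also have "\<dots> = (if C then c * (ch j (rt i))\<^sup>2 *
          (\<Sum>u\<le>r. ?P (int (r - u)) * fps_nth (geom y) u * ?b (K - 2 + int (r - u))) else 0)"
        by (simp add: c_def sum_distrib_left power2_eq_square fps_coeff_nat[of "pair_fps i i"] algebra_simps)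
      \<comment> \<open>Reversing the summation puts the polynomial at index u, as
        \<open>sum_quadratic_coeff\<close> expects.\<close>
      also have "(\<Sum>u\<le>r. ?P (int (r - u)) * fps_nth (geom y) u * ?b (K - 2 + int (r - u)))
        = (\<Sum>u\<le>r. ?P (int u) * fps_nth (geom y) (r - u) * ?b (K - 2 + int u))"
        by (rule sum.reindex_bij_witness[of _ "\<lambda>u. r - u" "\<lambda>u. r - u"]) auto
      also have "\<dots> = 1 * ?b (int r) * ?b (K - 2 + 0) + - (1 + Q\<^sup>2) * ?b (int r - 1) * ?b (K - 2 + 1) + Q\<^sup>2 * ?b (int r - 2) * ?b (K - 2 + 2)"
        by (rule sum_quadratic_coeff) (rule pair_fps_self)
      finally show ?thesis unfolding l by (simp add: algebra_simps)
    qed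
    define T1 where "T1 = ?a (1 - K) * ?a (- 1 - L) - (1 + Q\<^sup>2) * (?a (- K) * ?a (- L)) + Q\<^sup>2 * (?a (- 1 - K) * ?a (1 - L))"
    define T2 where "T2 = ?a (1 - K) * ?b L - (1 + Q\<^sup>2) * (?a (- K) * ?b (L - 1)) + Q\<^sup>2 * (?a (- 1 - K) * ?b (L - 2))"
    define T3 where "T3 = ?b (K - 2) * ?b L - (1 + Q\<^sup>2) * (?b (K - 1) * ?b (L - 1)) + Q\<^sup>2 * (?b K * ?b (L - 2))"
    have "serre_sum Q x y K L = T1 + (Q + inverse Q) * (y / Q) * T2 + (y / Q)\<^sup>2 * T3"
      unfolding T1_def T2_def T3_def by (simp add: serre_sum_def Let_def)
    then show ?thesis
      unfolding S_def lookup_add lookup_minus lookup_cscale W1[folded T1_def] W2[folded T2_def] W3[folded T3_def]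
        K_def[symmetric] L_def[symmetric] C_def[symmetric] c_def[symmetric]
      by (simp add: ch algebra_simps power2_eq_square)
  qed
  have "S k l m v + S l k m v = 0"
  proof (rule heis_family_eq_0[OF S2 _ v])
    fix k l m \<alpha> \<gamma> assume \<alpha>: "\<alpha> \<in> root_lattice N"
    show "lookup (S k l m (vac \<alpha>) + S l k m (vac \<alpha>)) (0, \<gamma>) = 0"
      using serre_sum_symmetric[OF xy Q_nz, of "k - h i \<alpha> - 1" "l - h i \<alpha> - 1"]
      by (auto simp: lookup_add vev[OF \<alpha>] add.commute[of l k] simp flip: distrib_left)
  qed
  then show ?thesis by (simp add: S_def)
qed

end

section \<open>The cocycle, and the currents E and F as instances\<close>

context fock_rep
begin

lemma cocycle_values: "\<alpha> \<in> root_lattice N \<Longrightarrow> \<beta> \<in> root_lattice N \<Longrightarrow> \<epsilon> \<alpha> \<beta> = 1 \<or> \<epsilon> \<alpha> \<beta> = -1"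
  and cocycle_add: "\<alpha> \<in> root_lattice N \<Longrightarrow> \<beta> \<in> root_lattice N \<Longrightarrow> \<gamma> \<in> root_lattice N \<Longrightarrow>
      \<epsilon> (\<alpha> + \<beta>) \<gamma> = \<epsilon> \<alpha> \<gamma> * \<epsilon> \<beta> \<gamma>"
    "\<alpha> \<in> root_lattice N \<Longrightarrow> \<beta> \<in> root_lattice N \<Longrightarrow> \<gamma> \<in> root_lattice N \<Longrightarrow>
      \<epsilon> \<gamma> (\<alpha> + \<beta>) = \<epsilon> \<gamma> \<alpha> * \<epsilon> \<gamma> \<beta>"
  and cocycle_self: "\<alpha> \<in> root_lattice N \<Longrightarrow> \<epsilon> \<alpha> \<alpha> = (-1) powi (lform \<alpha> \<alpha> div 2)"
  using cocycle unfolding lattice_cocycle_def by blast+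

lemma cocycle_0: "\<alpha> \<in> root_lattice N \<Longrightarrow> \<epsilon> 0 \<alpha> = 1" "\<alpha> \<in> root_lattice N \<Longrightarrow> \<epsilon> \<alpha> 0 = 1"
  using cocycle_add(1)[of 0 0 \<alpha>] cocycle_add(2)[of 0 0 \<alpha>] cocycle_values[of 0 \<alpha>] cocycle_values[of \<alpha> 0] root_lattice_0
  by auto

text \<open>Bimultiplicativity makes the values at \<alpha> and -\<alpha> inverse to each other, and
  1 and -1 are their own inverses.\<close>

lemma cocycle_uminus:
  assumes "\<alpha> \<in> root_lattice N" "\<beta> \<in> root_lattice N"
  shows "\<epsilon> (- \<alpha>) \<beta> = \<epsilon> \<alpha> \<beta>" "\<epsilon> \<alpha> (- \<beta>) = \<epsilon> \<alpha> \<beta>"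
proof -
  note m = root_lattice_uminus[OF assms(1)] root_lattice_uminus[OF assms(2)]
  show "\<epsilon> (- \<alpha>) \<beta> = \<epsilon> \<alpha> \<beta>"
    using cocycle_add(1)[OF assms(1) m(1) assms(2)] cocycle_0(1)[OF assms(2)] cocycle_values[OF assms]
      cocycle_values[OF m(1) assms(2)] by auto
  show "\<epsilon> \<alpha> (- \<beta>) = \<epsilon> \<alpha> \<beta>"
    using cocycle_add(2)[OF assms(2) m(2) assms(1)] cocycle_0(2)[OF assms(1)] cocycle_values[OF assms]
      cocycle_values[OF assms(1) m(2)] by auto
qed

lemma cocycle_root: "i < N \<Longrightarrow> \<epsilon> (simple_root i) (simple_root i) = -1"
  using cocycle_self[OF simple_root_in] by (simp add: lform_simple_roots cartan_eq)

text \<open>Polarization of \<epsilon>(\<alpha>, \<alpha>) = (-1)^((\<alpha>, \<alpha>)/2) at the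
  sum of the two roots: the mixed values multiply to (-1)^(a_ij).\<close>

lemma cocycle_roots:
  assumes "i < N" "j < N" "i \<noteq> j"
  shows "\<epsilon> (simple_root j) (simple_root i) = (if j = nxt i \<or> i = nxt j then -1 else 1) * \<epsilon> (simple_root i) (simple_root j)"
proof -
  note r = simple_root_in[OF assms(1)] simple_root_in[OF assms(2)]
  let ?i = "simple_root i" and ?j = "simple_root j" and ?c = "cartan N i j"
  have "lform (?i + ?j) (?i + ?j) div 2 = 2 + ?c"
    using assms by (auto simp: lform_add_left lform_add_right lform_simple_roots cartan_eq)
  then have "\<epsilon> (?i + ?j) (?i + ?j) = (-1) powi (2 + ?c)"
    using cocycle_self[OF root_lattice_add[OF r]] by simp
  also have "\<dots> = (if j = nxt i \<or> i = nxt j then -1 else 1)"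
    using assms by (auto simp: cartan_eq)
  finally have "\<epsilon> ?i ?j * \<epsilon> ?j ?i = (if j = nxt i \<or> i = nxt j then -1 else 1)"
    using r assms by (simp add: cocycle_add root_lattice_add cocycle_root mult.commute)
  then show ?thesis
    using cocycle_values[OF r] cocycle_values[OF r(2,1)] by (auto split: if_splits)
qed

text \<open>Along the line this is the step from d^i to d^(i+1). Around the cycle, from N - 1 to 0,
  it reads \<open>inverse sp = sp * d ^ N\<close>, which is the relation p = d^(-N).\<close>

lemma pos_nxt: "i < N \<Longrightarrow> pos (nxt i) = d * pos' i"
proof (cases "nxt i = 0")
  case True
  assume i: "i < N"
  with True have "Suc i = N" by (auto simp: nxt_def mod_Suc split: if_splits)
  moreover have "sp * (sp * d ^ N) = 1"
    using sp_eq p_eq d_nz by (simp add: power2_eq_square power_int_minus flip: mult.assoc)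
  then have "inverse sp = sp * d ^ N"
    using sp_nz by (simp add: field_simps)
  ultimately show ?thesis
    using True by (auto simp: pos_def pos'_def)
next
  case False
  assume "i < N"
  with False have "nxt i = Suc i" by (auto simp: nxt_def mod_Suc split: if_splits)
  then show ?thesis by (simp add: pos_def pos'_def)
qed

text \<open>A current at node i involves the modes of epsilon_i and epsilon_(i+1) alone: equal nodes
  share both, adjacent nodes exactly one, all others none.\<close>

lemma contraction_two_terms:
  assumes i: "i < N" and j: "j < N"
    and \<phi>: "\<And>a. \<phi> a (- int n) = (if a = i then u else 0) - (if a = nxt i then v else 0)"
    and \<psi>: "\<And>a. \<psi> a (int n) = (if a = j then u' else 0) - (if a = nxt j then v' else 0)"
  shows "contraction N \<phi> \<psi> n = (if i = j then - (u * u') - v * v' else if j = nxt i then v * u'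
    else if i = nxt j then u * v' else 0)"
proof -
  have "contraction N \<phi> \<psi> n = - (\<Sum>a<N. (if a = i then (if i = j then u * u' else 0) - (if i = nxt j then u * v' else 0) else 0)
     - (if a = nxt i then (if nxt i = j then v * u' else 0) - (if nxt i = nxt j then v * v' else 0) else 0))"
    unfolding contraction_def by (intro arg_cong[where f = uminus] sum.cong) (auto simp: \<phi> \<psi> algebra_simps)
  also have "\<dots> = (if i = j then - (u * u') - v * v' else if j = nxt i then v * u'
    else if i = nxt j then u * v' else 0)"
    using i j nxt_less[of i] nxt_neq[OF i] nxt_nxt_neq[OF i] nxt_neq[OF j] nxt_nxt_neq[OF j]
    by (auto simp: sum_subtractf nxt_inject)
  finally show ?thesis .
qed

lemma E_char_add:
  assumes "i < N" "\<alpha> \<in> root_lattice N" "\<beta> \<in> root_lattice N"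
  shows "E_char i (\<alpha> + \<beta>) = E_char i \<alpha> * E_char i \<beta>"
  unfolding E_char_def cocycle_add(2)[OF assms(2,3) simple_root_in[OF assms(1)]] lookup_add minus_add_distrib
    power_int_add[OF disjI1[OF pos_nz(1)]] power_int_add[OF disjI1[OF pos_nz(2)]]
  by simp

lemma F_char_eq:
  assumes "i < N" "\<alpha> \<in> root_lattice N"
  shows "F_char i \<alpha> = E_char i (- \<alpha>)"
  unfolding F_char_def E_char_def
  using assms by (simp add: cocycle_uminus simple_root_in)

text \<open>Adjacent roots share one coordinate. The ratio is that of the positions assigned to it
  by the two nodes, a power of d by \<open>pos_nxt\<close>, times the sign -1 of the
  cocycle.\<close>

lemma E_char_root:
  assumes i: "i < N" and j: "j < N" and ij: "i \<noteq> j"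
  shows "E_char j (simple_root i) = (if j = nxt i then - (1 / d) else if i = nxt j then - d else 1) * E_char i (simple_root j)"
proof -
  note nn = nxt_nxt_neq[OF i] nxt_nxt_neq[OF j] nxt_neq[OF i] nxt_neq[OF j] nxt_less nxt_inject[OF i j]
  have lk: "lookup (simple_root i) j = (if j = nxt i then -1 else 0)" "lookup (simple_root j) i = (if i = nxt j then -1 else 0)"
    "lookup (simple_root i) (nxt j) = (if i = nxt j then 1 else 0)" "lookup (simple_root j) (nxt i) = (if j = nxt i then 1 else 0)"
    using ij i j nn by (auto simp: lookup_simple_root)
  consider "j = nxt i" "i \<noteq> nxt j" | "i = nxt j" "j \<noteq> nxt i" | "j \<noteq> nxt i" "i \<noteq> nxt j"
    using nn by auto
  then show ?thesis
  proof cases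
    case 1
    then show ?thesis
      using pos_nxt[OF i] d_nz pos_nz(2)[of i] unfolding E_char_def lk cocycle_roots[OF i j ij]
      by (simp add: power_int_minus field_simps)
  next
    case 2
    then show ?thesis
      using pos_nxt[OF j] d_nz pos_nz(2)[of j] unfolding E_char_def lk cocycle_roots[OF i j ij]
      by (simp add: power_int_minus field_simps)
  next
    case 3
    then show ?thesis
      unfolding E_char_def lk cocycle_roots[OF i j ij] by simp
  qed
qed

lemma contraction_EE:
  assumes i: "i < N" and j: "j < N" and "n \<ge> 1"
  shows "contraction N (E_coeff i) (E_coeff j) n
       = (if i = j then - (1 ^ n) + - (((inverse q)\<^sup>2) ^ n) else if j = nxt i then (inverse q * d) ^ n
          else if i = nxt j then (inverse q / d) ^ n else 0)"
  by (subst contraction_two_terms[OF i j, where u = "inverse (pos i) ^ n" and v = "inverse q ^ n * inverse (pos' i) ^ n"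
        and u' = "pos j ^ n" and v' = "inverse q ^ n * pos' j ^ n"])
    (use q_nz d_nz pos_nz[of i] pos_nz[of j] pos_nxt[OF i] pos_nxt[OF j] in
      \<open>auto simp: E_coeff_def power_int_minus power_inverse field_simps power2_eq_square simp flip: power_mult_distrib\<close>)

lemma contraction_FF:
  assumes i: "i < N" and j: "j < N" and "n \<ge> 1"
  shows "contraction N (F_coeff i) (F_coeff j) n
       = (if i = j then - (1 ^ n) + - ((q\<^sup>2) ^ n) else if j = nxt i then (q * d) ^ n
          else if i = nxt j then (q / d) ^ n else 0)"
  by (subst contraction_two_terms[OF i j, where u = "- (q ^ n * inverse (pos i) ^ n)" and v = "- (inverse (pos' i) ^ n)"
        and u' = "- (q ^ n * pos j ^ n)" and v' = "- (pos' j ^ n)"])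
    (use q_nz d_nz pos_nz[of i] pos_nz[of j] pos_nxt[OF i] pos_nxt[OF j] in
      \<open>auto simp: F_coeff_def power_int_minus power_inverse field_simps power2_eq_square simp flip: power_mult_distrib\<close>)

sublocale E: current N q d p sq sp \<epsilon> "E_ser N \<epsilon> q p sp d" E_coeff "\<lambda>i. lform (simple_root i)" simple_root norm_const
  E_char "inverse q"
proof (unfold_locales, goal_cases)
  case (1 i) then show ?case by (rule vertex_op_E)
next
  case (2 i) then show ?case by (rule simple_root_in)
next
  case (3 i \<alpha> \<beta>) show ?case by (rule lform_add_right)
next
  case (4 i j) then show ?case by (rule lform_simple_roots)
next
  case 5 show ?case using q_nz by simp
next
  case (6 i j n) then show ?case by (rule contraction_EE)
next
  case (7 i \<alpha> \<beta>) then show ?case by (rule E_char_add)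
next
  case (8 i j) then show ?case by (rule E_char_root)
qed

sublocale F: current N q d p sq sp \<epsilon> F_op F_coeff "\<lambda>i \<alpha>. - lform (simple_root i) \<alpha>" "\<lambda>i. - simple_root i"
  "\<lambda>i. - norm_const i" F_char q
proof (unfold_locales, goal_cases)
  case (1 i) then show ?case by (rule vertex_op_F)
next
  case (2 i) then show ?case by (intro root_lattice_uminus simple_root_in)
next
  case (3 i \<alpha> \<beta>) show ?case by (simp add: lform_add_right)
next
  case (4 i j) then show ?case by (simp add: lform_uminus_right lform_simple_roots)
next
  case 5 show ?case by (rule q_nz)
next
  case (6 i j n) then show ?case by (rule contraction_FF)
next
  case (7 i \<alpha> \<beta>) then show ?case
    using E_char_add[of i "- \<alpha>" "- \<beta>"] by (simp add: F_char_eq root_lattice_uminus root_lattice_add)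
next
  case (8 i j)
  then have "F_char j (- simple_root i) = E_char j (simple_root i)" "F_char i (- simple_root j) = E_char i (simple_root j)"
    by (simp_all add: F_char_eq root_lattice_uminus simple_root_in)
  then show ?case using E_char_root[OF 8] by simp
qed

section \<open>The structure functions theta as ratios (1 - uX)/(1 - vX)\<close>

definition ratio_fps :: "complex \<Rightarrow> complex \<Rightarrow> complex fps" where
  "ratio_fps u v = geom v * (1 - fps_const u * fps_X)"

lemma exp_int_ratio: "exp_int (\<lambda>n. v ^ n - u ^ n) (ratio_fps u v)"
  using exp_int_mult[OF exp_int_geom exp_int_one_minus, of v u] by (simp add: ratio_fps_def)

lemma ratio_fps_inverse: "ratio_fps u v * ratio_fps v u = 1"
proof -
  have "g * r * (g' * r') = (g' * r) * (g * r')" for g r g' r' :: "complex fps" by (simp add: ac_simps)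
  then show ?thesis unfolding ratio_fps_def by (simp only: geom_mult) simp
qed

lemma ratio_fps_scale: "fps_nth (ratio_fps u v) n * w ^ n = fps_nth (ratio_fps (u * w) (v * w)) n"
proof (cases n)
  case (Suc k)
  have r: "fps_nth (ratio_fps u v) (Suc k) = v ^ Suc k - u * v ^ k" for u v
  proof -
    have "ratio_fps u v = geom v - fps_const u * (geom v * fps_X)"
      by (simp add: ratio_fps_def algebra_simps)
    then show ?thesis by (simp add: geom_def)
  qed
  show ?thesis
    unfolding Suc r by (simp add: power_mult_distrib algebra_simps)
qed (simp add: ratio_fps_def geom_def)

text \<open>\<theta>_m(z) = q^(-m) (1 - q^m z)/(1 - q^(-m) z). The prefactor will match the lattice
  part of a Cartan current and the ratio its contraction; w is the scalar in the argument of
  \<theta>.\<close>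

lemma theta_nth: "fps_nth (theta q m) n * w ^ n = q powi (- m) * fps_nth (ratio_fps (q powi m * w) (q powi (- m) * w)) n"
proof -
  define a where "a = q powi m"
  have a: "a \<noteq> 0" and a': "q powi (- m) = inverse a" using q_nz by (simp_all add: a_def power_int_minus)
  let ?D = "fps_X - fps_const a"
  have D: "fps_nth ?D 0 \<noteq> 0" using a by simp
  have "fps_const a * fps_X - 1 = (fps_const (inverse a) * ratio_fps a (inverse a)) * ?D"
  proof -
    have "?D = - (fps_const a * (1 - fps_const (inverse a) * fps_X))"
      using a by (simp add: algebra_simps flip: mult.assoc)
    moreover have "c' * (g * r) * (- (c * r')) = - ((c' * c) * (r * (g * r')))" for c c' g r r' :: "complex fps"
      by (simp add: ac_simps)
    moreover have "fps_const (inverse a) * fps_const a = 1" using a by simp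
    ultimately have "(fps_const (inverse a) * ratio_fps a (inverse a)) * ?D
      = - (1 * ((1 - fps_const a * fps_X) * (geom (inverse a) * (1 - fps_const (inverse a) * fps_X))))"
      unfolding ratio_fps_def by (simp only:)
    then show ?thesis by (simp only: geom_mult) simp
  qed
  then have "theta q m = fps_const (inverse a) * ratio_fps a (inverse a)"
    unfolding theta_def a_def[symmetric] using D by (simp add: fps_divide_unit mult.assoc inverse_mult_eq_1' del: fps_sub_nth)
  then show ?thesis
    by (simp add: a' ratio_fps_scale mult.assoc flip: a_def)
qed

end

section \<open>Exchange relations with a Cartan current\<close>

lemma composite_zero:
  assumes "vertex_op N B \<psi> g \<gamma> \<kappa>" "u = 0"
  shows "B l u = 0"
  using lin_0[OF vertex_seriesD(1)[OF vertex_opD(1)[OF assms(1)]]] assms(2) by simp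

text \<open>The number of terms varies with k and l. Since the terms beyond \<open>b k l\<close>
  vanish, the sum may be taken up to any larger fixed M, where the closure properties apply.\<close>

lemma exchange_sum_family:
  assumes A: "vertex_op N A \<phi> f \<beta> \<kappa>" "\<beta> \<in> root_lattice N" and B: "vertex_op N B \<psi> g \<gamma> \<kappa>'" "\<gamma> \<in> root_lattice N"
    and bound: "\<And>k l n v. b k l < n \<Longrightarrow> B (l + e' * int n) (A (k + e * int n) v) = 0"
  shows "heis_family N (\<lambda>k l m v. \<Sum>n\<le>b k l. t n *\<^sub>C B (l + e' * int n) (A (k + e * int n) v)) \<phi> \<psi> (\<lambda>_ _. 0)"
proof (rule heis_family_eventually[where b = "\<lambda>k l m. b k l"])
  show "heis_family N (\<lambda>k l m v. \<Sum>n\<le>M. t n *\<^sub>C B (l + e' * int n) (A (k + e * int n) v)) \<phi> \<psi> (\<lambda>_ _. 0)" for M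
  proof (intro heis_family_sum heis_family_scale)
    note fam = heis_family_swap12[OF heis_family_comp2[OF vertex_opD(1)[OF B(1)] B(2) vertex_opD(1)[OF A(1)] A(2)]]
    show "heis_family N (\<lambda>k l m v. B (l + e' * int n) (A (k + e * int n) v)) \<phi> \<psi> (\<lambda>_ _. 0)" for n
      using heis_family_shift[OF fam, where a = "e * int n" and b = "e' * int n"] .
  qed
  show "(\<lambda>v. \<Sum>n\<le>b k l. t n *\<^sub>C B (l + e' * int n) (A (k + e * int n) v))
     = (\<lambda>v. \<Sum>n\<le>M. t n *\<^sub>C B (l + e' * int n) (A (k + e * int n) v))" if "b k l \<le> M" for k l m M
  proof
    fix v
    show "(\<Sum>n\<le>b k l. t n *\<^sub>C B (l + e' * int n) (A (k + e * int n) v))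
     = (\<Sum>n\<le>M. t n *\<^sub>C B (l + e' * int n) (A (k + e * int n) v))"
      by (rule sum.mono_neutral_left) (use that bound in auto)
  qed
qed

lemma fps_coeff_1: "fps_coeff (1 :: complex fps) k = (if k = 0 then 1 else 0)"
  by (simp add: fps_coeff_def)

text \<open>A stands for K^+, which has only annihilation modes. Nothing is contracted when it
  stands on the right, so A(z) B(w) = s F(w/z) B(w) A(z); the scalar s is the effect of the lattice
  shift of B on the leading coefficient of A.\<close>

lemma exchange_plus:
  assumes A: "vertex_op N A \<phi> (\<lambda>_. 0) 0 \<kappa>" "\<And>k v. k > 0 \<Longrightarrow> A k v = 0" "\<And>a n. n > 0 \<Longrightarrow> \<phi> a n = 0"
    and B: "vertex_op N B \<psi> g \<gamma> \<kappa>'" "\<gamma> \<in> root_lattice N"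
    and F: "exp_int (contraction N \<phi> \<psi>) F"
    and s: "\<And>\<alpha>. \<kappa> (\<alpha> + \<gamma>) = s * \<kappa> \<alpha>" "\<And>n. t n = s * fps_nth F n"
    and v: "v \<in> VQ N"
  shows "A k (B l v) = (\<Sum>n\<le>nat (- k). t n *\<^sub>C B (l - int n) (A (k + int n) v))"
proof -
  have "A k (B l v) = (\<Sum>n\<le>nat (- k). t n *\<^sub>C B (l + (- 1) * int n) (A (k + 1 * int n) v))"
  proof (rule heis_family_eqI[where T = "\<lambda>k l m v. A k (B l v)" and S = "\<lambda>k l m v.
        \<Sum>n\<le>nat (- k). t n *\<^sub>C B (l + (- 1) * int n) (A (k + 1 * int n) v)", OF _ _ _ v])
    show "heis_family N (\<lambda>k l m v. A k (B l v)) \<phi> \<psi> (\<lambda>_ _. 0)"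
      by (rule heis_family_comp2[OF vertex_opD(1)[OF A(1)] root_lattice_0 vertex_opD(1)[OF B(1)] B(2)])
    show "heis_family N (\<lambda>k l m v. \<Sum>n\<le>nat (- k). t n *\<^sub>C B (l + (- 1) * int n) (A (k + 1 * int n) v)) \<phi> \<psi> (\<lambda>_ _. 0)"
      by (rule exchange_sum_family[OF A(1) root_lattice_0 B]) (rule composite_zero[OF B(1)], rule A(2), simp)
  next
    fix k l m :: int and \<alpha> \<delta>
    have 1: "exp_int (contraction N \<psi> \<phi>) 1"
      by (rule exp_int_cong[OF exp_int_0]) (simp add: contraction_def A(3))
    have "lookup (\<Sum>n\<le>nat (- k). t n *\<^sub>C B (l + (- 1) * int n) (A (k + 1 * int n) (vac \<alpha>))) (0, \<delta>)
       = (\<Sum>n\<le>nat (- k). if n = nat (- k) then (if k \<le> 0 \<and> k + l = g \<alpha> \<and> \<delta> = \<alpha> + \<gamma> then t n * (\<kappa> \<alpha> * \<kappa>' \<alpha>) else 0) else 0)"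
      unfolding lookup_sum lookup_cscale two_point_fps_coeff[OF B(1) A(1) 1]
      by (intro sum.cong) (auto simp: fps_coeff_1)
    also have "\<dots> = (if k \<le> 0 \<and> k + l = g \<alpha> \<and> \<delta> = \<alpha> + \<gamma> then t (nat (- k)) * (\<kappa> \<alpha> * \<kappa>' \<alpha>) else 0)"
      by simp
    also have "\<dots> = lookup (A k (B l (vac \<alpha>))) (0, \<delta>)"
    proof (cases "k + l = g \<alpha>")
      case True
      then have "l - g \<alpha> = - k" by simp
      then show ?thesis
        unfolding two_point_fps_coeff[OF A(1) B(1) F] by (simp add: s fps_coeff_def)
    qed (simp add: two_point_fps_coeff[OF A(1) B(1) F])
    finally show "lookup (A k (B l (vac \<alpha>))) (0, \<delta>)
      = lookup (\<Sum>n\<le>nat (- k). t n *\<^sub>C B (l + (- 1) * int n) (A (k + 1 * int n) (vac \<alpha>))) (0, \<delta>)" ..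
  qed
  then show ?thesis by simp
qed

text \<open>A stands for K^-, which has only creation modes. The contraction F now arises in the
  order B A, so the structure function is s divided by F.\<close>

lemma exchange_minus:
  assumes A: "vertex_op N A \<phi> (\<lambda>_. 0) 0 \<kappa>" "\<And>k v. k < 0 \<Longrightarrow> A k v = 0" "\<And>a n. n < 0 \<Longrightarrow> \<phi> a n = 0"
    and B: "vertex_op N B \<psi> g \<gamma> \<kappa>'" "\<gamma> \<in> root_lattice N"
    and F: "exp_int (contraction N \<psi> \<phi>) F"
    and s: "\<And>\<alpha>. \<kappa> (\<alpha> + \<gamma>) = s * \<kappa> \<alpha>" "Abs_fps t * F = fps_const s"
    and v: "v \<in> VQ N"
  shows "A k (B l v) = (\<Sum>n\<le>nat k. t n *\<^sub>C B (l + int n) (A (k - int n) v))"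
proof -
  have "A k (B l v) = (\<Sum>n\<le>nat k. t n *\<^sub>C B (l + 1 * int n) (A (k + (- 1) * int n) v))"
  proof (rule heis_family_eqI[where T = "\<lambda>k l m v. A k (B l v)" and S = "\<lambda>k l m v.
        \<Sum>n\<le>nat k. t n *\<^sub>C B (l + 1 * int n) (A (k + (- 1) * int n) v)", OF _ _ _ v])
    show "heis_family N (\<lambda>k l m v. A k (B l v)) \<phi> \<psi> (\<lambda>_ _. 0)"
      by (rule heis_family_comp2[OF vertex_opD(1)[OF A(1)] root_lattice_0 vertex_opD(1)[OF B(1)] B(2)])
    show "heis_family N (\<lambda>k l m v. \<Sum>n\<le>nat k. t n *\<^sub>C B (l + 1 * int n) (A (k + (- 1) * int n) v)) \<phi> \<psi> (\<lambda>_ _. 0)"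
      by (rule exchange_sum_family[OF A(1) root_lattice_0 B]) (rule composite_zero[OF B(1)], rule A(2), simp)
  next
    fix k l m :: int and \<alpha> \<delta>
    have 1: "exp_int (contraction N \<phi> \<psi>) 1"
      by (rule exp_int_cong[OF exp_int_0]) (simp add: contraction_def A(3))
    have tF: "(\<Sum>n\<le>r. t n * fps_nth F (r - n)) = (if r = 0 then s else 0)" for r
      using arg_cong[OF s(2), of "\<lambda>G. fps_nth G r"] by (simp add: fps_mult_nth atLeast0AtMost)
    have "lookup (\<Sum>n\<le>nat k. t n *\<^sub>C B (l + 1 * int n) (A (k + (- 1) * int n) (vac \<alpha>))) (0, \<delta>)
       = (\<Sum>n\<le>nat k. (if k \<ge> 0 \<and> k + l = g \<alpha> \<and> \<delta> = \<alpha> + \<gamma> then \<kappa> \<alpha> * \<kappa>' \<alpha> else 0) * (t n * fps_nth F (nat k - n)))"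
      unfolding lookup_sum lookup_cscale two_point_fps_coeff[OF B(1) A(1) F]
      by (intro sum.cong) (auto simp: fps_coeff_def nat_diff_distrib')
    also have "\<dots> = (if k \<ge> 0 \<and> k + l = g \<alpha> \<and> \<delta> = \<alpha> + \<gamma> then \<kappa> \<alpha> * \<kappa>' \<alpha> else 0) * (if nat k = 0 then s else 0)"
      unfolding sum_distrib_left[symmetric] tF ..
    also have "\<dots> = lookup (A k (B l (vac \<alpha>))) (0, \<delta>)"
      unfolding two_point_fps_coeff[OF A(1) B(1) 1] by (auto simp: s fps_coeff_1)
    finally show "lookup (A k (B l (vac \<alpha>))) (0, \<delta>)
      = lookup (\<Sum>n\<le>nat k. t n *\<^sub>C B (l + 1 * int n) (A (k + (- 1) * int n) (vac \<alpha>))) (0, \<delta>)" ..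
  qed
  then show ?thesis by simp
qed

text \<open>K^- K^+ is already in normal order, and K^+ K^- acquires the contraction F. The relation
  therefore holds exactly when F is the quotient of the structure functions t' and t.\<close>

lemma exchange_plus_minus:
  assumes A: "vertex_op N A \<phi> (\<lambda>_. 0) 0 \<kappa>" "\<And>k v. k > 0 \<Longrightarrow> A k v = 0" "\<And>a n. n > 0 \<Longrightarrow> \<phi> a n = 0"
    and B: "vertex_op N B \<psi> (\<lambda>_. 0) 0 \<kappa>'" "\<And>k v. k < 0 \<Longrightarrow> B k v = 0"
    and F: "exp_int (contraction N \<phi> \<psi>) F"
    and t: "Abs_fps t * F = Abs_fps t'"
    and v: "v \<in> VQ N"
  shows "(\<Sum>n\<le>nat (min (- k) l). t n *\<^sub>C A (k + int n) (B (l - int n) v))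
     = (\<Sum>n\<le>nat (min (- k) l). t' n *\<^sub>C B (l - int n) (A (k + int n) v))"
proof -
  have "(\<Sum>n\<le>nat (min (- k) l). t n *\<^sub>C A (k + 1 * int n) (B (l + (- 1) * int n) v))
     = (\<Sum>n\<le>nat (min (- k) l). t' n *\<^sub>C B (l + (- 1) * int n) (A (k + 1 * int n) v))"
  proof (rule heis_family_eqI[where T = "\<lambda>k l m v. \<Sum>n\<le>nat (min (- k) l). t n *\<^sub>C A (k + 1 * int n) (B (l + (- 1) * int n) v)"
        and S = "\<lambda>k l m v. \<Sum>n\<le>nat (min (- k) l). t' n *\<^sub>C B (l + (- 1) * int n) (A (k + 1 * int n) v)", OF _ _ _ v])
    have z: "A (k + 1 * int n) (B (l + - 1 * int n) v) = 0" "B (l + - 1 * int n) (A (k + 1 * int n) v) = 0"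
      if "nat (min (- k) l) < n" for k l n v
    proof -
      have "k + int n > 0 \<or> l - int n < 0" using that by (auto simp: min_def split: if_splits)
      then show "A (k + 1 * int n) (B (l + - 1 * int n) v) = 0" "B (l + - 1 * int n) (A (k + 1 * int n) v) = 0"
        using A(2) B(2) composite_zero[OF A(1)] composite_zero[OF B(1)] by auto
    qed
    show "heis_family N (\<lambda>k l m v. \<Sum>n\<le>nat (min (- k) l). t n *\<^sub>C A (k + 1 * int n) (B (l + (- 1) * int n) v)) \<phi> \<psi> (\<lambda>_ _. 0)"
      using heis_family_swap12[OF exchange_sum_family[where b = "\<lambda>l k. nat (min (- k) l)", OF B(1) root_lattice_0 A(1) root_lattice_0 z(1)]] .
    show "heis_family N (\<lambda>k l m v. \<Sum>n\<le>nat (min (- k) l). t' n *\<^sub>C B (l + (- 1) * int n) (A (k + 1 * int n) v)) \<phi> \<psi> (\<lambda>_ _. 0)"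
      by (rule exchange_sum_family[OF A(1) root_lattice_0 B(1) root_lattice_0]) (rule z(2))
  next
    fix k l m :: int and \<alpha> \<delta>
    have 1: "exp_int (contraction N \<psi> \<phi>) 1"
      by (rule exp_int_cong[OF exp_int_0]) (simp add: contraction_def A(3))
    have tF: "(\<Sum>n\<le>r. t n * fps_nth F (r - n)) = t' r" for r
      using arg_cong[OF t, of "\<lambda>G. fps_nth G r"] by (simp add: fps_mult_nth atLeast0AtMost)
    have "lookup (\<Sum>n\<le>nat (min (- k) l). t' n *\<^sub>C B (l + (- 1) * int n) (A (k + 1 * int n) (vac \<alpha>))) (0, \<delta>)
       = (\<Sum>n\<le>nat (min (- k) l). if n = nat l then (if l \<ge> 0 \<and> k + l = 0 \<and> \<delta> = \<alpha> then t' n * (\<kappa> \<alpha> * \<kappa>' \<alpha>) else 0) else 0)"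
      unfolding lookup_sum lookup_cscale two_point_fps_coeff[OF B(1) A(1) 1]
      by (intro sum.cong) (auto simp: fps_coeff_1)
    also have "\<dots> = (if l \<ge> 0 \<and> k + l = 0 \<and> \<delta> = \<alpha> then \<kappa> \<alpha> * \<kappa>' \<alpha> * t' (nat l) else 0)"
      by auto
    also have "\<dots> = (if l \<ge> 0 \<and> k + l = 0 \<and> \<delta> = \<alpha> then \<kappa> \<alpha> * \<kappa>' \<alpha> * (\<Sum>n\<le>nat l. t n * fps_nth F (nat l - n)) else 0)"
      by (simp add: tF)
    also have "\<dots> = (\<Sum>n\<le>nat (min (- k) l). if l \<ge> 0 \<and> k + l = 0 \<and> \<delta> = \<alpha> then \<kappa> \<alpha> * \<kappa>' \<alpha> * (t n * fps_nth F (nat l - n)) else 0)"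
    proof (cases "l \<ge> 0 \<and> k + l = 0 \<and> \<delta> = \<alpha>")
      case True
      then have m: "min (- k) l = l" by simp
      show ?thesis unfolding m using True by (simp add: sum_distrib_left)
    qed auto
    also have "\<dots> = lookup (\<Sum>n\<le>nat (min (- k) l). t n *\<^sub>C A (k + 1 * int n) (B (l + (- 1) * int n) (vac \<alpha>))) (0, \<delta>)"
      unfolding lookup_sum lookup_cscale two_point_fps_coeff[OF A(1) B(1) F]
      by (intro sum.cong) (auto simp: fps_coeff_def nat_diff_distrib')
    finally show "lookup (\<Sum>n\<le>nat (min (- k) l). t n *\<^sub>C A (k + 1 * int n) (B (l + (- 1) * int n) (vac \<alpha>))) (0, \<delta>)
      = lookup (\<Sum>n\<le>nat (min (- k) l). t' n *\<^sub>C B (l + (- 1) * int n) (A (k + 1 * int n) (vac \<alpha>))) (0, \<delta>)" ..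
  qed
  then show ?thesis by simp
qed

section \<open>The Cartan currents\<close>

context fock_rep
begin

abbreviation (input) "Ep \<equiv> E_ser N \<epsilon> q p sp d"
abbreviation (input) "Kplus \<equiv> Kp_ser N q sq p sp d"
abbreviation (input) "Kminus \<equiv> Km_ser N q sq p sp d"

text \<open>Half-integral powers of q occur in the Cartan currents. With everything written in
  \<open>sq ^ n\<close>, each contraction below becomes a rational identity in
  \<open>sq ^ n\<close>, \<open>d ^ n\<close> and powers of the positions.\<close>

lemma q_powi_power: "(q powi k) ^ n = (sq ^ n) powi (2 * k)"
proof -
  have "(q powi k) ^ n = ((sq powi 2) powi k) powi int n"
    by (simp add: sq_eq)
  also have "\<dots> = (sq powi int n) powi (2 * k)"
    by (simp only: power_int_mult[symmetric] ac_simps)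
  finally show ?thesis by simp
qed

lemma E_coeff_nat: "E_coeff i a (int n) = (if a = i then pos i ^ n else 0) - (if a = nxt i then inverse ((sq ^ n)\<^sup>2) * pos' i ^ n else 0)"
  "E_coeff i a (- int n) = (if a = i then inverse (pos i ^ n) else 0) - (if a = nxt i then inverse ((sq ^ n)\<^sup>2) * inverse (pos' i ^ n) else 0)"
  using q_powi_power[of 1 n] by (simp_all add: E_coeff_def power_int_minus)

lemma F_coeff_nat: "F_coeff i a (int n) = (if a = i then - ((sq ^ n)\<^sup>2 * pos i ^ n) else 0) - (if a = nxt i then - (pos' i ^ n) else 0)"
  "F_coeff i a (- int n) = (if a = i then - ((sq ^ n)\<^sup>2 * inverse (pos i ^ n)) else 0) - (if a = nxt i then - inverse (pos' i ^ n) else 0)"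
  using q_powi_power[of 1 n] by (simp_all add: F_coeff_def power_int_minus)

lemma Kp_coeff_nat: "n \<ge> 1 \<Longrightarrow> Kp_coeff i a (- int n) =
   (if a = i then (inverse ((sq ^ n)\<^sup>2) - (sq ^ n)\<^sup>2) * sq ^ n * inverse (pos i ^ n) else 0)
   - (if a = nxt i then (inverse ((sq ^ n)\<^sup>2) - (sq ^ n)\<^sup>2) * inverse (sq ^ n) * inverse (pos' i ^ n) else 0)"
  using q_powi_power[of 1 n] by (simp add: Kp_coeff_def power_int_minus algebra_simps)

lemma Km_coeff_nat: "n \<ge> 1 \<Longrightarrow> Km_coeff i a (int n) =
   (if a = i then (inverse ((sq ^ n)\<^sup>2) - (sq ^ n)\<^sup>2) * sq ^ n * pos i ^ n else 0)
   - (if a = nxt i then (inverse ((sq ^ n)\<^sup>2) - (sq ^ n)\<^sup>2) * inverse (sq ^ n) * pos' i ^ n else 0)"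
  using q_powi_power[of 1 n] by (simp add: Km_coeff_def power_int_minus algebra_simps)

lemma pos_nxt_power: "i < N \<Longrightarrow> pos (nxt i) ^ n = d ^ n * pos' i ^ n"
  by (simp add: pos_nxt power_mult_distrib)

lemma node_cases:
  assumes "i < N" "j < N"
  obtains "i = j" "j \<noteq> nxt i" "i \<noteq> nxt j" "cartan N i j = 2" "mcoef N i j = 0"
  | "j = nxt i" "i \<noteq> j" "i \<noteq> nxt j" "cartan N i j = -1" "mcoef N i j = -1"
  | "i = nxt j" "i \<noteq> j" "j \<noteq> nxt i" "cartan N i j = -1" "mcoef N i j = 1"
  | "i \<noteq> j" "j \<noteq> nxt i" "i \<noteq> nxt j" "cartan N i j = 0" "mcoef N i j = 0"
  using nxt_nxt_neq[OF assms(1)] nxt_nxt_neq[OF assms(2)] nxt_neq[OF assms(1)] nxt_neq[OF assms(2)]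
    cartan_eq[OF assms] mcoef_eq[OF assms]
  by (metis (full_types))

text \<open>A difference of two n-th powers is the exponent of a single ratio (1 - uX)/(1 - vX),
  here that of \<theta> with m = -a_ij. The scalar d^(-m_ij) / \<open>sq\<close> is its argument, as
  c acts by \<open>sq\<close>.\<close>

lemma contraction_KpE:
  assumes i: "i < N" and j: "j < N" and n: "n \<ge> 1"
  shows "contraction N (Kp_coeff i) (E_coeff j) n
    = (q powi cartan N i j * (d powi (- mcoef N i j) / sq)) ^ n - (q powi (- cartan N i j) * (d powi (- mcoef N i j) / sq)) ^ n"
proof -
  have eq: "contraction N (Kp_coeff i) (E_coeff j) n = (if i = j then - (u * u') - v * v' else if j = nxt i then v * u'
    else if i = nxt j then u * v' else 0)" if "u = (inverse ((sq ^ n)\<^sup>2) - (sq ^ n)\<^sup>2) * sq ^ n * inverse (pos i ^ n)"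
    "v = (inverse ((sq ^ n)\<^sup>2) - (sq ^ n)\<^sup>2) * inverse (sq ^ n) * inverse (pos' i ^ n)"
    "u' = pos j ^ n" "v' = inverse ((sq ^ n)\<^sup>2) * pos' j ^ n" for u v u' v'
    by (rule contraction_two_terms[OF i j]) (simp_all only: Kp_coeff_nat[OF n] E_coeff_nat that)
  show ?thesis
    unfolding eq[OF refl refl refl refl] power_mult_distrib power_divide q_powi_power
    by (rule node_cases[OF i j]; use pos_nz[of i] pos_nz[of j] pos_nxt_power[OF i, of n] pos_nxt_power[OF j, of n] sq_nz d_nz
       q_powi_power[of 1 n] in \<open>simp add: power_int_minus power_inverse field_simps\<close>) (simp_all add: eval_nat_numeral mult_ac)?
qed

lemma contraction_KpF:
  assumes i: "i < N" and j: "j < N" and n: "n \<ge> 1"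
  shows "contraction N (Kp_coeff i) (F_coeff j) n
    = (q powi (- cartan N i j) * (d powi (- mcoef N i j) * sq)) ^ n - (q powi cartan N i j * (d powi (- mcoef N i j) * sq)) ^ n"
proof -
  have eq: "contraction N (Kp_coeff i) (F_coeff j) n = (if i = j then - (u * u') - v * v' else if j = nxt i then v * u'
    else if i = nxt j then u * v' else 0)" if "u = (inverse ((sq ^ n)\<^sup>2) - (sq ^ n)\<^sup>2) * sq ^ n * inverse (pos i ^ n)"
    "v = (inverse ((sq ^ n)\<^sup>2) - (sq ^ n)\<^sup>2) * inverse (sq ^ n) * inverse (pos' i ^ n)"
    "u' = - ((sq ^ n)\<^sup>2 * pos j ^ n)" "v' = - (pos' j ^ n)" for u v u' v'
    by (rule contraction_two_terms[OF i j]) (simp_all only: Kp_coeff_nat[OF n] F_coeff_nat that)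
  show ?thesis
    unfolding eq[OF refl refl refl refl] power_mult_distrib power_divide q_powi_power
    by (rule node_cases[OF i j]; use pos_nz[of i] pos_nz[of j] pos_nxt_power[OF i, of n] pos_nxt_power[OF j, of n] sq_nz d_nz
       q_powi_power[of 1 n] in \<open>simp add: power_int_minus power_inverse field_simps\<close>) (simp_all add: eval_nat_numeral mult_ac)?
qed

lemma contraction_EKm:
  assumes i: "i < N" and j: "j < N" and n: "n \<ge> 1"
  shows "contraction N (E_coeff j) (Km_coeff i) n
    = (q powi cartan N i j * (d powi mcoef N i j / sq)) ^ n - (q powi (- cartan N i j) * (d powi mcoef N i j / sq)) ^ n"
proof -
  have eq: "contraction N (E_coeff j) (Km_coeff i) n = (if j = i then - (u * u') - v * v' else if i = nxt j then v * u'
    else if j = nxt i then u * v' else 0)" if "u = inverse (pos j ^ n)"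
    "v = inverse ((sq ^ n)\<^sup>2) * inverse (pos' j ^ n)"
    "u' = (inverse ((sq ^ n)\<^sup>2) - (sq ^ n)\<^sup>2) * sq ^ n * pos i ^ n" "v' = (inverse ((sq ^ n)\<^sup>2) - (sq ^ n)\<^sup>2) * inverse (sq ^ n) * pos' i ^ n" for u v u' v'
    by (rule contraction_two_terms[OF j i]) (simp_all only: Km_coeff_nat[OF n] E_coeff_nat that)
  show ?thesis
    unfolding eq[OF refl refl refl refl] power_mult_distrib power_divide q_powi_power
    by (rule node_cases[OF i j]; use pos_nz[of i] pos_nz[of j] pos_nxt_power[OF i, of n] pos_nxt_power[OF j, of n] sq_nz d_nz
       q_powi_power[of 1 n] in \<open>simp add: power_int_minus power_inverse field_simps\<close>) (simp_all add: eval_nat_numeral mult_ac)?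
qed

lemma contraction_FKm:
  assumes i: "i < N" and j: "j < N" and n: "n \<ge> 1"
  shows "contraction N (F_coeff j) (Km_coeff i) n
    = (q powi (- cartan N i j) * (d powi mcoef N i j * sq)) ^ n - (q powi cartan N i j * (d powi mcoef N i j * sq)) ^ n"
proof -
  have eq: "contraction N (F_coeff j) (Km_coeff i) n = (if j = i then - (u * u') - v * v' else if i = nxt j then v * u'
    else if j = nxt i then u * v' else 0)" if "u = - ((sq ^ n)\<^sup>2 * inverse (pos j ^ n))"
    "v = - inverse (pos' j ^ n)"
    "u' = (inverse ((sq ^ n)\<^sup>2) - (sq ^ n)\<^sup>2) * sq ^ n * pos i ^ n" "v' = (inverse ((sq ^ n)\<^sup>2) - (sq ^ n)\<^sup>2) * inverse (sq ^ n) * pos' i ^ n" for u v u' v'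
    by (rule contraction_two_terms[OF j i]) (simp_all only: Km_coeff_nat[OF n] F_coeff_nat that)
  show ?thesis
    unfolding eq[OF refl refl refl refl] power_mult_distrib power_divide q_powi_power
    by (rule node_cases[OF i j]; use pos_nz[of i] pos_nz[of j] pos_nxt_power[OF i, of n] pos_nxt_power[OF j, of n] sq_nz d_nz
       q_powi_power[of 1 n] in \<open>simp add: power_int_minus power_inverse field_simps\<close>) (simp_all add: eval_nat_numeral mult_ac)?
qed

text \<open>The two differences belong to the arguments with c^(-2) = 1/q and c^2 = q. Writing q as
  \<open>q powi 1\<close> lets \<open>q_powi_power\<close> rewrite its n-th power.\<close>

lemma contraction_KpKm:
  assumes i: "i < N" and j: "j < N" and n: "n \<ge> 1"
  shows "contraction N (Kp_coeff i) (Km_coeff j) n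
    = ((q powi cartan N i j * (d powi (- mcoef N i j) / q powi 1)) ^ n - (q powi (- cartan N i j) * (d powi (- mcoef N i j) / q powi 1)) ^ n)
      + ((q powi (- cartan N i j) * (d powi (- mcoef N i j) * q powi 1)) ^ n - (q powi cartan N i j * (d powi (- mcoef N i j) * q powi 1)) ^ n)"
proof -
  have eq: "contraction N (Kp_coeff i) (Km_coeff j) n = (if i = j then - (u * u') - v * v' else if j = nxt i then v * u'
    else if i = nxt j then u * v' else 0)" if "u = (inverse ((sq ^ n)\<^sup>2) - (sq ^ n)\<^sup>2) * sq ^ n * inverse (pos i ^ n)"
    "v = (inverse ((sq ^ n)\<^sup>2) - (sq ^ n)\<^sup>2) * inverse (sq ^ n) * inverse (pos' i ^ n)"
    "u' = (inverse ((sq ^ n)\<^sup>2) - (sq ^ n)\<^sup>2) * sq ^ n * pos j ^ n" "v' = (inverse ((sq ^ n)\<^sup>2) - (sq ^ n)\<^sup>2) * inverse (sq ^ n) * pos' j ^ n" for u v u' v'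
    by (rule contraction_two_terms[OF i j]) (simp_all only: Kp_coeff_nat[OF n] Km_coeff_nat[OF n] that)
  show ?thesis
    unfolding eq[OF refl refl refl refl] power_mult_distrib power_divide q_powi_power
    by (rule node_cases[OF i j]; use pos_nz[of i] pos_nz[of j] pos_nxt_power[OF i, of n] pos_nxt_power[OF j, of n] sq_nz d_nz
       q_powi_power[of 1 n] in \<open>simp add: power_int_minus power_inverse field_simps\<close>) (simp_all add: eval_nat_numeral mult_ac)?
qed

text \<open>At equal nodes the series is 1/((1 - qX)(1 - q^(-1) X)), whose two poles produce the two
  delta terms of the commutator. Along an edge it is the polynomial 1 - dX or 1 - d^(-1) X, and E
  and F commute.\<close>

lemma contraction_EF:
  assumes i: "i < N" and j: "j < N" and n: "n \<ge> 1"
  shows "contraction N (E_coeff i) (F_coeff j) n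
    = (if i = j then q ^ n + inverse q ^ n else if j = nxt i then - (d ^ n) else if i = nxt j then - (inverse d ^ n) else 0)"
proof -
  have eq: "contraction N (E_coeff i) (F_coeff j) n = (if i = j then - (u * u') - v * v' else if j = nxt i then v * u'
    else if i = nxt j then u * v' else 0)" if "u = inverse (pos i ^ n)"
    "v = inverse ((sq ^ n)\<^sup>2) * inverse (pos' i ^ n)"
    "u' = - ((sq ^ n)\<^sup>2 * pos j ^ n)" "v' = - (pos' j ^ n)" for u v u' v'
    by (rule contraction_two_terms[OF i j]) (simp_all only: E_coeff_nat F_coeff_nat that)
  show ?thesis
    unfolding eq[OF refl refl refl refl] power_mult_distrib power_divide q_powi_power
    by (rule node_cases[OF i j]; use pos_nz[of i] pos_nz[of j] pos_nxt_power[OF i, of n] pos_nxt_power[OF j, of n] sq_nz d_nz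
       q_powi_power[of 1 n] in \<open>simp add: power_int_minus power_inverse field_simps\<close>) (simp_all add: eval_nat_numeral mult_ac)?
qed

lemma contraction_FE:
  assumes i: "i < N" and j: "j < N" and n: "n \<ge> 1"
  shows "contraction N (F_coeff i) (E_coeff j) n
    = (if i = j then q ^ n + inverse q ^ n else if j = nxt i then - (d ^ n) else if i = nxt j then - (inverse d ^ n) else 0)"
proof -
  have eq: "contraction N (F_coeff i) (E_coeff j) n = (if i = j then - (u * u') - v * v' else if j = nxt i then v * u'
    else if i = nxt j then u * v' else 0)" if "u = - ((sq ^ n)\<^sup>2 * inverse (pos i ^ n))"
    "v = - inverse (pos' i ^ n)"
    "u' = pos j ^ n" "v' = inverse ((sq ^ n)\<^sup>2) * pos' j ^ n" for u v u' v'
    by (rule contraction_two_terms[OF i j]) (simp_all only: E_coeff_nat F_coeff_nat that)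
  show ?thesis
    unfolding eq[OF refl refl refl refl] power_mult_distrib power_divide q_powi_power
    by (rule node_cases[OF i j]; use pos_nz[of i] pos_nz[of j] pos_nxt_power[OF i, of n] pos_nxt_power[OF j, of n] sq_nz d_nz
       q_powi_power[of 1 n] in \<open>simp add: power_int_minus power_inverse field_simps\<close>) (simp_all add: eval_nat_numeral mult_ac)?
qed

end

text \<open>A delta function times a series in one variable has, at the indices (k, l), the
  coefficient c^(l-k) times that of A at k + l. The condition on \<phi> splits the covariance of A
  into contributions of the two variables; it puts the right-hand side of the commutator on a par
  with products E F.\<close>

lemma heis_family_diagonal:
  assumes A: "vertex_series N A \<phi> f \<beta>" "\<beta> \<in> root_lattice N" and c: "c \<noteq> 0"
    and \<phi>: "\<And>a n. a < N \<Longrightarrow> n \<noteq> 0 \<Longrightarrow> \<phi> a n = \<psi> a n * c powi n + \<chi> a n * c powi (- n)"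
  shows "heis_family N (\<lambda>k l m v. c powi (l - k) *\<^sub>C A (k + l) v) \<psi> \<chi> (\<lambda>_ _. 0)"
proof (rule heis_familyI)
  fix a n k l m v
  assume an: "a < N" "n \<noteq> (0::int)"
  have e: "c powi (l - (k - n)) = c powi (l - k) * c powi n" "c powi (l - n - k) = c powi (l - k) * c powi (- n)"
    using c power_int_add[of c "l - k" n] power_int_add[of c "l - k" "- n"] by (simp_all add: algebra_simps)
  have e': "k - n + l = k + l - n" "k + (l - n) = k + l - n" by simp_all
  show "heis N (int a) n (c powi (l - k) *\<^sub>C A (k + l) v) = c powi (l - k) *\<^sub>C A (k + l) (heis N (int a) n v)
     + \<psi> a n *\<^sub>C c powi (l - (k - n)) *\<^sub>C A (k - n + l) v + \<chi> a n *\<^sub>C c powi (l - n - k) *\<^sub>C A (k + (l - n)) v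
     + 0 *\<^sub>C c powi (l - k) *\<^sub>C A (k + l) v"
    unfolding e e' by (simp add: lin_cscale[OF lin_heis] vertex_seriesD(4)[OF A(1) an] cscale_add \<phi>[OF an]
      cscale_add_left distrib_left mult_ac)
qed (simp_all add: lin_scale vertex_seriesD(1)[OF A(1)] VQ_cscale vertex_series_VQ[OF A])

text \<open>The coefficients of 1/((1 - qX)(1 - q^(-1) X)) are the q-integers. The first term is
  nonzero only for z > 0 and the second only for z < 0, so the antisymmetric combination is the
  q-integer of z for every integer z.\<close>

lemma fps_coeff_quantum:
  fixes q :: complex
  assumes q: "q \<noteq> 0" "q\<^sup>2 \<noteq> 1"
  shows "fps_coeff (geom q * geom (inverse q)) (z - 1) - fps_coeff (geom q * geom (inverse q)) (- z - 1)
    = (q powi z - q powi (- z)) / (q - inverse q)"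
proof -
  let ?G = "geom q * geom (inverse q)"
  have n: "q - inverse q \<noteq> 0" using q by (simp add: field_simps power2_eq_square)
  \<comment> \<open>Partial fractions of the product of the two geometric series, multiplied by q -
    q^(-1).\<close>
  have "fps_const q * geom q - fps_const (inverse q) * geom (inverse q) = fps_const (q - inverse q) * ?G"
  proof -
    have "fps_const q * geom q = fps_const q * geom q * (geom (inverse q) * (1 - fps_const (inverse q) * fps_X))"
      unfolding geom_mult by simp
    moreover have "fps_const (inverse q) * geom (inverse q)
        = fps_const (inverse q) * geom (inverse q) * (geom q * (1 - fps_const q * fps_X))"
      unfolding geom_mult by simp
    moreover have "fps_const q * g * (g' * (1 - fps_const (inverse q) * fps_X))
        - fps_const (inverse q) * g' * (g * (1 - fps_const q * fps_X)) = fps_const (q - inverse q) * (g * g')" for g g'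
    proof -
      have "c * g * (g' * (1 - c' * x)) - c' * g' * (g * (1 - c * x)) = (c - c') * (g * g')"
        for c c' x :: "complex fps" by (simp add: algebra_simps)
      then show ?thesis by (simp flip: fps_const_sub)
    qed
    ultimately show ?thesis by metis
  qed
  then have "fps_nth (fps_const q * geom q - fps_const (inverse q) * geom (inverse q)) r = fps_nth (fps_const (q - inverse q) * ?G) r" for r
    by simp
  then have G: "fps_nth ?G r = (q ^ Suc r - inverse q ^ Suc r) / (q - inverse q)" for r
    using n by (simp add: geom_def nonzero_eq_divide_eq mult.commute)
  consider "z > 0" | "z = 0" | "z < 0" by linarith
  then show ?thesis
  proof cases
    case 1
    then have "Suc (nat (z - 1)) = nat z" by simp
    with 1 show ?thesis by (simp add: fps_coeff_def G power_int_def power_inverse del: power_Suc)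
  next
    case 3
    then have "Suc (nat (- z - 1)) = nat (- z)" by simp
    with 3 show ?thesis by (simp add: fps_coeff_def G power_int_def power_inverse diff_divide_distrib del: power_Suc)
  qed (simp add: fps_coeff_def)
qed

section \<open>The Cartan relations and the commutators of E and F\<close>

context fock_rep
begin

lemma q_diff_nz: "q - inverse q \<noteq> 0" and q2: "q\<^sup>2 \<noteq> 1"
  using q_gen[rule_format, of 2] q_nz by (auto simp: field_simps power2_eq_square)

lemma Kp_coeff_pos: "n > 0 \<Longrightarrow> Kp_coeff i a n = 0" and Km_coeff_neg: "n < 0 \<Longrightarrow> Km_coeff i a n = 0"
  by (simp_all add: Kp_coeff_def Km_coeff_def)

lemma q_powi_lform_add:
  "i < N \<Longrightarrow> j < N \<Longrightarrow> q powi lform (simple_root i) (\<alpha> + simple_root j) = q powi cartan N i j * q powi lform (simple_root i) \<alpha>"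
  "i < N \<Longrightarrow> j < N \<Longrightarrow> q powi lform (simple_root i) (\<alpha> + - simple_root j) = q powi (- cartan N i j) * q powi lform (simple_root i) \<alpha>"
  "i < N \<Longrightarrow> j < N \<Longrightarrow> q powi (- lform (simple_root i) (\<alpha> + simple_root j)) = q powi (- cartan N i j) * q powi (- lform (simple_root i) \<alpha>)"
  "i < N \<Longrightarrow> j < N \<Longrightarrow> q powi (- lform (simple_root i) (\<alpha> + - simple_root j)) = q powi cartan N i j * q powi (- lform (simple_root i) \<alpha>)"
  by (simp_all only: lform_add_right lform_uminus_right lform_simple_roots minus_add_distrib minus_minus
    power_int_add[OF disjI1[OF q_nz]] mult.commute)

lemma theta_scaled: "fps_nth (theta q m) n * x ^ n * y ^ n
    = q powi (- m) * fps_nth (ratio_fps (q powi m * (x * y)) (q powi (- m) * (x * y))) n"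
  unfolding theta_nth[symmetric] by (simp add: power_mult_distrib)

lemma Kp_E:
  assumes i: "i < N" and j: "j < N" and v: "v \<in> VQ N"
  shows "Kplus i (- int r) (Ep j l v) = (\<Sum>n\<le>r. (fps_nth (theta q (- cartan N i j)) n * (d powi (- mcoef N i j)) ^ n * inverse sq ^ n) *\<^sub>C
     Ep j (l - int n) (Kplus i (- int r + int n) v))"
proof -
  let ?w = "d powi (- mcoef N i j) / sq" and ?t = "\<lambda>n. fps_nth (theta q (- cartan N i j)) n * (d powi (- mcoef N i j)) ^ n * inverse sq ^ n"
  have "?t n = q powi cartan N i j * fps_nth (ratio_fps (q powi (- cartan N i j) * ?w) (q powi cartan N i j * ?w)) n" for n
    unfolding theta_scaled by (simp add: divide_inverse)
  from exchange_plus[OF vertex_op_Kp[OF i] K_zero(1)[OF i] Kp_coeff_pos vertex_op_E[OF j] simple_root_in[OF j]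
    exp_int_cong[OF exp_int_ratio contraction_KpE[OF i j, symmetric]] q_powi_lform_add(1)[OF i j] this v, where k = "- int r" and l = l]
  show ?thesis by simp
qed

lemma Kp_F:
  assumes i: "i < N" and j: "j < N" and v: "v \<in> VQ N"
  shows "Kplus i (- int r) (F_op j l v) = (\<Sum>n\<le>r. (fps_nth (theta q (cartan N i j)) n * (d powi (- mcoef N i j)) ^ n * sq ^ n) *\<^sub>C
     F_op j (l - int n) (Kplus i (- int r + int n) v))"
proof -
  let ?w = "d powi (- mcoef N i j) * sq" and ?t = "\<lambda>n. fps_nth (theta q (cartan N i j)) n * (d powi (- mcoef N i j)) ^ n * sq ^ n"
  have "?t n = q powi (- cartan N i j) * fps_nth (ratio_fps (q powi cartan N i j * ?w) (q powi (- cartan N i j) * ?w)) n" for n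
    unfolding theta_scaled by (simp add: divide_inverse)
  from exchange_plus[OF vertex_op_Kp[OF i] K_zero(1)[OF i] Kp_coeff_pos vertex_op_F[OF j] root_lattice_uminus[OF simple_root_in[OF j]]
    exp_int_cong[OF exp_int_ratio contraction_KpF[OF i j, symmetric]] q_powi_lform_add(2)[OF i j] this v, where k = "- int r" and l = l]
  show ?thesis by simp
qed

lemma Km_E:
  assumes i: "i < N" and j: "j < N" and v: "v \<in> VQ N"
  shows "Kminus i (int r) (Ep j l v) = (\<Sum>n\<le>r. (fps_nth (theta q (cartan N i j)) n * (d powi mcoef N i j) ^ n * inverse sq ^ n) *\<^sub>C
     Ep j (l + int n) (Kminus i (int r - int n) v))"
proof -
  let ?w = "d powi mcoef N i j / sq" and ?t = "\<lambda>n. fps_nth (theta q (cartan N i j)) n * (d powi mcoef N i j) ^ n * inverse sq ^ n"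
  let ?R = "ratio_fps (q powi (- cartan N i j) * ?w) (q powi cartan N i j * ?w)"
  have "Abs_fps ?t = fps_const (q powi (- cartan N i j)) * ratio_fps (q powi cartan N i j * ?w) (q powi (- cartan N i j) * ?w)"
    unfolding theta_scaled by (rule fps_ext) (simp add: divide_inverse)
  then have "Abs_fps ?t * ?R = fps_const (q powi (- cartan N i j))"
    by (simp add: mult.assoc ratio_fps_inverse)
  from exchange_minus[OF vertex_op_Km[OF i] K_zero(2)[OF i] Km_coeff_neg vertex_op_E[OF j] simple_root_in[OF j]
    exp_int_cong[OF exp_int_ratio contraction_EKm[OF i j, symmetric]] q_powi_lform_add(3)[OF i j] this v, where k = "int r" and l = l]
  show ?thesis by simp
qed

lemma Km_F:
  assumes i: "i < N" and j: "j < N" and v: "v \<in> VQ N"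
  shows "Kminus i (int r) (F_op j l v) = (\<Sum>n\<le>r. (fps_nth (theta q (- cartan N i j)) n * (d powi mcoef N i j) ^ n * sq ^ n) *\<^sub>C
     F_op j (l + int n) (Kminus i (int r - int n) v))"
proof -
  let ?w = "d powi mcoef N i j * sq" and ?t = "\<lambda>n. fps_nth (theta q (- cartan N i j)) n * (d powi mcoef N i j) ^ n * sq ^ n"
  let ?R = "ratio_fps (q powi cartan N i j * ?w) (q powi (- cartan N i j) * ?w)"
  have "Abs_fps ?t = fps_const (q powi cartan N i j) * ratio_fps (q powi (- cartan N i j) * ?w) (q powi cartan N i j * ?w)"
    unfolding theta_scaled by (rule fps_ext) simp
  then have "Abs_fps ?t * ?R = fps_const (q powi cartan N i j)"
    by (simp add: mult.assoc ratio_fps_inverse)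
  from exchange_minus[OF vertex_op_Km[OF i] K_zero(2)[OF i] Km_coeff_neg vertex_op_F[OF j] root_lattice_uminus[OF simple_root_in[OF j]]
    exp_int_cong[OF exp_int_ratio contraction_FKm[OF i j, symmetric]] q_powi_lform_add(4)[OF i j] this v, where k = "int r" and l = l]
  show ?thesis by simp
qed

lemma Kp_Km:
  assumes i: "i < N" and j: "j < N" and v: "v \<in> VQ N"
  shows "(\<Sum>n\<le>min r s. (fps_nth (theta q (- cartan N i j)) n * (d powi (- mcoef N i j)) ^ n * q ^ n) *\<^sub>C
     Kplus i (- int r + int n) (Kminus j (int s - int n) v))
   = (\<Sum>n\<le>min r s. (fps_nth (theta q (- cartan N i j)) n * (d powi (- mcoef N i j)) ^ n * inverse q ^ n) *\<^sub>C
     Kminus j (int s - int n) (Kplus i (- int r + int n) v))"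
proof -
  let ?w = "d powi (- mcoef N i j)" and ?a = "q powi cartan N i j" and ?b = "q powi (- cartan N i j)"
  let ?t = "\<lambda>n. fps_nth (theta q (- cartan N i j)) n * ?w ^ n * q ^ n"
    and ?t' = "\<lambda>n. fps_nth (theta q (- cartan N i j)) n * ?w ^ n * inverse q ^ n"
  have t: "Abs_fps ?t = fps_const ?a * ratio_fps (?b * (?w * q)) (?a * (?w * q))"
    unfolding theta_scaled by (rule fps_ext) simp
  have t': "Abs_fps ?t' = fps_const ?a * ratio_fps (?b * (?w * inverse q)) (?a * (?w * inverse q))"
    unfolding theta_scaled by (rule fps_ext) simp
  let ?R1 = "ratio_fps (?b * (?w / q powi 1)) (?a * (?w / q powi 1))"
    and ?R2 = "ratio_fps (?a * (?w * q powi 1)) (?b * (?w * q powi 1))"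
  have "c * r * (r' * r'') = c * r' * (r * r'')" for c r r' r'' :: "complex fps" by (simp add: ac_simps)
  from this[of "fps_const ?a" "ratio_fps (?b * (?w * q)) (?a * (?w * q))" ?R1 ?R2]
  have "Abs_fps ?t * (?R1 * ?R2) = Abs_fps ?t'"
    unfolding t t' by (simp add: ratio_fps_inverse divide_inverse)
  from exchange_plus_minus[OF vertex_op_Kp[OF i] K_zero(1)[OF i] Kp_coeff_pos vertex_op_Km[OF j] K_zero(2)[OF j]
    exp_int_cong[OF exp_int_mult[OF exp_int_ratio exp_int_ratio] contraction_KpKm[OF i j, symmetric]] this v,
    where k = "- int r" and l = "int s"]
  have "(\<Sum>n\<le>nat (min (- (- int r)) (int s)). ?t n *\<^sub>C Kplus i (- int r + int n) (Kminus j (int s - int n) v))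
     = (\<Sum>n\<le>nat (min (- (- int r)) (int s)). ?t' n *\<^sub>C Kminus j (int s - int n) (Kplus i (- int r + int n) v))" .
  moreover have "nat (min (- (- int r)) (int s)) = min r s" by (simp add: min_def)
  ultimately show ?thesis by simp
qed

lemma commute_trivial_contraction:
  assumes A: "vertex_op N A \<phi> (\<lambda>_. 0) 0 \<kappa>" and B: "vertex_op N B \<psi> (\<lambda>_. 0) 0 \<kappa>'"
    and c: "\<And>n. n \<ge> 1 \<Longrightarrow> contraction N \<phi> \<psi> n = 0 \<and> contraction N \<psi> \<phi> n = 0"
    and v: "v \<in> VQ N"
  shows "A k (B l v) = B l (A k v)"
proof -
  have 1: "exp_int (contraction N \<phi> \<psi>) 1" "exp_int (contraction N \<psi> \<phi>) 1"
    by (rule exp_int_cong[OF exp_int_0], simp add: c)+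
  note fam = heis_family_comp2[OF vertex_opD(1)[OF A] root_lattice_0 vertex_opD(1)[OF B] root_lattice_0]
    heis_family_swap12[OF heis_family_comp2[OF vertex_opD(1)[OF B] root_lattice_0 vertex_opD(1)[OF A] root_lattice_0]]
  show ?thesis
    by (rule heis_family_eqI[OF fam _ v]) (auto simp: two_point_fps_coeff[OF A B 1(1)] two_point_fps_coeff[OF B A 1(2)] fps_coeff_1)
qed

lemma Kp_Kp:
  assumes i: "i < N" and j: "j < N" and v: "v \<in> VQ N"
  shows "Kplus i k (Kplus j l v) = Kplus j l (Kplus i k v)"
  by (rule commute_trivial_contraction[OF vertex_op_Kp[OF i] vertex_op_Kp[OF j] _ v]) (simp_all add: Kp_coeff_pos contraction_def)

lemma Km_Km:
  assumes i: "i < N" and j: "j < N" and v: "v \<in> VQ N"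
  shows "Kminus i k (Kminus j l v) = Kminus j l (Kminus i k v)"
  by (rule commute_trivial_contraction[OF vertex_op_Km[OF i] vertex_op_Km[OF j] _ v]) (simp_all add: Km_coeff_neg contraction_def)

lemma E_char_uminus: "i < N \<Longrightarrow> \<alpha> \<in> root_lattice N \<Longrightarrow> E_char i (- \<alpha>) * E_char i \<alpha> = 1"
  using E_char_add[of i "- \<alpha>" \<alpha>] by (simp add: root_lattice_uminus) (simp add: E_char_def cocycle_0 simple_root_in)

text \<open>The positions cancel against the normalization, and \<epsilon>(\<alpha>, -\<alpha>) = -1
  remains. \<open>F_op\<close> carries the opposite sign to compensate for it.\<close>

lemma E_char_self: "i < N \<Longrightarrow> norm_const i * norm_const i * E_char i (- simple_root i) = -1"
  using nxt_neq[of i] nxt_less[of i] cocycle_uminus(2)[of "simple_root i" "simple_root i"] cocycle_root[of i] simple_root_in[of i] sp_nz pos_nz(2)[of i]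
  by (auto simp: E_char_def lookup_simple_root norm_const_def pos_def pos'_def power_int_minus field_simps)

text \<open>The two orders give the same Laurent polynomial of at most two terms: G' is G with its
  coefficients reversed up to a scalar, and the lattice factors supply that scalar.\<close>

lemma E_F_commute:
  assumes i: "i < N" and j: "j < N" and ij: "i \<noteq> j" and v: "v \<in> VQ N"
  shows "Ep i k (F_op j l v) = F_op j l (Ep i k v)"
proof -
  define G where "G = (if j = nxt i then 1 - fps_const d * fps_X else if i = nxt j then 1 - fps_const (inverse d) * fps_X else 1)"
  define G' where "G' = (if j = nxt i then 1 - fps_const (inverse d) * fps_X else if i = nxt j then 1 - fps_const d * fps_X else 1)"
  have "exp_int (\<lambda>n. if i = j then q ^ n + inverse q ^ n else if j = nxt i then - (d ^ n) else if i = nxt j then - (inverse d ^ n) else 0) G"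
    using exp_int_one_minus exp_int_0 ij by (auto simp: G_def)
  then have G: "exp_int (contraction N (E_coeff i) (F_coeff j)) G"
    by (rule exp_int_cong) (rule contraction_EF[OF i j, symmetric])
  have "exp_int (\<lambda>n. if j = i then q ^ n + inverse q ^ n else if i = nxt j then - (d ^ n) else if j = nxt i then - (inverse d ^ n) else 0) G'"
    using exp_int_one_minus exp_int_0 ij nxt_nxt_neq[OF i] by (auto simp: G'_def)
  then have G': "exp_int (contraction N (F_coeff j) (E_coeff i)) G'"
    by (rule exp_int_cong) (rule contraction_FE[OF j i, symmetric])
  note fam = heis_family_comp2[OF vertex_opD(1)[OF vertex_op_E[OF i]] simple_root_in[OF i]
      vertex_opD(1)[OF vertex_op_F[OF j]] root_lattice_uminus[OF simple_root_in[OF j]]]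
    heis_family_swap12[OF heis_family_comp2[OF vertex_opD(1)[OF vertex_op_F[OF j]] root_lattice_uminus[OF simple_root_in[OF j]]
      vertex_opD(1)[OF vertex_op_E[OF i]] simple_root_in[OF i]]]
  have sym: "cartan N j i = cartan N i j" using i j by (auto simp: cartan_eq)
  show ?thesis
  proof (rule heis_family_eqI[OF fam _ v])
    fix k l m :: int and \<alpha> \<gamma>
    assume \<alpha>: "\<alpha> \<in> root_lattice N"
    let ?s = "lform (simple_root i) \<alpha>" and ?t = "lform (simple_root j) \<alpha>"
    define x where "x = l + ?t - 1"
    define C where "C \<longleftrightarrow> k + l = ?s - ?t - cartan N i j + 2 \<and> \<gamma> = \<alpha> + simple_root i - simple_root j"
    have k: "fps_coeff G' (k - (?s + 1)) = fps_coeff G' (- cartan N i j - x)" if C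
      by (rule arg_cong[where f = "fps_coeff G'"]) (use that in \<open>simp add: C_def x_def\<close>)
    have x: "l - (- ?t + 1) = x" by (simp add: x_def)
    let ?c = "norm_const i * norm_const j * E_char i \<alpha> * F_char j \<alpha>"
    have cond: "k + l = - ?t + 1 + (lform (simple_root i) (\<alpha> + - simple_root j) + 1) \<and> \<gamma> = \<alpha> + - simple_root j + simple_root i \<longleftrightarrow> C"
      "l + k = ?s + 1 + (- lform (simple_root j) (\<alpha> + simple_root i) + 1) \<and> \<gamma> = \<alpha> + simple_root i + - simple_root j \<longleftrightarrow> C"
      unfolding C_def lform_add_right lform_uminus_right lform_simple_roots[OF i j] lform_simple_roots[OF j i] sym
      by (auto simp: algebra_simps)
    have L: "lookup (Ep i k (F_op j l (vac \<alpha>))) (0, \<gamma>) = (if C then - ?c * (E_char i (- simple_root j) * fps_coeff G x) else 0)"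
      unfolding two_point_fps_coeff[OF vertex_op_E[OF i] vertex_op_F[OF j] G] cond x
        E.ch_add[OF i \<alpha> root_lattice_uminus[OF simple_root_in[OF j]]] by simp
    have R: "lookup (F_op j l (Ep i k (vac \<alpha>))) (0, \<gamma>) = (if C then - ?c * (F_char j (simple_root i) * fps_coeff G' (- cartan N i j - x)) else 0)"
      unfolding two_point_fps_coeff[OF vertex_op_F[OF j] vertex_op_E[OF i] G'] cond
        F.ch_add[OF j \<alpha> simple_root_in[OF i]] by (simp add: k)
    have "E_char i (- simple_root j) * fps_coeff G x = F_char j (simple_root i) * fps_coeff G' (- cartan N i j - x)"
    proof -
      define e where "e = E_char i (simple_root j)"
      have e1: "E_char i (- simple_root j) * e = 1"
        unfolding e_def by (rule E_char_uminus[OF i simple_root_in[OF j]])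
      then have e0: "e \<noteq> 0" by auto
      have e: "e \<noteq> 0" "E_char i (- simple_root j) = 1 / e"
        using e0 e1 by (simp_all only: nonzero_eq_divide_eq[OF e0] simp_thms)
      have e': "F_char j (simple_root i) * ((if j = nxt i then - (1 / d) else if i = nxt j then - d else 1) * e) = 1"
        using E_char_uminus[OF j simple_root_in[OF i]] F_char_eq[OF j simple_root_in[OF i]] E_char_root[OF i j ij]
        by (simp only: e_def)
      consider (a) "j = nxt i" "i \<noteq> nxt j" "cartan N i j = -1" | (b) "i = nxt j" "j \<noteq> nxt i" "cartan N i j = -1"
        | (c) "j \<noteq> nxt i" "i \<noteq> nxt j" "cartan N i j = 0"
        using node_cases[OF i j] ij by metis
      then show ?thesis
      proof cases
        case a
        have "F_char j (simple_root i) = (F_char j (simple_root i) * (- (1 / d) * e)) * (- d / e)"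
          using e d_nz by simp
        then have "F_char j (simple_root i) = - d / e"
          unfolding e'[unfolded if_P[OF a(1)]] by simp
        with a e d_nz show ?thesis
          by (simp add: G_def G'_def fps_coeff_def nat_eq_iff) (auto simp: field_simps nat_eq_iff fps_X_nth)
      next
        case b
        have "F_char j (simple_root i) = (F_char j (simple_root i) * (- d * e)) * (- (1 / d) / e)"
          using e d_nz by simp
        then have "F_char j (simple_root i) = - (1 / d) / e"
          unfolding e'[unfolded if_not_P[OF b(2)] if_P[OF b(1)]] by simp
        with b e d_nz show ?thesis
          by (simp add: G_def G'_def fps_coeff_def nat_eq_iff) (auto simp: field_simps nat_eq_iff fps_X_nth)
      next
        case c
        then have "F_char j (simple_root i) = 1 / e" using e' e by (simp add: field_simps)
        with c e show ?thesis
          by (auto simp: G_def G'_def fps_coeff_1)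
      qed
    qed
    then show "lookup (Ep i k (F_op j l (vac \<alpha>))) (0, \<gamma>) = lookup (F_op j l (Ep i k (vac \<alpha>))) (0, \<gamma>)"
      unfolding L R by simp
  qed
qed

text \<open>Both sides have the covariance of E F, because \<open>Kp_coeff i a n\<close> is
  \<open>E_coeff i a n\<close> times \<open>sq powi n\<close> plus \<open>F_coeff i a n\<close>
  times \<open>sq powi (- n)\<close>, and likewise for \<open>Km_coeff\<close> with
  \<open>sq\<close> inverted. On vacua the difference of the two orders is the q-integer of
  \<open>fps_coeff_quantum\<close>.\<close>

lemma E_F_commutator:
  assumes i: "i < N" and v: "v \<in> VQ N"
  shows "Ep i k (F_op i l v) - F_op i l (Ep i k v)
    = (1 / (q - inverse q)) *\<^sub>C (sq powi (l - k) *\<^sub>C Kplus i (k + l) v - sq powi (k - l) *\<^sub>C Kminus i (k + l) v)"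
proof -
  let ?G = "geom q * geom (inverse q)"
  have "exp_int (\<lambda>n. if i = i then q ^ n + inverse q ^ n else if i = nxt i then - (d ^ n) else if i = nxt i then - (inverse d ^ n) else 0) ?G"
    using exp_int_mult[OF exp_int_geom exp_int_geom] by simp
  then have G: "exp_int (contraction N (E_coeff i) (F_coeff i)) ?G" "exp_int (contraction N (F_coeff i) (E_coeff i)) ?G"
    using contraction_EF[OF i i] contraction_FE[OF i i] by (auto elim!: exp_int_cong)
  note mi = root_lattice_uminus[OF simple_root_in[OF i]]
  note fam1 = heis_family_diff[OF heis_family_comp2[OF vertex_opD(1)[OF vertex_op_E[OF i]] simple_root_in[OF i] vertex_opD(1)[OF vertex_op_F[OF i]] mi]
    heis_family_swap12[OF heis_family_comp2[OF vertex_opD(1)[OF vertex_op_F[OF i]] mi vertex_opD(1)[OF vertex_op_E[OF i]] simple_root_in[OF i]]]]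
  have isq: "inverse sq \<noteq> 0" using sq_nz by simp
  have q': "q powi x = sq powi x * sq powi x" for x
    by (simp add: sq_eq[symmetric] power2_eq_square power_int_mult_distrib)
  have famp: "heis_family N (\<lambda>k l m v. sq powi (l - k) *\<^sub>C Kplus i (k + l) v) (E_coeff i) (F_coeff i) (\<lambda>_ _. 0)"
    by (rule heis_family_diagonal[OF vertex_opD(1)[OF vertex_op_Kp[OF i]] root_lattice_0 sq_nz])
      (use sq_nz nxt_neq[OF i] in \<open>auto simp: Kp_coeff_def E_coeff_def F_coeff_def q' power_int_minus field_simps abs_if\<close>)
  have famm: "heis_family N (\<lambda>k l m v. inverse sq powi (l - k) *\<^sub>C Kminus i (k + l) v) (E_coeff i) (F_coeff i) (\<lambda>_ _. 0)"
    by (rule heis_family_diagonal[OF vertex_opD(1)[OF vertex_op_Km[OF i]] root_lattice_0 isq])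
      (use sq_nz nxt_neq[OF i] in \<open>auto simp: Km_coeff_def E_coeff_def F_coeff_def q' power_int_minus power_int_inverse field_simps abs_if\<close>)
  note fam2 = heis_family_scale[OF heis_family_diff[OF famp famm], of "1 / (q - inverse q)"]
  have "Ep i k (F_op i l v) - F_op i l (Ep i k v)
    = (1 / (q - inverse q)) *\<^sub>C (sq powi (l - k) *\<^sub>C Kplus i (k + l) v - inverse sq powi (l - k) *\<^sub>C Kminus i (k + l) v)"
  proof (rule heis_family_eqI[OF fam1 fam2 _ v])
    fix k l m :: int and \<alpha> \<gamma>
    assume \<alpha>: "\<alpha> \<in> root_lattice N"
    let ?s = "lform (simple_root i) \<alpha>"
    define C where "C \<longleftrightarrow> k + l = 0 \<and> \<gamma> = \<alpha>"
    have aii: "cartan N i i = 2" using i by (simp add: cartan_eq)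
    \<comment> \<open>The values -1 meet the minus sign in the leading coefficient of
      \<open>F_op\<close>, so both orders enter with coefficient 1.\<close>
    have EF: "norm_const i * norm_const i * (F_char i \<alpha> * E_char i (\<alpha> + - simple_root i)) = -1"
      "norm_const i * norm_const i * (E_char i \<alpha> * F_char i (\<alpha> + simple_root i)) = -1"
    proof -
      have FE: "F_char i \<alpha> * E_char i \<alpha> = 1"
        using E_char_uminus[OF i \<alpha>] F_char_eq[OF i \<alpha>] by simp
      have "F_char i (simple_root i) = E_char i (- simple_root i)"
        by (rule F_char_eq[OF i simple_root_in[OF i]])
      then have *: "norm_const i * norm_const i * F_char i (simple_root i) = -1"
        using E_char_self[OF i] by simp
      have "norm_const i * norm_const i * (F_char i \<alpha> * E_char i (\<alpha> + - simple_root i))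
         = (F_char i \<alpha> * E_char i \<alpha>) * (norm_const i * norm_const i * E_char i (- simple_root i))"
        unfolding E.ch_add[OF i \<alpha> mi] by (simp only: mult_ac)
      then show "norm_const i * norm_const i * (F_char i \<alpha> * E_char i (\<alpha> + - simple_root i)) = -1"
        unfolding FE E_char_self[OF i] by simp
      have "norm_const i * norm_const i * (E_char i \<alpha> * F_char i (\<alpha> + simple_root i))
         = (F_char i \<alpha> * E_char i \<alpha>) * (norm_const i * norm_const i * F_char i (simple_root i))"
        unfolding F.ch_add[OF i \<alpha> simple_root_in[OF i]] by (simp only: mult_ac)
      then show "norm_const i * norm_const i * (E_char i \<alpha> * F_char i (\<alpha> + simple_root i)) = -1"
        unfolding FE * by simp
    qed
    have cond: "k + l = - ?s + 1 + (lform (simple_root i) (\<alpha> + - simple_root i) + 1) \<and> \<gamma> = \<alpha> + - simple_root i + simple_root i \<longleftrightarrow> C"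
      "l + k = ?s + 1 + (- lform (simple_root i) (\<alpha> + simple_root i) + 1) \<and> \<gamma> = \<alpha> + simple_root i + - simple_root i \<longleftrightarrow> C"
      unfolding C_def lform_add_right lform_uminus_right lform_simple_roots[OF i i] aii
      by auto
    have x: "l - (- ?s + 1) = l + ?s - 1" by simp
    have k: "fps_coeff ?G (k - (?s + 1)) = fps_coeff ?G (- (l + ?s) - 1)" if C
      by (rule arg_cong[where f = "fps_coeff ?G"]) (use that in \<open>simp add: C_def\<close>)
    have L: "lookup (Ep i k (F_op i l (vac \<alpha>))) (0, \<gamma>) = (if C then fps_coeff ?G (l + ?s - 1) else 0)"
      unfolding two_point_fps_coeff[OF vertex_op_E[OF i] vertex_op_F[OF i] G(1)] cond x
      using arg_cong[OF EF(1), of "\<lambda>t. - t * fps_coeff ?G (l + ?s - 1)"] by (simp add: mult_ac)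
    have R: "lookup (F_op i l (Ep i k (vac \<alpha>))) (0, \<gamma>) = (if C then fps_coeff ?G (- (l + ?s) - 1) else 0)"
      unfolding two_point_fps_coeff[OF vertex_op_F[OF i] vertex_op_E[OF i] G(2)] cond
      using arg_cong[OF EF(2), of "\<lambda>t. - t * fps_coeff ?G (- (l + ?s) - 1)"] by (simp add: mult_ac k)
    \<comment> \<open>On the support C one has l - k = 2 l, so the half powers of q combine to
      q^l.\<close>
    have P: "sq powi (l - k) * q powi ?s = q powi (l + ?s)" "inverse sq powi (l - k) * q powi (- ?s) = q powi (- (l + ?s))" if C
    proof -
      have k: "l - k = l + l" using that by (simp add: C_def)
      show "sq powi (l - k) * q powi ?s = q powi (l + ?s)" "inverse sq powi (l - k) * q powi (- ?s) = q powi (- (l + ?s))"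
        unfolding k q' power_int_inverse power_int_minus power_int_add[OF disjI1[OF sq_nz]]
        by (simp_all add: mult_ac)
    qed
    show "lookup (Ep i k (F_op i l (vac \<alpha>)) - F_op i l (Ep i k (vac \<alpha>))) (0, \<gamma>) =
      lookup ((1 / (q - inverse q)) *\<^sub>C (sq powi (l - k) *\<^sub>C Kplus i (k + l) (vac \<alpha>)
         - inverse sq powi (l - k) *\<^sub>C Kminus i (k + l) (vac \<alpha>))) (0, \<gamma>)"
    proof (cases C)
      case True
      then have "k + l = 0" "\<gamma> = \<alpha>" by (simp_all add: C_def)
      then show ?thesis
        unfolding lookup_minus lookup_cscale L R if_P[OF True] fps_coeff_quantum[OF q_nz q2]
          one_point[OF vertex_op_Kp[OF i]] one_point[OF vertex_op_Km[OF i]]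
        by (simp add: P[OF True] del: minus_add_distrib)
    next
      case False
      then have "\<not> (k + l = 0 \<and> \<gamma> = \<alpha> + 0)" by (simp add: C_def)
      then show ?thesis
        unfolding lookup_minus lookup_cscale L R if_not_P[OF False]
          one_point[OF vertex_op_Kp[OF i]] one_point[OF vertex_op_Km[OF i]]
        by auto
    qed
  qed
  then show ?thesis
    by (simp add: power_int_inverse flip: power_int_minus)
qed

end

lemma cscale_eq_mult: "c *\<^sub>C x = single 0 c * (x :: 'a free_alg)"
  by (simp add: cscale_def mult_map_scale_conv_mult)

lemma cscale_mult_left: "(c *\<^sub>C x) * y = c *\<^sub>C (x * (y :: 'a free_alg))"
  by (simp add: cscale_eq_mult mult.assoc)

lemma cscale_mult_right: "x * (c *\<^sub>C y) = c *\<^sub>C (x * (y :: 'a free_alg))"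
proof -
  have x: "x = (\<Sum>b\<in>keys x. single b (lookup x b))"
    using basis_expansion[of x] by simp
  have "x * single 0 c = single 0 c * x"
    by (subst (1 2) x) (simp add: sum_distrib_left sum_distrib_right mult_single mult.commute)
  then show ?thesis
    by (simp add: cscale_eq_mult flip: mult.assoc)
qed

section \<open>The homomorphism from the presented algebra\<close>

definition eval_word :: "('a \<Rightarrow> fock \<Rightarrow> fock) \<Rightarrow> 'a free_monoid \<Rightarrow> fock \<Rightarrow> fock" where
  "eval_word g w v = foldr g (letters w) v"

definition eval_free :: "('a \<Rightarrow> fock \<Rightarrow> fock) \<Rightarrow> 'a free_alg \<Rightarrow> fock \<Rightarrow> fock" where
  "eval_free g x v = (\<Sum>w\<in>keys x. lookup x w *\<^sub>C eval_word g w v)"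

lemma eval_free_superset:
  "finite A \<Longrightarrow> keys x \<subseteq> A \<Longrightarrow> eval_free g x v = (\<Sum>w\<in>A. lookup x w *\<^sub>C eval_word g w v)"
  unfolding eval_free_def by (rule sum.mono_neutral_left) (auto simp: in_keys_iff)

lemma lin_eval_free_left: "lin (\<lambda>x. eval_free g x v)"
proof (rule linI)
  fix x y :: "'a free_alg"
  show "eval_free g (x + y) v = eval_free g x v + eval_free g y v"
    using keys_add[of x y]
    by (simp add: eval_free_superset[of "keys x \<union> keys y"] lookup_add cscale_add_left sum.distrib)
next
  fix c and x :: "'a free_alg"
  show "eval_free g (c *\<^sub>C x) v = c *\<^sub>C eval_free g x v"
    using keys_cscale[of c x] by (simp add: eval_free_superset[of "keys x"] cscale_sum)
qed

lemmas eval_free_add = lin_add[OF lin_eval_free_left] and eval_free_diff = lin_diff[OF lin_eval_free_left]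
  and eval_free_cscale = lin_cscale[OF lin_eval_free_left] and eval_free_sum = lin_sum[OF lin_eval_free_left]
  and eval_free_0 = lin_0[OF lin_eval_free_left]

lemma eval_free_single: "eval_free g (single w c) v = c *\<^sub>C eval_word g w v"
  by (simp add: eval_free_def)

lemma eval_free_gen: "eval_free g (gen a) v = g a v"
  by (simp add: gen_def eval_free_single eval_word_def)

lemma eval_free_one: "eval_free g 1 v = v"
proof -
  have "eval_free g (single 0 1) v = v"
    unfolding eval_free_single by (simp add: eval_word_def zero_free_monoid_def)
  then show ?thesis by (simp only: single_one)
qed

lemma lin_eval_word: "(\<And>a. lin (g a)) \<Longrightarrow> lin (eval_word g w)"
proof -
  assume g: "\<And>a. lin (g a)"
  have "lin (\<lambda>v. foldr g xs v)" for xs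
    by (induction xs) (auto intro: lin_id lin_comp[OF g])
  then show ?thesis by (simp add: eval_word_def[abs_def])
qed

lemma lin_eval_free: "(\<And>a. lin (g a)) \<Longrightarrow> lin (eval_free g x)"
  unfolding eval_free_def[abs_def] by (intro lin_setsum lin_scale lin_eval_word)

text \<open>Both sides are linear in either factor, which reduces the claim to words; there
  concatenation becomes composition.\<close>

lemma eval_free_mult:
  assumes g: "\<And>a. lin (g a)"
  shows "eval_free g (x * y) v = eval_free g x (eval_free g y v)"
proof -
  have word: "eval_free g (bas w * bas w') v = eval_free g (bas w) (eval_free g (bas w') v)" for w w' :: "'a free_monoid"
    by (simp add: mult_single eval_free_single eval_word_def plus_free_monoid_def)
  have 1: "eval_free g (bas w * y) v = eval_free g (bas w) (eval_free g y v)" for w :: "'a free_monoid"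
  proof (rule lin_eqI[where S = "\<lambda>y. eval_free g (bas w * y) v" and T = "\<lambda>y. eval_free g (bas w) (eval_free g y v)" and v = y])
    show "lin (\<lambda>y. eval_free g (bas w * y) v)"
      by (rule linI) (simp_all only: distrib_left cscale_mult_right eval_free_add eval_free_cscale)
    show "lin (\<lambda>y. eval_free g (bas w) (eval_free g y v))"
      by (rule lin_comp[OF lin_eval_free[OF g] lin_eval_free_left])
  qed (rule word)
  show ?thesis
  proof (rule lin_eqI[where S = "\<lambda>x. eval_free g (x * y) v" and T = "\<lambda>x. eval_free g x (eval_free g y v)" and v = x])
    show "lin (\<lambda>x. eval_free g (x * y) v)"
      by (rule linI) (simp_all only: distrib_right cscale_mult_left eval_free_add eval_free_cscale)
  qed (rule lin_eval_free_left, rule 1)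
qed

section \<open>Exponentials over the free algebra and over the operators\<close>

context heis_exponent
begin

text \<open>The integer convolution rewritten as a Cauchy product over degrees in the direction s,
  the form taken by powers of formal power series.\<close>

lemma pow_Suc_sum: "ser_pow X (Suc m) (s * int n) v = (\<Sum>i\<le>n. X (s * int i) (ser_pow X m (s * int (n - i)) v))"
proof -
  have ss: "s * (s * k) = k" for k using s by auto
  let ?A = "(\<lambda>i. s * int (n - i)) ` {..n}"
  have "{k. X (s * int n - k) (ser_pow X m k v) \<noteq> 0} \<subseteq> ?A"
  proof
    fix k assume "k \<in> {k. X (s * int n - k) (ser_pow X m k v) \<noteq> 0}"
    then have "ser_pow X m k v \<noteq> 0" "\<not> s * (s * int n - k) \<le> 0"
      using lin_0[OF lin_X] X_zero by auto
    then have "s * k \<ge> 0" "s * k \<le> int n"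
      using pow_zero[of k m v] by (fastforce, simp add: right_diff_distrib ss)
    then have "k = s * int (n - (n - nat (s * k)))" by (simp add: ss)
    then show "k \<in> ?A" by (rule image_eqI) simp
  qed
  then have "ser_pow X (Suc m) (s * int n) v = (\<Sum>k\<in>?A. X (s * int n - k) (ser_pow X m k v))"
    by (simp add: ser_mult_def Sum_any.expand_superset[of ?A])
  also have "\<dots> = (\<Sum>i\<le>n. X (s * int n - s * int (n - i)) (ser_pow X m (s * int (n - i)) v))"
    by (rule sum.reindex_cong[OF _ refl refl]) (use s in \<open>auto simp: inj_on_def\<close>)
  also have "\<dots> = (\<Sum>i\<le>n. X (s * int i) (ser_pow X m (s * int (n - i)) v))"
    by (intro sum.cong refl) (simp add: of_nat_diff flip: right_diff_distrib)
  finally show ?thesis .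
qed

lemma eval_free_power:
  assumes g: "\<And>a. lin (g a)" and F: "\<And>n v. eval_free g (fps_nth F n) v = X (s * int n) v"
  shows "eval_free g (fps_nth (F ^ m) n) v = ser_pow X m (s * int n) v"
proof (induction m arbitrary: n v)
  case 0
  then show ?case
    using s by (auto simp: fps_one_nth eval_free_one eval_free_0 ser_const_def)
next
  case (Suc m)
  have "eval_free g (fps_nth (F ^ Suc m) n) v = (\<Sum>i\<le>n. X (s * int i) (ser_pow X m (s * int (n - i)) v))"
    by (simp add: fps_mult_nth eval_free_sum eval_free_mult[OF g] F Suc atLeast0AtMost)
  then show ?case by (simp only: pow_Suc_sum)
qed

lemma eval_free_exp:
  assumes g: "\<And>a. lin (g a)" and F: "\<And>n v. eval_free g (fps_nth F n) v = X (s * int n) v"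
  shows "eval_free g (fps_nth (free_exp F) n) v = ser_exp X (s * int n) v"
proof -
  have "nat (s * (s * int n)) \<le> n" using s by auto
  from exp_eq_sum[OF this, of v] show ?thesis
    by (simp add: free_exp_def eval_free_sum eval_free_cscale eval_free_power[OF g F])
qed

text \<open>The exponent is recovered recursively from its exponential.\<close>

lemma exponent_in_closed_set:
  assumes add: "\<And>S T. S \<in> G \<Longrightarrow> T \<in> G \<Longrightarrow> (\<lambda>v. S v + T v) \<in> G"
    and scale: "\<And>c T. T \<in> G \<Longrightarrow> (\<lambda>v. c *\<^sub>C T v) \<in> G"
    and comp: "\<And>S T. S \<in> G \<Longrightarrow> T \<in> G \<Longrightarrow> (\<lambda>v. S (T v)) \<in> G"
    and zero: "(\<lambda>v. 0) \<in> G" and one: "(\<lambda>v. v) \<in> G"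
    and exp: "\<And>k. ser_exp X k \<in> G"
  shows "X (s * int n) \<in> G"
proof (induction n rule: less_induct)
  case (less n)
  have sum: "(\<lambda>v. \<Sum>a\<in>A. T a v) \<in> G" if "\<And>a. a \<in> A \<Longrightarrow> T a \<in> G" for A and T :: "nat \<Rightarrow> fock \<Rightarrow> fock"
    using that by (induction A rule: infinite_finite_induct) (simp_all add: zero add)
  have pow: "ser_pow X m (s * int j) \<in> G" if "j < n" for m j
    using that
  proof (induction m arbitrary: j)
    case 0
    have "ser_pow X 0 (s * int j) = (if j = 0 then (\<lambda>v. v) else (\<lambda>v. 0))"
      using s by (auto simp: ser_const_def fun_eq_iff)
    then show ?case by (simp add: one zero)
  next
    case (Suc m)
    have "(\<lambda>v. \<Sum>i\<le>j. X (s * int i) (ser_pow X m (s * int (j - i)) v)) \<in> G"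
    proof (rule sum)
      fix i assume "i \<in> {..j}"
      with Suc.prems have "X (s * int i) \<in> G" "ser_pow X m (s * int (j - i)) \<in> G"
        using less Suc.IH[of "j - i"] by (simp_all del: of_nat_diff)
      then show "(\<lambda>v. X (s * int i) (ser_pow X m (s * int (j - i)) v)) \<in> G" by (rule comp)
    qed
    then show ?case by (simp only: pow_Suc_sum[abs_def])
  qed
  \<comment> \<open>With at least two factors, each of positive degree, every exponent that occurs
    has degree below n and is covered by the induction hypothesis.\<close>
  have pow2: "ser_pow X (Suc (Suc m)) (s * int n) \<in> G" for m
  proof -
    have "(\<Sum>i\<le>n. X (s * int i) (ser_pow X (Suc m) (s * int (n - i)) v))
        = (\<Sum>i\<in>{1..<n}. X (s * int i) (ser_pow X (Suc m) (s * int (n - i)) v))" for v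
    proof (rule sum.mono_neutral_right)
      show "\<forall>i\<in>{..n} - {1..<n}. X (s * int i) (ser_pow X (Suc m) (s * int (n - i)) v) = 0"
        using pow_zero[of 0 "Suc m" v] by (auto simp: X_zero lin_0[OF lin_X] not_less not_le less_Suc_eq_le simp del: ser_pow.simps)
    qed auto
    then have "ser_pow X (Suc (Suc m)) (s * int n) = (\<lambda>v. \<Sum>i\<in>{1..<n}. X (s * int i) (ser_pow X (Suc m) (s * int (n - i)) v))"
      by (simp only: pow_Suc_sum fun_eq_iff simp_thms)
    also have "\<dots> \<in> G"
    proof (rule sum)
      fix i assume "i \<in> {1..<n}"
      then have "X (s * int i) \<in> G" "ser_pow X (Suc m) (s * int (n - i)) \<in> G"
        using less pow[of "n - i" "Suc m"] by (simp_all del: ser_pow.simps of_nat_diff)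
      then show "(\<lambda>v. X (s * int i) (ser_pow X (Suc m) (s * int (n - i)) v)) \<in> G" by (rule comp)
    qed
    finally show ?thesis .
  qed
  show ?case
  proof (cases "n = 0")
    case True
    have "X 0 = (\<lambda>v. 0)" by (rule ext) (simp add: X_zero)
    then show ?thesis using True zero by simp
  next
    case False
    have X1: "ser_pow X 1 (s * int n) v = X (s * int n) v" for v
    proof -
      have "ser_pow X (Suc 0) (s * int n) v = (\<Sum>i\<in>{n}. X (s * int i) (ser_pow X 0 (s * int (n - i)) v))"
        unfolding pow_Suc_sum
        by (rule sum.mono_neutral_right) (use s in \<open>auto simp: ser_const_def lin_0[OF lin_X]\<close>)
      then show ?thesis by (simp add: ser_const_def)
    qed
    have P: "(\<lambda>v. \<Sum>m\<in>{2..n}. (1 / fact m) *\<^sub>C ser_pow X m (s * int n) v) \<in> G"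
    proof (rule sum, rule scale)
      fix m :: nat assume "m \<in> {2..n}"
      then obtain m' where "m = Suc (Suc m')" by (metis Suc_le_D atLeastAtMost_iff numeral_2_eq_2 Suc_le_mono)
      then show "ser_pow X m (s * int n) \<in> G" using pow2 by simp
    qed
    have e: "ser_exp X (s * int n) v = X (s * int n) v + (\<Sum>m\<in>{2..n}. (1 / fact m) *\<^sub>C ser_pow X m (s * int n) v)" for v
    proof -
      have 1: "{..n} = {0, 1} \<union> {2..n}" using False by auto
      have 2: "{0, 1} \<inter> {2..n} = {}" by auto
      have p0: "ser_pow X 0 (s * int n) v = 0" using False s by (auto simp: ser_const_def)
      have "nat (s * (s * int n)) \<le> n" using s by auto
      from exp_eq_sum[OF this, of v]
      have "ser_exp X (s * int n) v = (\<Sum>m\<in>{0, 1} \<union> {2..n}. (1 / fact m) *\<^sub>C ser_pow X m (s * int n) v)"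
        unfolding 1 .
      also have "\<dots> = (\<Sum>m\<in>{0, 1}. (1 / fact m) *\<^sub>C ser_pow X m (s * int n) v)
          + (\<Sum>m\<in>{2..n}. (1 / fact m) *\<^sub>C ser_pow X m (s * int n) v)"
        by (rule sum.union_disjoint) (use 2 in auto)
      also have "(\<Sum>m\<in>{0, 1}. (1 / fact m) *\<^sub>C ser_pow X m (s * int n) v) = X (s * int n) v"
        using p0 X1[of v] by (simp del: ser_pow.simps)
      finally show ?thesis .
    qed
    have "X (s * int n) = (\<lambda>v. ser_exp X (s * int n) v + (- 1) *\<^sub>C (\<Sum>m\<in>{2..n}. (1 / fact m) *\<^sub>C ser_pow X m (s * int n) v))"
      by (rule ext) (simp add: e cscale_uminus_left)
    also have "\<dots> \<in> G"
      by (rule add[OF exp scale[OF P]])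
    finally show ?thesis .
  qed
qed

end

section \<open>The free algebra over a generating set, and restriction to V_Q\<close>

definition words_over :: "'a set \<Rightarrow> 'a free_alg set" where
  "words_over X = {x. \<forall>w \<in> keys x. set (letters w) \<subseteq> X}"

lemma words_over_gen: "a \<in> X \<Longrightarrow> gen a \<in> words_over X"
  by (simp add: words_over_def gen_def)

lemma words_over_0: "0 \<in> words_over X" and words_over_1: "1 \<in> words_over X"
  by (simp_all add: words_over_def zero_free_monoid_def)

lemma words_over_add: "x \<in> words_over X \<Longrightarrow> y \<in> words_over X \<Longrightarrow> x + y \<in> words_over X"
  using keys_add[of x y] by (auto simp: words_over_def)

lemma words_over_cscale: "x \<in> words_over X \<Longrightarrow> c *\<^sub>C x \<in> words_over X"
  using keys_cscale[of c x] by (auto simp: words_over_def)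

lemma words_over_diff: "x \<in> words_over X \<Longrightarrow> y \<in> words_over X \<Longrightarrow> x - y \<in> words_over X"
  using words_over_add[of x X "(- 1) *\<^sub>C y"] words_over_cscale[of y X "- 1"]
  by (simp add: poly_mapping_eq_iff cscale_uminus_left)

lemma words_over_mult: "x \<in> words_over X \<Longrightarrow> y \<in> words_over X \<Longrightarrow> x * y \<in> words_over X"
  using keys_mult[of x y] by (fastforce simp: words_over_def plus_free_monoid_def)

lemma words_over_power: "x \<in> words_over X \<Longrightarrow> x ^ n \<in> words_over X"
  by (induction n) (auto intro: words_over_1 words_over_mult)

lemma words_over_sum: "(\<And>a. a \<in> A \<Longrightarrow> f a \<in> words_over X) \<Longrightarrow> sum f A \<in> words_over X"
  by (induction A rule: infinite_finite_induct) (auto intro: words_over_0 words_over_add)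

lemma words_over_fps_power:
  "(\<And>n. fps_nth F n \<in> words_over X) \<Longrightarrow> fps_nth (F ^ m) n \<in> words_over X"
proof (induction m arbitrary: n)
  case 0
  then show ?case by (simp add: fps_one_nth words_over_0 words_over_1)
next
  case (Suc m)
  then show ?case by (auto simp: fps_mult_nth intro!: words_over_sum words_over_mult)
qed

lemma words_over_free_exp:
  "(\<And>n. fps_nth F n \<in> words_over X) \<Longrightarrow> fps_nth (free_exp F) n \<in> words_over X"
  by (auto simp: free_exp_def intro!: words_over_sum words_over_cscale words_over_fps_power)

lemma free_algebra_simps [simp]:
  "carrier (free_algebra X) = words_over X" "mult (free_algebra X) = (*)" "one (free_algebra X) = 1"
  "zero (free_algebra X) = 0" "add (free_algebra X) = (+)" "smult (free_algebra X) = cscale"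
  by (simp_all add: free_algebra_def words_over_def)

lemma ring_free_algebra: "ring (free_algebra X)"
proof (rule ringI)
  show "abelian_group (free_algebra X)"
  proof (rule abelian_groupI)
    fix x assume "x \<in> carrier (free_algebra X)"
    then have "0 - x \<in> words_over X" by (intro words_over_diff words_over_0) simp
    then show "\<exists>y\<in>carrier (free_algebra X). y \<oplus>\<^bsub>free_algebra X\<^esub> x = \<zero>\<^bsub>free_algebra X\<^esub>"
      by (intro bexI[of _ "0 - x"]) simp_all
  qed (simp_all add: words_over_add words_over_0 ac_simps)
  show "Group.monoid (free_algebra X)"
    by (rule monoidI) (simp_all add: words_over_mult words_over_1 mult.assoc)
qed (simp_all add: algebra_simps)

lemma EndVQ_simps [simp]:
  "mult (EndVQ N) = compose (VQ N)" "one (EndVQ N) = (\<lambda>v \<in> VQ N. v)" "zero (EndVQ N) = (\<lambda>v \<in> VQ N. 0)"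
  "add (EndVQ N) = (\<lambda>S T. \<lambda>v \<in> VQ N. S v + T v)" "smult (EndVQ N) = (\<lambda>c T. \<lambda>v \<in> VQ N. c *\<^sub>C T v)"
  by (simp_all add: EndVQ_def)

lemma compose_restrict: "(\<And>v. v \<in> A \<Longrightarrow> T v \<in> A) \<Longrightarrow> compose A (restrict S A) (restrict T A) = restrict (\<lambda>v. S (T v)) A"
  by (auto simp: compose_def fun_eq_iff)

text \<open>The operators live on the larger type \<open>fock\<close>, while the target algebra
  consists of restrictions to V_Q. Invariance of V_Q makes restriction compatible with
  composition.\<close>

definition restricts_to :: "nat \<Rightarrow> (fock \<Rightarrow> fock) set \<Rightarrow> (fock \<Rightarrow> fock) set" where
  "restricts_to N S = {T. (\<forall>v\<in>VQ N. T v \<in> VQ N) \<and> restrict T (VQ N) \<in> generated_carrier (EndVQ N) S}"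

lemma restricts_to_add: "A \<in> restricts_to N S \<Longrightarrow> B \<in> restricts_to N S \<Longrightarrow> (\<lambda>v. A v + B v) \<in> restricts_to N S"
  using generated_carrier.add[of "restrict A (VQ N)" "EndVQ N" S "restrict B (VQ N)"]
  by (simp add: restricts_to_def VQ_add cong: restrict_cong)

lemma restricts_to_scale: "A \<in> restricts_to N S \<Longrightarrow> (\<lambda>v. c *\<^sub>C A v) \<in> restricts_to N S"
  using generated_carrier.smult[of "restrict A (VQ N)" "EndVQ N" S c]
  by (simp add: restricts_to_def VQ_cscale cong: restrict_cong)

lemma restricts_to_comp: "A \<in> restricts_to N S \<Longrightarrow> B \<in> restricts_to N S \<Longrightarrow> (\<lambda>v. A (B v)) \<in> restricts_to N S"
  using generated_carrier.mult[of "restrict A (VQ N)" "EndVQ N" S "restrict B (VQ N)"]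
  by (simp add: restricts_to_def compose_restrict)

lemma restricts_to_one: "(\<lambda>v. v) \<in> restricts_to N S"
  using generated_carrier.one[of "EndVQ N" S] by (simp add: restricts_to_def)

lemma restricts_to_zero: "(\<lambda>v. 0) \<in> restricts_to N S"
  using restricts_to_scale[OF restricts_to_one, of 0] by simp

lemma restricts_to_sum: "(\<And>a. a \<in> A \<Longrightarrow> T a \<in> restricts_to N S) \<Longrightarrow> (\<lambda>v. \<Sum>a\<in>A. T a v) \<in> restricts_to N S"
  by (induction A rule: infinite_finite_induct) (auto intro: restricts_to_zero restricts_to_add)

lemma restricts_to_eval_free:
  assumes g: "\<And>a. a \<in> X \<Longrightarrow> g a \<in> restricts_to N S" and x: "x \<in> words_over X"
  shows "eval_free g x \<in> restricts_to N S"
proof -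
  have "(\<lambda>v. foldr g xs v) \<in> restricts_to N S" if "set xs \<subseteq> X" for xs
    using that
  proof (induction xs)
    case (Cons a xs)
    then show ?case using restricts_to_comp[OF g, of a "foldr g xs"] by simp
  qed (simp add: restricts_to_one id_def)
  then have "(\<lambda>v. \<Sum>w\<in>keys x. lookup x w *\<^sub>C eval_word g w v) \<in> restricts_to N S"
    using x unfolding eval_word_def by (intro restricts_to_sum restricts_to_scale) (auto simp: words_over_def)
  then show ?thesis by (simp add: eval_free_def[abs_def])
qed

text \<open>The elements acting by 0 on V_Q form an ideal that contains R, so the action factors
  through the quotient. The map evaluates a chosen representative of a class; all of them act alike
  on V_Q.\<close>

theorem presented_algebra_hom:
  assumes lin: "\<And>a. lin (g a)" and gens: "\<And>a. a \<in> X \<Longrightarrow> g a \<in> restricts_to N S"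
    and R: "R \<subseteq> words_over X" and rel: "\<And>x v. x \<in> R \<Longrightarrow> v \<in> VQ N \<Longrightarrow> eval_free g x v = 0"
  obtains \<pi> where "\<pi> \<in> alg_hom (presented_algebra X R) (generated_subalg (EndVQ N) S)"
    "\<And>x. x \<in> words_over X \<Longrightarrow>
       \<pi> (presentation_ideal X R +>\<^bsub>free_algebra X\<^esub> x) = restrict (eval_free g x) (VQ N)"
proof -
  interpret ring "free_algebra X" by (rule ring_free_algebra)
  define K where "K = {x \<in> words_over X. \<forall>v\<in>VQ N. eval_free g x v = 0}"
  define I where "I = presentation_ideal X R"
  have VQ: "eval_free g x v \<in> VQ N" if "x \<in> words_over X" "v \<in> VQ N" for x v
    using restricts_to_eval_free[OF gens that(1)] that(2) by (simp add: restricts_to_def)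
  have "ideal K (free_algebra X)"
  proof (rule idealI[OF ring_free_algebra])
    show "subgroup K (add_monoid (free_algebra X))"
    proof (rule add.subgroupI)
      show "K \<noteq> {}" by (auto simp: K_def intro!: exI[of _ 0] words_over_0 eval_free_0)
      fix x assume x: "x \<in> K"
      have x': "x \<in> words_over X" using x by (simp add: K_def)
      have "\<ominus>\<^bsub>free_algebra X\<^esub> x = - x"
        by (rule minus_equality) (use x' words_over_diff[OF words_over_0 x'] in simp_all)
      then show "\<ominus>\<^bsub>free_algebra X\<^esub> x \<in> K"
        using x words_over_diff[OF words_over_0 x'] by (simp add: K_def lin_uminus[OF lin_eval_free_left])
    qed (auto simp: K_def words_over_add eval_free_add)
  qed (auto simp: K_def words_over_mult eval_free_mult[OF lin] VQ lin_0[OF lin_eval_free[OF lin]])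
  then have IK: "I \<subseteq> K"
    unfolding I_def presentation_ideal_def by (rule genideal_minimal) (use R rel in \<open>auto simp: K_def\<close>)
  interpret I: ideal I "free_algebra X"
    unfolding I_def presentation_ideal_def by (rule genideal_ideal) (use R in simp)
  define h where "h x = restrict (eval_free g x) (VQ N)" for x
  define \<pi> where "\<pi> C = h (SOME x. x \<in> C)" for C
  have coset: "\<exists>i\<in>I. y = i + x" if "y \<in> I +>\<^bsub>free_algebra X\<^esub> x" for x y
    using that by (auto simp: a_r_coset_def r_coset_def)
  have h_coset: "h y = h x" if "y \<in> I +>\<^bsub>free_algebra X\<^esub> x" for x y
    using coset[OF that] IK by (auto simp: h_def K_def eval_free_add fun_eq_iff restrict_def)
  have \<pi>: "\<pi> C = h y" if "y \<in> C" "C \<subseteq> I +>\<^bsub>free_algebra X\<^esub> x" for C x y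
  proof -
    have "(SOME x. x \<in> C) \<in> C" using that(1) by (rule someI)
    then show ?thesis using that h_coset unfolding \<pi>_def by (metis subsetD)
  qed
  have self: "x \<in> I +>\<^bsub>free_algebra X\<^esub> x" if "x \<in> words_over X" for x
    using I.a_rcos_self[of x] that by simp
  have \<pi>_coset: "\<pi> (I +>\<^bsub>free_algebra X\<^esub> x) = h x" if "x \<in> words_over X" for x
    using \<pi>[OF self[OF that] subset_refl] .
  have carrier: "\<exists>x\<in>words_over X. C = I +>\<^bsub>free_algebra X\<^esub> x" if "C \<in> carrier (presented_algebra X R)" for C
    using that by (auto simp: presented_algebra_def quot_alg_def FactRing_def A_RCOSETS_def' I_def)
  have hom_mult: "compose (VQ N) (h x) (h y) = h (x * y)" if "y \<in> words_over X" for x y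
    unfolding h_def by (subst compose_restrict) (use VQ[OF that] in \<open>auto simp: eval_free_mult[OF lin] fun_eq_iff restrict_def\<close>)
  have "\<pi> \<in> alg_hom (presented_algebra X R) (generated_subalg (EndVQ N) S)"
    unfolding alg_hom_def
  proof (intro CollectI conjI allI ballI)
    show "\<pi> \<in> ring_hom (presented_algebra X R) (generated_subalg (EndVQ N) S)"
    proof (rule ring_hom_memI)
      fix C assume "C \<in> carrier (presented_algebra X R)"
      then obtain x where x: "x \<in> words_over X" "C = I +>\<^bsub>free_algebra X\<^esub> x"
        using carrier by blast
      then show "\<pi> C \<in> carrier (generated_subalg (EndVQ N) S)"
        using restricts_to_eval_free[OF gens x(1)] by (simp add: \<pi>_coset h_def generated_subalg_def restricts_to_def)
      fix D assume "D \<in> carrier (presented_algebra X R)"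
      then obtain y where y: "y \<in> words_over X" "D = I +>\<^bsub>free_algebra X\<^esub> y"
        using carrier by blast
      have "C \<otimes>\<^bsub>presented_algebra X R\<^esub> D = I +>\<^bsub>free_algebra X\<^esub> (x * y)"
        using I.rcoset_mult_add[of x y] x y by (simp add: presented_algebra_def quot_alg_def FactRing_def I_def)
      then show "\<pi> (C \<otimes>\<^bsub>presented_algebra X R\<^esub> D) = \<pi> C \<otimes>\<^bsub>generated_subalg (EndVQ N) S\<^esub> \<pi> D"
        using x y by (simp add: \<pi>_coset words_over_mult generated_subalg_def hom_mult)
      have "C \<oplus>\<^bsub>presented_algebra X R\<^esub> D = I +>\<^bsub>free_algebra X\<^esub> (x + y)"
        using I.a_rcos_sum[of x y] x y by (simp add: presented_algebra_def quot_alg_def FactRing_def I_def)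
      then show "\<pi> (C \<oplus>\<^bsub>presented_algebra X R\<^esub> D) = \<pi> C \<oplus>\<^bsub>generated_subalg (EndVQ N) S\<^esub> \<pi> D"
        using x y by (simp add: \<pi>_coset words_over_add generated_subalg_def h_def eval_free_add fun_eq_iff restrict_def)
    next
      have "\<one>\<^bsub>presented_algebra X R\<^esub> = I +>\<^bsub>free_algebra X\<^esub> 1"
        by (simp add: presented_algebra_def quot_alg_def FactRing_def I_def)
      then show "\<pi> \<one>\<^bsub>presented_algebra X R\<^esub> = \<one>\<^bsub>generated_subalg (EndVQ N) S\<^esub>"
        by (simp add: \<pi>_coset words_over_1 generated_subalg_def h_def eval_free_one fun_eq_iff restrict_def)
    qed
  next
    fix c C assume "C \<in> carrier (presented_algebra X R)"
    then obtain x where x: "x \<in> words_over X" "C = I +>\<^bsub>free_algebra X\<^esub> x"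
      using carrier by blast
    have smult: "c \<odot>\<^bsub>presented_algebra X R\<^esub> C = (\<Union>y\<in>C. I +>\<^bsub>free_algebra X\<^esub> (c *\<^sub>C y))"
      by (simp add: presented_algebra_def quot_alg_def I_def)
    \<comment> \<open>A scalar multiple of a class is defined as a union over its representatives,
      so the value is checked at every element of this union.\<close>
    have h_all: "h z = h (c *\<^sub>C x)" if z: "z \<in> c \<odot>\<^bsub>presented_algebra X R\<^esub> C" for z
    proof -
      obtain y where y: "y \<in> C" "z \<in> I +>\<^bsub>free_algebra X\<^esub> (c *\<^sub>C y)" using z unfolding smult by blast
      have "h y = h x" using h_coset y(1) x(2) by simp
      then have "eval_free g y v = eval_free g x v" if "v \<in> VQ N" for v
        using that by (auto simp: h_def dest!: fun_cong[of _ _ v])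
      then have "h (c *\<^sub>C y) = h (c *\<^sub>C x)"
        by (auto simp: h_def eval_free_cscale fun_eq_iff restrict_def)
      then show ?thesis using h_coset[OF y(2)] by simp
    qed
    have "c *\<^sub>C x \<in> c \<odot>\<^bsub>presented_algebra X R\<^esub> C"
      unfolding smult using self[OF x(1)] self[OF words_over_cscale[OF x(1)]] x(2) by blast
    then have "(SOME z. z \<in> c \<odot>\<^bsub>presented_algebra X R\<^esub> C) \<in> c \<odot>\<^bsub>presented_algebra X R\<^esub> C" by (rule someI)
    then have "\<pi> (c \<odot>\<^bsub>presented_algebra X R\<^esub> C) = h (c *\<^sub>C x)"
      unfolding \<pi>_def by (rule h_all)
    then show "\<pi> (c \<odot>\<^bsub>presented_algebra X R\<^esub> C) = c \<odot>\<^bsub>generated_subalg (EndVQ N) S\<^esub> \<pi> C"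
      using x by (simp add: \<pi>_coset generated_subalg_def h_def eval_free_cscale fun_eq_iff restrict_def)
  qed
  then show thesis
    using that \<pi>_coset unfolding I_def h_def by blast
qed

section \<open>Images of the generators and vanishing of the relators\<close>

context fock_rep
begin

text \<open>Signs of indices are reversed since \<open>GE i k\<close> belongs to z^(-k). The images
  of \<open>GH\<close> are obtained by dividing the exponents of the Cartan currents by q - q^(-1),
  with a further sign for negative l. In \<open>GE\<close> and \<open>GF\<close> an index outside
  the diagram gives 0, so that every image is linear.\<close>

primrec gen_op :: "toroidal_gen \<Rightarrow> fock \<Rightarrow> fock" where
  "gen_op (GE i k) = (if i < N then Ep i (- k) else (\<lambda>_. 0))"
| "gen_op (GF i k) = (if i < N then F_op i (- k) else (\<lambda>_. 0))"
| "gen_op (GH i l) = (\<lambda>v. if l > 0 then (1 / (q - inverse q)) *\<^sub>C Kp_exponent i (- l) v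
     else (- 1 / (q - inverse q)) *\<^sub>C Km_exponent i (- l) v)"
| "gen_op (GK i) = scalar_op q (simple_root i)"
| "gen_op (GKinv i) = scalar_op (inverse q) (simple_root i)"
| "gen_op GC = (\<lambda>v. sq *\<^sub>C v)"
| "gen_op GCinv = (\<lambda>v. inverse sq *\<^sub>C v)"

lemma lin_gen_op: "lin (gen_op x)"
proof (cases x)
  case (GH i l)
  then show ?thesis
    using heis_exponent.lin_X[OF heis_exponent_Kp] heis_exponent.lin_X[OF heis_exponent_Km]
    by (cases "l > 0") (simp_all add: lin_scale)
qed (simp_all add: lin_zero lin_scale[OF lin_id] lin_scalar_op
    vertex_seriesD(1)[OF vertex_opD(1)[OF vertex_op_E]] vertex_seriesD(1)[OF vertex_opD(1)[OF vertex_op_F]])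

abbreviation ev :: "toroidal_gen free_alg \<Rightarrow> fock \<Rightarrow> fock" where
  "ev \<equiv> eval_free gen_op"

lemmas ev_simps = eval_free_add eval_free_diff eval_free_cscale eval_free_sum eval_free_gen eval_free_one
  eval_free_mult[OF lin_gen_op]

lemma ev_k_plus: "i < N \<Longrightarrow> ev (k_plus q i n) v = Kplus i (- n) v"
proof (cases "n < 0")
  case True
  moreover assume "i < N"
  ultimately show ?thesis by (simp add: k_plus_def eval_free_0 K_zero)
next
  case False
  assume i: "i < N"
  let ?F = "Abs_fps (\<lambda>k. if k = 0 then 0 else (q - inverse q) *\<^sub>C gen (GH i (int k)))"
  note he = heis_exponent_Kp[of i]
  have "ev (fps_nth ?F k) v = Kp_exponent i (- 1 * int k) v" for k v
    using heis_exponent.X_zero[OF he, of 0 v] q_diff_nz by (simp add: ev_simps eval_free_0)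
  from heis_exponent.eval_free_exp[OF he lin_gen_op this] False show ?thesis
    by (simp add: k_plus_def ev_simps Kp_ser_eq[OF i] ser_mult_const_left[OF lin_scalar_op])
qed

lemma ev_k_minus: "i < N \<Longrightarrow> ev (k_minus q i n) v = Kminus i n v"
proof (cases "n < 0")
  case True
  moreover assume "i < N"
  ultimately show ?thesis by (simp add: k_minus_def eval_free_0 K_zero)
next
  case False
  assume i: "i < N"
  let ?F = "Abs_fps (\<lambda>k. if k = 0 then 0 else (- (q - inverse q)) *\<^sub>C gen (GH i (- int k)))"
  note he = heis_exponent_Km[of i]
  have "ev (fps_nth ?F k) v = Km_exponent i (1 * int k) v" for k v
  proof (cases "k = 0")
    case True
    then show ?thesis using heis_exponent.X_zero[OF he, of 0 v] by (simp add: eval_free_0)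
  next
    case False
    have "- c * (- 1 / c) = 1" if "c \<noteq> 0" for c :: complex using that by simp
    note this[OF q_diff_nz]
    with False show ?thesis by (simp only: fps_nth_Abs_fps if_False ev_simps gen_op.simps) simp
  qed
  from heis_exponent.eval_free_exp[OF he lin_gen_op this] False show ?thesis
    by (simp add: k_minus_def ev_simps Km_ser_eq[OF i] ser_mult_const_left[OF lin_scalar_op])
qed

lemma ev_cpow: "ev (cpow n) v = sq powi n *\<^sub>C v"
proof -
  have "ev (gen GC ^ k) v = sq ^ k *\<^sub>C v" "ev (gen GCinv ^ k) v = inverse sq ^ k *\<^sub>C v" for k
    by (induction k) (simp_all add: ev_simps)
  then show ?thesis by (simp add: cpow_def power_int_def)
qed

lemma gens_mem: "i < N \<Longrightarrow> GE i k \<in> toroidal_gens N" "i < N \<Longrightarrow> GF i k \<in> toroidal_gens N"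
  "i < N \<Longrightarrow> l \<noteq> 0 \<Longrightarrow> GH i l \<in> toroidal_gens N" "i < N \<Longrightarrow> GK i \<in> toroidal_gens N"
  "i < N \<Longrightarrow> GKinv i \<in> toroidal_gens N" "GC \<in> toroidal_gens N" "GCinv \<in> toroidal_gens N"
  by (auto simp: toroidal_gens_def)

lemma words_over_k_plus: "i < N \<Longrightarrow> k_plus q i n \<in> words_over (toroidal_gens N)"
  by (auto simp: k_plus_def intro!: words_over_0 words_over_mult words_over_free_exp words_over_cscale words_over_gen gens_mem)

lemma words_over_k_minus: "i < N \<Longrightarrow> k_minus q i n \<in> words_over (toroidal_gens N)"
  by (auto simp: k_minus_def intro!: words_over_0 words_over_mult words_over_free_exp words_over_cscale words_over_gen gens_mem)

lemma words_over_cpow: "cpow n \<in> words_over (toroidal_gens N)"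
  by (auto simp: cpow_def intro!: words_over_power words_over_gen gens_mem)

lemma relators_words_over: "toroidal_relators N q d \<subseteq> words_over (toroidal_gens N)"
proof
  fix x assume "x \<in> toroidal_relators N q d"
  then show "x \<in> words_over (toroidal_gens N)"
    by cases (simp_all only:, intro words_over_diff words_over_add words_over_mult words_over_cscale words_over_sum
      words_over_1 words_over_k_plus words_over_k_minus words_over_cpow words_over_gen gens_mem; assumption)+
qed

lemma scalar_op_inverse: "c \<noteq> 0 \<Longrightarrow> scalar_op c \<beta> (scalar_op (inverse c) \<beta> v) = v"
proof (rule lin_eqI[where S = "\<lambda>v. scalar_op c \<beta> (scalar_op (inverse c) \<beta> v)", OF lin_comp[OF lin_scalar_op lin_scalar_op] lin_id])
  fix b :: fock_basis
  assume "c \<noteq> 0"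
  then show "scalar_op c \<beta> (scalar_op (inverse c) \<beta> (bas b)) = bas b"
    by (cases b) (simp add: scalar_op_def power_int_inverse)
qed

lemma relators_vanish:
  assumes "x \<in> toroidal_relators N q d" and v: "v \<in> VQ N"
  shows "ev x v = 0"
  using assms(1)
proof cases
  case (k_kinv i)
  then show ?thesis using scalar_op_inverse[OF q_nz] by (simp add: ev_simps)
next
  case (kinv_k i)
  then show ?thesis using scalar_op_inverse[of "inverse q"] q_nz by (simp add: ev_simps)
next
  case c_cinv
  then show ?thesis using sq_nz by (simp add: ev_simps)
next
  case cinv_c
  then show ?thesis using sq_nz by (simp add: ev_simps)
next
  case (c_central y)
  then show ?thesis by (simp add: ev_simps lin_cscale[OF lin_gen_op])
next
  case (cinv_central y)
  then show ?thesis by (simp add: ev_simps lin_cscale[OF lin_gen_op])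
next
  case (kp_kp i j r s)
  then show ?thesis using Kp_Kp[OF _ _ v] by (simp add: ev_simps ev_k_plus)
next
  case (km_km i j r s)
  then show ?thesis using Km_Km[OF _ _ v] by (simp add: ev_simps ev_k_minus)
next
  case (kp_km i j r s)
  \<comment> \<open>As c acts by \<open>sq\<close>, its square acts by q, which gives the arguments
    of the two sides of \<open>Kp_Km\<close>.\<close>
  have "sq powi (2 * int n) = q ^ n" "sq powi (- 2 * int n) = inverse q ^ n" for n
    by (simp_all add: power_int_mult sq_eq power_int_minus power_inverse)
  with kp_km Kp_Km[OF kp_km(2,3) v, of r s] show ?thesis
    by (simp add: ev_simps ev_k_plus ev_k_minus ev_cpow mult.assoc)
next
  case (kp_e i j r l)
  with Kp_E[OF kp_e(2,3) v, of r "- l"] show ?thesis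
    by (simp add: ev_simps ev_k_plus ev_cpow power_int_minus power_inverse mult.assoc)
next
  case (km_e i j r l)
  with Km_E[OF km_e(2,3) v, of r "- l"] show ?thesis
    by (simp add: ev_simps ev_k_minus ev_cpow power_int_minus power_inverse mult.assoc)
next
  case (kp_f i j r l)
  with Kp_F[OF kp_f(2,3) v, of r "- l"] show ?thesis
    by (simp add: ev_simps ev_k_plus ev_cpow power_int_minus power_inverse mult.assoc)
next
  case (km_f i j r l)
  with Km_F[OF km_f(2,3) v, of r "- l"] show ?thesis
    by (simp add: ev_simps ev_k_minus ev_cpow power_int_minus power_inverse mult.assoc)
next
  case (e_f i j k l)
  show ?thesis
  proof (cases "i = j")
    case True
    with e_f E_F_commutator[OF e_f(2) v, of "- k" "- l"] show ?thesis
      by (simp add: ev_simps ev_k_plus ev_k_minus ev_cpow kron_eq)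
  next
    case False
    with e_f E_F_commute[OF e_f(2,3) _ v, of "- k" "- l"] show ?thesis
      by (simp add: ev_simps kron_eq)
  qed
next
  case (e_e i j k l)
  with E.quadratic[OF e_e(2,3) v, of "- k" "- l"] show ?thesis
    by (simp add: ev_simps power_int_inverse power_int_minus)
next
  case (f_f i j k l)
  \<comment> \<open>\<open>F.quadratic\<close> is the relation divided by q^(a_ij); multiplying back
    gives the relator.\<close>
  let ?A = "q powi cartan N i j"
  have A: "?A * inverse ?A = 1" "?A * (inverse ?A * c) = c" for c using q_nz by simp_all
  show ?thesis
    using arg_cong[OF F.quadratic[OF f_f(2,3) v, of "- k" "- l"], of "\<lambda>u. ?A *\<^sub>C u"] f_f(2,3)
    by (simp add: f_f(1) ev_simps cscale_diff power_int_minus A)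
next
  case (serre_e i j k\<^sub>1 k\<^sub>2 l)
  with E.serre[OF serre_e(2,3,4) v, of "- k\<^sub>1" "- k\<^sub>2" "- l"] show ?thesis
    by (simp add: ev_simps add.commute[of q])
next
  case (serre_f i j k\<^sub>1 k\<^sub>2 l)
  with F.serre[OF serre_f(2,3,4) v, of "- k\<^sub>1" "- k\<^sub>2" "- l"] show ?thesis
    by (simp add: ev_simps)
next
  case (e_commute i j k l)
  with E.commute[OF e_commute(2,3,4) v] show ?thesis by (simp add: ev_simps)
next
  case (f_commute i j k l)
  with F.commute[OF f_commute(2,3,4) v] show ?thesis by (simp add: ev_simps)
qed

definition series_coeffs :: "(fock \<Rightarrow> fock) set" where
  "series_coeffs = (\<Union>i<N. range (coef N (Ep i)) \<union> range (coef N (F_ser N \<epsilon> q p sp d i)) \<union>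
            range (coef N (Kplus i)) \<union> range (coef N (Kminus i)))"

lemma restricts_to_series:
  assumes i: "i < N"
  shows "Ep i k \<in> restricts_to N series_coeffs" "F_op i k \<in> restricts_to N series_coeffs"
    "Kplus i k \<in> restricts_to N series_coeffs" "Kminus i k \<in> restricts_to N series_coeffs"
proof -
  have mem: "restrict (Ep i k) (VQ N) \<in> series_coeffs" "restrict (F_ser N \<epsilon> q p sp d i k) (VQ N) \<in> series_coeffs"
    "restrict (Kplus i k) (VQ N) \<in> series_coeffs" "restrict (Kminus i k) (VQ N) \<in> series_coeffs"
    using i by (auto simp: series_coeffs_def coef_def intro!: bexI[of _ i])
  show "Ep i k \<in> restricts_to N series_coeffs" "Kplus i k \<in> restricts_to N series_coeffs"
    "Kminus i k \<in> restricts_to N series_coeffs"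
    using mem vertex_series_VQ[OF vertex_opD(1)[OF vertex_op_E[OF i]] simple_root_in[OF i]]
      vertex_series_VQ[OF vertex_opD(1)[OF vertex_op_Kp[OF i]] root_lattice_0]
      vertex_series_VQ[OF vertex_opD(1)[OF vertex_op_Km[OF i]] root_lattice_0]
    by (auto simp: restricts_to_def intro: generated_carrier.gen)
  have "F_op i k v \<in> VQ N" if "v \<in> VQ N" for v
    by (rule vertex_series_VQ[OF vertex_opD(1)[OF vertex_op_F[OF i]] root_lattice_uminus[OF simple_root_in[OF i]] that])
  moreover have "restrict (F_op i k) (VQ N) = (- 1) \<odot>\<^bsub>EndVQ N\<^esub> restrict (F_ser N \<epsilon> q p sp d i k) (VQ N)"
    by (auto simp: F_op_def fun_eq_iff restrict_def)
  ultimately show "F_op i k \<in> restricts_to N series_coeffs"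
    using mem(2) by (auto simp: restricts_to_def simp del: EndVQ_simps intro: generated_carrier.intros)
qed

text \<open>The target is generated by the coefficients of the series only. The operators
  \<open>K_op\<close> are the constant terms of the Cartan currents; stripping them off leaves pure
  exponentials, from which \<open>exponent_in_closed_set\<close> recovers the images of
  \<open>GH\<close>.\<close>

lemma restricts_to_gen_op:
  assumes "x \<in> toroidal_gens N"
  shows "gen_op x \<in> restricts_to N series_coeffs"
proof -
  note closed = restricts_to_add restricts_to_scale restricts_to_zero restricts_to_one
  have K: "scalar_op q (simple_root i) \<in> restricts_to N series_coeffs"
    "scalar_op (inverse q) (simple_root i) \<in> restricts_to N series_coeffs" if i: "i < N" for i
  proof -
    have "scalar_op q (simple_root i) = Kplus i 0" "scalar_op (inverse q) (simple_root i) = Kminus i 0"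
      by (simp_all add: fun_eq_iff Kp_ser_eq[OF i] Km_ser_eq[OF i] ser_mult_const_left[OF lin_scalar_op]
        heis_exponent.exp_0[OF heis_exponent_Kp] heis_exponent.exp_0[OF heis_exponent_Km])
    then show "scalar_op q (simple_root i) \<in> restricts_to N series_coeffs"
      "scalar_op (inverse q) (simple_root i) \<in> restricts_to N series_coeffs"
      using restricts_to_series[OF i] by simp_all
  qed
  have exp: "ser_exp (Kp_exponent i) k \<in> restricts_to N series_coeffs" "ser_exp (Km_exponent i) k \<in> restricts_to N series_coeffs"
    if i: "i < N" for i k
  proof -
    have "ser_exp (Kp_exponent i) k = (\<lambda>v. scalar_op (inverse q) (simple_root i) (Kplus i k v))"
      "ser_exp (Km_exponent i) k = (\<lambda>v. scalar_op q (simple_root i) (Kminus i k v))"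
      using scalar_op_inverse[of "inverse q"] scalar_op_inverse[of q] q_nz
      by (simp_all add: fun_eq_iff Kp_ser_eq[OF i] Km_ser_eq[OF i] ser_mult_const_left[OF lin_scalar_op])
    then show "ser_exp (Kp_exponent i) k \<in> restricts_to N series_coeffs" "ser_exp (Km_exponent i) k \<in> restricts_to N series_coeffs"
      using restricts_to_comp[OF K(2)[OF i] restricts_to_series(3)[OF i]]
        restricts_to_comp[OF K(1)[OF i] restricts_to_series(4)[OF i]] by simp_all
  qed
  have X: "Kp_exponent i (- int n) \<in> restricts_to N series_coeffs" "Km_exponent i (int n) \<in> restricts_to N series_coeffs"
    if i: "i < N" for i n
  proof -
    let ?G = "restricts_to N series_coeffs"
    have "Kp_exponent i (- 1 * int n) \<in> ?G"
    proof (rule heis_exponent.exponent_in_closed_set[OF heis_exponent_Kp])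
      show "(\<lambda>v. A (B v)) \<in> ?G" if "A \<in> ?G" "B \<in> ?G" for A B
        using restricts_to_comp[OF that] .
    qed (rule closed exp[OF i]; assumption)+
    then show "Kp_exponent i (- int n) \<in> ?G" by simp
    have "Km_exponent i (1 * int n) \<in> ?G"
    proof (rule heis_exponent.exponent_in_closed_set[OF heis_exponent_Km])
      show "(\<lambda>v. A (B v)) \<in> ?G" if "A \<in> ?G" "B \<in> ?G" for A B
        using restricts_to_comp[OF that] .
    qed (rule closed exp[OF i]; assumption)+
    then show "Km_exponent i (int n) \<in> ?G" by simp
  qed
  have "gen_op (GH i l) \<in> restricts_to N series_coeffs" if i: "i < N" for i l
  proof (cases "l > 0")
    case True
    then have "gen_op (GH i l) = (\<lambda>v. (1 / (q - inverse q)) *\<^sub>C Kp_exponent i (- int (nat l)) v)"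
      by simp
    then show ?thesis by (simp only: restricts_to_scale[OF X(1)[OF i]])
  next
    case False
    then have "gen_op (GH i l) = (\<lambda>v. (- 1 / (q - inverse q)) *\<^sub>C Km_exponent i (int (nat (- l))) v)"
      by simp
    then show ?thesis by (simp only: restricts_to_scale[OF X(2)[OF i]])
  qed
  then show ?thesis
    using assms K restricts_to_series restricts_to_scale[OF restricts_to_one]
    unfolding toroidal_gens_def by (auto simp del: gen_op.simps(3))
qed

lemma toroidal_representation:
  "\<exists>\<pi> \<in> alg_hom (toroidal_algebra N q d) (vertex_algebra N \<epsilon> q sq p sp d).
    (\<forall>i<N. \<forall>k::int.
       \<pi> (tcls N q d (gen (GE i k))) = coef N (E_ser N \<epsilon> q p sp d i) (- k) \<and>
       \<pi> (tcls N q d (gen (GF i k))) = (-1) \<odot>\<^bsub>EndVQ N\<^esub> coef N (F_ser N \<epsilon> q p sp d i) (- k) \<and>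
       \<pi> (tcls N q d (k_plus q i k)) = coef N (Kp_ser N q sq p sp d i) (- k) \<and>
       \<pi> (tcls N q d (k_minus q i k)) = coef N (Km_ser N q sq p sp d i) k) \<and>
    (\<forall>i<N. \<pi> (tcls N q d (gen (GK i))) = restrict (K_op N q 1 i) (VQ N) \<and>
           \<pi> (tcls N q d (gen (GKinv i))) = restrict (K_op N q (-1) i) (VQ N)) \<and>
    \<pi> (tcls N q d (gen GC)) = sq \<odot>\<^bsub>EndVQ N\<^esub> \<one>\<^bsub>EndVQ N\<^esub>"
proof -
  obtain \<pi> where \<pi>: "\<pi> \<in> alg_hom (presented_algebra (toroidal_gens N) (toroidal_relators N q d))
        (generated_subalg (EndVQ N) series_coeffs)"
      "\<And>x. x \<in> words_over (toroidal_gens N) \<Longrightarrow> \<pi> (tcls N q d x) = restrict (ev x) (VQ N)"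
    by (rule presented_algebra_hom[OF lin_gen_op restricts_to_gen_op relators_words_over relators_vanish])
      (auto simp: tcls_def)
  show ?thesis
  proof (intro bexI[of _ \<pi>] conjI allI impI)
    show "\<pi> \<in> alg_hom (toroidal_algebra N q d) (vertex_algebra N \<epsilon> q sq p sp d)"
      using \<pi>(1) by (simp add: toroidal_algebra_def vertex_algebra_def series_coeffs_def)
  qed (auto simp: \<pi>(2) words_over_gen gens_mem words_over_k_plus words_over_k_minus coef_def K_op_def F_op_def
      ev_k_plus ev_k_minus eval_free_gen fun_eq_iff restrict_def simple_root_def power_int_minus)
qed

end

theorem theorem3p2:
  fixes N :: nat and q d p sq sp :: complex and \<epsilon> :: "lattice \<Rightarrow> lattice \<Rightarrow> complex"
  assumes "N \<ge> 3"
    and "q \<noteq> 0" and "\<forall>n::nat. n > 0 \<longrightarrow> q ^ n \<noteq> 1"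
    and "d \<noteq> 0" and "p = d powi (- int N)"
    and "sq ^ 2 = q" and "sp ^ 2 = p"
    and "lattice_cocycle N \<epsilon>"
  shows "\<exists>\<pi> \<in> alg_hom (toroidal_algebra N q d) (vertex_algebra N \<epsilon> q sq p sp d).
    (\<forall>i<N. \<forall>k::int.
       \<pi> (tcls N q d (gen (GE i k))) = coef N (E_ser N \<epsilon> q p sp d i) (- k) \<and>
       \<pi> (tcls N q d (gen (GF i k))) = (-1) \<odot>\<^bsub>EndVQ N\<^esub> coef N (F_ser N \<epsilon> q p sp d i) (- k) \<and>
       \<pi> (tcls N q d (k_plus q i k)) = coef N (Kp_ser N q sq p sp d i) (- k) \<and>
       \<pi> (tcls N q d (k_minus q i k)) = coef N (Km_ser N q sq p sp d i) k) \<and>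
    (\<forall>i<N. \<pi> (tcls N q d (gen (GK i))) = restrict (K_op N q 1 i) (VQ N) \<and>
           \<pi> (tcls N q d (gen (GKinv i))) = restrict (K_op N q (-1) i) (VQ N)) \<and>
    \<pi> (tcls N q d (gen GC)) = sq \<odot>\<^bsub>EndVQ N\<^esub> \<one>\<^bsub>EndVQ N\<^esub>"
  proof -
  interpret fock_rep N q d p sq sp \<epsilon>
    by unfold_locales (fact assms)+
  show ?thesis by (rule toroidal_representation)
qed

end
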